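(* Let $\Bbbk$ be a field and let $\Delta$ be a pure simplicial complex. Then $\Delta$ has a Cohen--Macaulay extender (over $\Bbbk$) if and only if $\operatorname{depth}\Bbbk[\Delta]\ge\dim\Bbbk[\Delta]-1$.
   Context: All simplicial complexes are finite: a simplicial complex is a collection of finite subsets of a finite ground set, closed under taking subsets; $\dim\sigma=|\sigma|-1$, and a $d$-dimensional complex ($d\ge-1$) contains the empty face. It is pure if all its maximal faces have the same dimension. $\Bbbk[\Delta]=\Bbbk[x_1,\dots,x_n]/I_\Delta$ is the Stanley--Reisner ring, where $I_\Delta$ is the ideal generated by the squarefree monomials of non-faces of $\Delta$; for $\dim\Delta=d$ one has $\dim\Bbbk[\Delta]=d+1$. A complex $\Gamma$ is Cohen--Macaulay (over $\Bbbk$) if $\operatorname{depth}\Bbbk[\Gamma]=\dim\Bbbk[\Gamma]$; equivalently, $\tilde H_i(\operatorname{lk}_\Gamma(\sigma);\Bbbk)=0$ for all $\sigma\in\Gamma$ and all $i\ne\dim\Gamma-|\sigma|$, where $\operatorname{lk}_\Gamma(\sigma)=\{\tau\in\Gamma : \sigma\cup\tau\in\Gamma,\ \sigma\cap\tau=\varnothing\}$. For a subcomplex $\Delta\subseteq\Gamma$ with $\dim\Gamma=d$, the relative complex $(\Gamma,\Delta)$ (the faces of $\Gamma$ not in $\Delta$) is relative Cohen--Macaulay if $I_\Delta/I_\Gamma$ is a Cohen--Macaulay module over the polynomial ring $\Bbbk[\mathbf x]$ on the vertices of $\Gamma$ (the zero module being allowed). Equivalently, for every $\sigma\in\Gamma$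 the relative homology $\tilde H_i(\operatorname{lk}_\Gamma(\sigma),\operatorname{lk}_\Delta(\sigma);\Bbbk)$ vanishes except possibly when $|\sigma|+i=d$, where $\operatorname{lk}_\Delta(\sigma)$ is the void complex if $\sigma\notin\Delta$, in which case the relative homology is $\tilde H_i(\operatorname{lk}_\Gamma(\sigma);\Bbbk)$. A Cohen--Macaulay extender for a pure $d$-dimensional complex $\Delta$ is a $d$-dimensional complex $\Gamma$ such that $\Delta\subseteq\Gamma$, $\Gamma$ is Cohen--Macaulay, and $(\Gamma,\Delta)$ is relative Cohen--Macaulay. $\Gamma$ may use more vertices than $\Delta$. *)

theory Defs
  imports
    "HOL-Algebra.QuotRing"
    "HOL-Algebra.Module"
    "HOL-Library.Poly_Mapping"
    "HOL-Library.Extended_Nat"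
    "HOL-Library.Infinite_Typeclass"
begin

section \<open>Simplicial complexes\<close>

text \<open>
  The void complex, which has no faces at all, is allowed here; it differs from
  the complex whose only face is the empty one.
\<close>

definition simplicial_complex :: "'v set set \<Rightarrow> bool" where
  "simplicial_complex \<Delta> \<longleftrightarrow> finite (\<Union>\<Delta>) \<and> (\<forall>\<sigma>\<in>\<Delta>. \<forall>\<tau>. \<tau> \<subseteq> \<sigma> \<longrightarrow> \<tau> \<in> \<Delta>)"

definition face_dim :: "'v set \<Rightarrow> int" where
  "face_dim \<sigma> = int (card \<sigma>) - 1"

text \<open>Only meaningful for a complex with at least one face.\<close>

definition complex_dim :: "'v set set \<Rightarrow> int" where
  "complex_dim \<Delta> = Max (face_dim ` \<Delta>)"

definition facets :: "'v set set \<Rightarrow> 'v set set" where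
  "facets \<Delta> = {\<sigma> \<in> \<Delta>. \<forall>\<tau>\<in>\<Delta>. \<sigma> \<subseteq> \<tau> \<longrightarrow> \<tau> = \<sigma>}"

definition pure_complex :: "'v set set \<Rightarrow> bool" where
  "pure_complex \<Delta> \<longleftrightarrow> (\<forall>\<sigma>\<in>facets \<Delta>. \<forall>\<tau>\<in>facets \<Delta>. face_dim \<sigma> = face_dim \<tau>)"


section \<open>Krull dimension, regular sequences and depth\<close>

text \<open>
  The Krull dimension of the zero ring comes out as \<open>0\<close> and not as minus
  infinity; below, the zero module is treated separately.
\<close>

definition krull_dim :: "('a, 'b) ring_scheme \<Rightarrow> enat" where
  "krull_dim R = Sup {enat l | l.
     \<exists>P :: nat \<Rightarrow> 'a set. (\<forall>i\<le>l. primeideal (P i) R) \<and> (\<forall>i<l. P i \<subset> P (Suc i))}"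

definition annihilator :: "('a, 'b) ring_scheme \<Rightarrow> ('a, 'm, 'c) module_scheme \<Rightarrow> 'a set" where
  "annihilator R M = {r \<in> carrier R. \<forall>m \<in> carrier M. r \<odot>\<^bsub>M\<^esub> m = \<zero>\<^bsub>M\<^esub>}"

definition module_dim :: "('a, 'b) ring_scheme \<Rightarrow> ('a, 'm, 'c) module_scheme \<Rightarrow> enat" where
  "module_dim R M = krull_dim (R Quot (annihilator R M))"

text \<open>The submodule \<open>(f\<^sub>1, \<dots>, f\<^sub>r) M\<close> of \<open>M\<close>.\<close>

definition ideal_mult_module :: "('a, 'm, 'c) module_scheme \<Rightarrow> 'a list \<Rightarrow> 'm set" where
  "ideal_mult_module M fs =
     {finsum M (\<lambda>i. fs ! i \<odot>\<^bsub>M\<^esub> m i) {..<length fs} | m. m \<in> {..<length fs} \<rightarrow> carrier M}"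

text \<open>
  \<open>f\<^sub>i\<close> is a nonzerodivisor on \<open>M / (f\<^sub>1, \<dots>, f\<^sub>i\<^sub>-\<^sub>1) M\<close> for all \<open>i\<close>, and
  \<open>M / (f\<^sub>1, \<dots>, f\<^sub>r) M\<close> is nonzero.
\<close>

definition regular_sequence ::
    "('a, 'b) ring_scheme \<Rightarrow> ('a, 'm, 'c) module_scheme \<Rightarrow> 'a list \<Rightarrow> bool" where
  "regular_sequence R M fs \<longleftrightarrow>
     set fs \<subseteq> carrier R \<and>
     (\<forall>i<length fs. \<forall>m\<in>carrier M.
        fs ! i \<odot>\<^bsub>M\<^esub> m \<in> ideal_mult_module M (take i fs) \<longrightarrow> m \<in> ideal_mult_module M (take i fs)) \<and>
     ideal_mult_module M fs \<noteq> carrier M"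

definition module_depth ::
    "('a, 'b) ring_scheme \<Rightarrow> 'a set \<Rightarrow> ('a, 'm, 'c) module_scheme \<Rightarrow> enat" where
  "module_depth R I M = Sup {enat (length fs) | fs. regular_sequence R M fs \<and> set fs \<subseteq> I}"

text \<open>
  The quotient \<open>J/I\<close> of ideals \<open>I \<subseteq> J\<close> as a module over \<open>R\<close>. The fields
  \<open>mult\<close> and \<open>one\<close> play no role for modules; they are filled in as for the ring \<open>R Quot I\<close>.
\<close>

definition quotient_module ::
    "('a, 'b) ring_scheme \<Rightarrow> 'a set \<Rightarrow> 'a set \<Rightarrow> ('a, 'a set) module" where
  "quotient_module R J I =
     \<lparr>carrier = (\<lambda>x. I +>\<^bsub>R\<^esub> x) ` J, mult = rcoset_mult R I, one = I +>\<^bsub>R\<^esub> \<one>\<^bsub>R\<^esub>,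
      zero = I, add = set_add R, smult = (\<lambda>r C. rcoset_mult R I (I +>\<^bsub>R\<^esub> r) C)\<rparr>"


section \<open>Stanley--Reisner rings\<close>

text \<open>
  A polynomial maps exponent vectors to coefficients, and an exponent
  vector maps variables to exponents; both maps have finite support.
\<close>

type_synonym ('v, 'k) mpoly = "('v \<Rightarrow>\<^sub>0 nat) \<Rightarrow>\<^sub>0 'k"

definition poly_ring :: "'v set \<Rightarrow> ('v, 'k::comm_ring_1) mpoly ring" where
  "poly_ring V =
     \<lparr>carrier = {p. \<forall>e\<in>Poly_Mapping.keys p. Poly_Mapping.keys e \<subseteq> V}, mult = (*), one = 1, zero = 0, add = (+)\<rparr>"

definition variable :: "'v \<Rightarrow> ('v, 'k::comm_ring_1) mpoly" where
  "variable v = Poly_Mapping.single (Poly_Mapping.single v 1) 1"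

definition irrelevant_ideal :: "'v set \<Rightarrow> ('v, 'k::comm_ring_1) mpoly set" where
  "irrelevant_ideal V = Idl\<^bsub>poly_ring V\<^esub> (variable ` V)"

text \<open>
  The set of variables \<open>V\<close> may be larger than the vertex set \<open>\<Union>\<Delta>\<close>: in a relative complex
  \<open>(\<Gamma>, \<Delta>)\<close> the ideals of both complexes live in the polynomial ring on the vertices of \<open>\<Gamma>\<close>.
\<close>

definition sr_ideal :: "'v set \<Rightarrow> 'v set set \<Rightarrow> ('v, 'k::comm_ring_1) mpoly set" where
  "sr_ideal V \<Delta> = Idl\<^bsub>poly_ring V\<^esub> {\<Prod>v\<in>\<sigma>. variable v | \<sigma>. \<sigma> \<subseteq> V \<and> \<sigma> \<notin> \<Delta>}"

definition sr_ring :: "'v set set \<Rightarrow> ('v, 'k::field) mpoly set ring" where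
  "sr_ring \<Delta> = poly_ring (\<Union>\<Delta>) Quot sr_ideal (\<Union>\<Delta>) \<Delta>"

definition sr_dim :: "'k::field itself \<Rightarrow> 'v set set \<Rightarrow> enat" where
  "sr_dim _ \<Delta> = krull_dim (sr_ring \<Delta> :: ('v, 'k) mpoly set ring)"

text \<open>The depth of the Stanley--Reisner ring as a graded module over the polynomial ring.\<close>

definition sr_depth :: "'k::field itself \<Rightarrow> 'v set set \<Rightarrow> enat" where
  "sr_depth _ \<Delta> =
     (let R = poly_ring (\<Union>\<Delta>) :: ('v, 'k) mpoly ring
      in module_depth R (irrelevant_ideal (\<Union>\<Delta>))
           (quotient_module R (carrier R) (sr_ideal (\<Union>\<Delta>) \<Delta>)))"


section \<open>Cohen--Macaulay complexes and extenders\<close>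

definition cohen_macaulay_complex :: "'k::field itself \<Rightarrow> 'v set set \<Rightarrow> bool" where
  "cohen_macaulay_complex k \<Gamma> \<longleftrightarrow> sr_depth k \<Gamma> = sr_dim k \<Gamma>"

definition cohen_macaulay_module ::
    "'v set \<Rightarrow> (('v, 'k::field) mpoly, 'm, 'c) module_scheme \<Rightarrow> bool" where
  "cohen_macaulay_module V M \<longleftrightarrow>
     carrier M = {\<zero>\<^bsub>M\<^esub>} \<or>
     module_depth (poly_ring V) (irrelevant_ideal V) M = module_dim (poly_ring V) M"

definition relative_cohen_macaulay :: "'k::field itself \<Rightarrow> 'v set set \<Rightarrow> 'v set set \<Rightarrow> bool" where
  "relative_cohen_macaulay _ \<Gamma> \<Delta> \<longleftrightarrow>
     (let V = \<Union>\<Gamma>; R = poly_ring V :: ('v, 'k) mpoly ring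
      in cohen_macaulay_module V (quotient_module R (sr_ideal V \<Delta>) (sr_ideal V \<Gamma>)))"

definition cm_extender :: "'k::field itself \<Rightarrow> 'v set set \<Rightarrow> 'v set set \<Rightarrow> bool" where
  "cm_extender k \<Delta> \<Gamma> \<longleftrightarrow>
     simplicial_complex \<Gamma> \<and> \<Delta> \<subseteq> \<Gamma> \<and> complex_dim \<Gamma> = complex_dim \<Delta> \<and>
     cohen_macaulay_complex k \<Gamma> \<and> relative_cohen_macaulay k \<Gamma> \<Delta>"

end

theory Submission
  imports Defs "HOL-Library.FuncSet"
begin

text \<open>
  If \<open>\<Gamma>\<close> is an extender, the exact sequence \<open>0 \<rightarrow> I\<^sub>\<Delta>/I\<^sub>\<Gamma> \<rightarrow> k[\<Gamma>] \<rightarrow> k[\<Delta>] \<rightarrow> 0\<close> and the depth lemma give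
  \<open>depth k[\<Delta>] \<ge> dim k[\<Delta>] - 1\<close>, since \<open>\<Gamma>\<close> is pure and hence \<open>I\<^sub>\<Delta>/I\<^sub>\<Gamma>\<close> is zero or of full dimension.
  Conversely, let \<open>\<Gamma>\<close> be the \<open>d\<close>-skeleton of the simplex on the vertices of \<open>\<Delta>\<close>, where \<open>d = dim \<Delta>\<close>: it is
  Cohen--Macaulay, and the depth lemma bounds the depth of \<open>I\<^sub>\<Delta>/I\<^sub>\<Gamma>\<close> from below by \<open>d + 1\<close>.

  The depth lemma needs no homological algebra: as all maximal regular sequences behave alike (Rees) and
  finitely many modules of positive depth have a common nonzerodivisor (prime avoidance), one can divide
  all three modules of an exact sequence by the same element and argue by induction. The same kind of
  induction produces from a regular sequence a chain of primes, so that depth is bounded by dimension,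
  and dimensions of Stanley--Reisner rings are bounded by counting monomials: if \<open>\<Delta>\<close> has dimension \<open>d\<close>,
  then \<open>d + 2\<close> polynomials are algebraically dependent modulo \<open>I\<^sub>\<Delta>\<close>.
\<close>

section \<open>Depth over Noetherian rings\<close>

text \<open>The elements of a regular sequence may be arbitrary polynomials without constant term.
  This is what lets prime avoidance work over every field, finite ones included, where linear forms
  would not suffice. It is replaced by localization at 1 + \<mm>, carried out inside the ring by
  saturating ideals. Only monomials have to survive this, and they do, because 1 - a has constant
  term 1 for a in \<mm>. All modules that occur, kernels included, are quotients of two ideals of
  one polynomial ring, so the arguments need no abstract modules; these enter only in the comparison
  with the definitions. That the skeleton of the simplex is Cohen--Macaulay is again a case of the
  depth lemma: minimal nonfaces are added one by one until the full simplex is reached. An extender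
  may have vertices outside \<Delta>. The depth of k[\<Delta>] must then be compared over two
  polynomial rings, by setting the additional variables to zero.\<close>

definition subring_set :: "'a::comm_ring_1 set \<Rightarrow> bool" where
  "subring_set S \<longleftrightarrow> 1 \<in> S \<and> (\<forall>x\<in>S. \<forall>y\<in>S. x - y \<in> S \<and> x * y \<in> S)"

text \<open>Rings are subsets of a type that is itself a commutative ring. Polynomial rings in
  different sets of variables thus share one type and its arithmetic, and only the set
  \<open>S\<close> of admissible multipliers changes.\<close>

definition ideal_in :: "'a::comm_ring_1 set \<Rightarrow> 'a set \<Rightarrow> bool" where
  "ideal_in S N \<longleftrightarrow> N \<subseteq> S \<and> 0 \<in> N \<and> (\<forall>x\<in>N. \<forall>y\<in>N. x + y \<in> N) \<and> (\<forall>s\<in>S. \<forall>x\<in>N. s * x \<in> N)"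

definition prime_in :: "'a::comm_ring_1 set \<Rightarrow> 'a set \<Rightarrow> bool" where
  "prime_in S P \<longleftrightarrow> ideal_in S P \<and> 1 \<notin> P \<and> (\<forall>a\<in>S. \<forall>b\<in>S. a * b \<in> P \<longrightarrow> a \<in> P \<or> b \<in> P)"

text \<open>The Noetherian property, in the form in which maximal annihilators and other extremal
  ideals are extracted from it.\<close>

definition max_condition :: "'a::comm_ring_1 set \<Rightarrow> bool" where
  "max_condition S \<longleftrightarrow> (\<forall>\<F>. \<F> \<noteq> {} \<and> (\<forall>N\<in>\<F>. ideal_in S N) \<longrightarrow> (\<exists>M\<in>\<F>. \<forall>N\<in>\<F>. M \<subseteq> N \<longrightarrow> N = M))"

text \<open>A module \<open>M = N/N'\<close> is given by the two ideals \<open>N' \<subseteq> N\<close>; then \<open>M/fM\<close> is given by \<open>N\<close> and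
  \<open>add_multiples f N N'\<close>.\<close>

definition add_multiples :: "'a::comm_ring_1 \<Rightarrow> 'a set \<Rightarrow> 'a set \<Rightarrow> 'a set" where
  "add_multiples f N N' = {y + f * z | y z. y \<in> N' \<and> z \<in> N}"

definition nonzerodivisor :: "'a::comm_ring_1 \<Rightarrow> 'a set \<Rightarrow> 'a set \<Rightarrow> bool" where
  "nonzerodivisor f N N' \<longleftrightarrow> (\<forall>u\<in>N. f * u \<in> N' \<longrightarrow> u \<in> N')"

primrec depth_ge :: "'a::comm_ring_1 set \<Rightarrow> nat \<Rightarrow> 'a set \<Rightarrow> 'a set \<Rightarrow> bool" where
  "depth_ge \<mm> 0 N N' \<longleftrightarrow> True"
| "depth_ge \<mm> (Suc n) N N' \<longleftrightarrow> (\<exists>f\<in>\<mm>. nonzerodivisor f N N' \<and> depth_ge \<mm> n N (add_multiples f N N'))"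

lemma nonzerodivisorD: "nonzerodivisor f N N' \<Longrightarrow> u \<in> N \<Longrightarrow> f * u \<in> N' \<Longrightarrow> u \<in> N'"
  by (simp add: nonzerodivisor_def)

lemma subring_setD:
  assumes "subring_set S"
  shows "1 \<in> S" "0 \<in> S" "\<And>x y. x \<in> S \<Longrightarrow> y \<in> S \<Longrightarrow> x + y \<in> S"
    "\<And>x y. x \<in> S \<Longrightarrow> y \<in> S \<Longrightarrow> x - y \<in> S" "\<And>x y. x \<in> S \<Longrightarrow> y \<in> S \<Longrightarrow> x * y \<in> S"
    "\<And>x. x \<in> S \<Longrightarrow> - x \<in> S"
proof -
  show 1: "1 \<in> S" and d: "\<And>x y. x \<in> S \<Longrightarrow> y \<in> S \<Longrightarrow> x - y \<in> S"
    and "\<And>x y. x \<in> S \<Longrightarrow> y \<in> S \<Longrightarrow> x * y \<in> S"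
    using assms by (auto simp: subring_set_def)
  show z: "0 \<in> S" using d[OF 1 1] by simp
  show m: "- x \<in> S" if "x \<in> S" for x using d[OF z that] by simp
  show "x + y \<in> S" if "x \<in> S" "y \<in> S" for x y using d[OF that(1) m[OF that(2)]] by simp
qed

locale subring_context =
  fixes S :: "'a::comm_ring_1 set"
  assumes subring: "subring_set S"
begin

lemmas S_simps [simp, intro] = subring_setD[OF subring]

lemma idealD:
  assumes "ideal_in S N"
  shows "N \<subseteq> S" "0 \<in> N" "\<And>x y. x \<in> N \<Longrightarrow> y \<in> N \<Longrightarrow> x + y \<in> N"
    "\<And>s x. s \<in> S \<Longrightarrow> x \<in> N \<Longrightarrow> s * x \<in> N" "\<And>s x. s \<in> S \<Longrightarrow> x \<in> N \<Longrightarrow> x * s \<in> N"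
    "\<And>x. x \<in> N \<Longrightarrow> x \<in> S"
    "\<And>x. x \<in> N \<Longrightarrow> - x \<in> N" "\<And>x y. x \<in> N \<Longrightarrow> y \<in> N \<Longrightarrow> x - y \<in> N"
proof -
  show "N \<subseteq> S" "0 \<in> N" and ad: "\<And>x y. x \<in> N \<Longrightarrow> y \<in> N \<Longrightarrow> x + y \<in> N"
    and mu: "\<And>s x. s \<in> S \<Longrightarrow> x \<in> N \<Longrightarrow> s * x \<in> N" "\<And>x. x \<in> N \<Longrightarrow> x \<in> S"
    using assms by (auto simp: ideal_in_def)
  then show "\<And>s x. s \<in> S \<Longrightarrow> x \<in> N \<Longrightarrow> x * s \<in> N" by (metis mult.commute)
  show n: "- x \<in> N" if "x \<in> N" for x using mu(1)[of "-1", OF _ that] by simp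
  show "x - y \<in> N" if "x \<in> N" "y \<in> N" for x y using ad[OF that(1) n[OF that(2)]] by simp
qed

lemma idealI:
  assumes "N \<subseteq> S" "0 \<in> N" "\<And>x y. x \<in> N \<Longrightarrow> y \<in> N \<Longrightarrow> x + y \<in> N"
    "\<And>s x. s \<in> S \<Longrightarrow> x \<in> N \<Longrightarrow> s * x \<in> N"
  shows "ideal_in S N"
  using assms by (auto simp: ideal_in_def)

lemma ideal_S: "ideal_in S S"
  by (rule idealI) auto

lemma ideal_add_multiples:
  assumes "f \<in> S" "ideal_in S N" "ideal_in S N'"
  shows "ideal_in S (add_multiples f N N')"
proof (rule idealI)
  show "add_multiples f N N' \<subseteq> S"
    using assms idealD(6)[OF assms(2)] idealD(6)[OF assms(3)] by (auto simp: add_multiples_def)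
  show "0 \<in> add_multiples f N N'"
    using idealD(2)[OF assms(2)] idealD(2)[OF assms(3)] unfolding add_multiples_def by force
next
  fix a b assume "a \<in> add_multiples f N N'" "b \<in> add_multiples f N N'"
  then obtain y z y' z' where "a = y + f * z" "b = y' + f * z'" "y \<in> N'" "z \<in> N" "y' \<in> N'" "z' \<in> N"
    by (auto simp: add_multiples_def)
  then have "a + b = (y + y') + f * (z + z')" "y + y' \<in> N'" "z + z' \<in> N"
    using idealD(3)[OF assms(2)] idealD(3)[OF assms(3)] by (auto simp: algebra_simps)
  then show "a + b \<in> add_multiples f N N'" unfolding add_multiples_def by blast
next
  fix s a assume s: "s \<in> S" and "a \<in> add_multiples f N N'"
  then obtain y z where "a = y + f * z" "y \<in> N'" "z \<in> N"
    by (auto simp: add_multiples_def)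
  then have "s * a = s * y + f * (s * z)" "s * y \<in> N'" "s * z \<in> N"
    using s idealD(4)[OF assms(2)] idealD(4)[OF assms(3)] by (auto simp: algebra_simps)
  then show "s * a \<in> add_multiples f N N'" unfolding add_multiples_def by blast
qed

lemma add_multiples_upper: "ideal_in S N \<Longrightarrow> N' \<subseteq> add_multiples f N N'"
  unfolding add_multiples_def using idealD(2)[of N] by force

lemma add_multiplesI: "y \<in> N' \<Longrightarrow> z \<in> N \<Longrightarrow> y + f * z \<in> add_multiples f N N'"
  unfolding add_multiples_def by blast

lemma mult_in_add_multiples: "ideal_in S N' \<Longrightarrow> z \<in> N \<Longrightarrow> f * z \<in> add_multiples f N N'"
  using add_multiplesI[of 0 N' z N f] idealD(2)[of N'] by simp

lemma add_multiplesE: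
  assumes "x \<in> add_multiples f N N'"
  obtains y z where "x = y + f * z" "y \<in> N'" "z \<in> N"
  using assms unfolding add_multiples_def by blast

lemma add_multiples_subset:
  assumes "f \<in> S" "ideal_in S N" "N' \<subseteq> N"
  shows "add_multiples f N N' \<subseteq> N"
  using assms idealD[OF assms(2)] by (auto simp: add_multiples_def)

lemma add_multiples_commute:
  "add_multiples f N (add_multiples g N N') = add_multiples g N (add_multiples f N N')"
proof -
  have "add_multiples f N (add_multiples g N N') \<subseteq> add_multiples g N (add_multiples f N N')" for f g
  proof
    fix x assume "x \<in> add_multiples f N (add_multiples g N N')"
    then obtain y z w where "x = (y + g * z) + f * w" "y \<in> N'" "z \<in> N" "w \<in> N"
      by (auto simp: add_multiples_def)
    then have "x = (y + f * w) + g * z" "y + f * w \<in> add_multiples f N N'" "z \<in> N"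
      by (simp_all add: algebra_simps add_multiplesI)
    then show "x \<in> add_multiples g N (add_multiples f N N')" unfolding add_multiples_def by blast
  qed
  then show ?thesis by blast
qed

end

locale noetherian_subring = subring_context +
  assumes max_cond: "max_condition S"
begin

lemma max_elem:
  assumes "N0 \<in> \<F>" "\<And>N. N \<in> \<F> \<Longrightarrow> ideal_in S N"
  obtains M where "M \<in> \<F>" "\<And>N. N \<in> \<F> \<Longrightarrow> M \<subseteq> N \<Longrightarrow> N = M"
  using max_cond assms unfolding max_condition_def by (metis empty_iff)

lemma max_elem_above:
  assumes "N0 \<in> \<F>" "\<And>N. N \<in> \<F> \<Longrightarrow> ideal_in S N"
  obtains M where "M \<in> \<F>" "N0 \<subseteq> M" "\<And>N. N \<in> \<F> \<Longrightarrow> M \<subseteq> N \<Longrightarrow> N = M"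
proof -
  have *: "N0 \<in> {N \<in> \<F>. N0 \<subseteq> N}" "\<And>N. N \<in> {N \<in> \<F>. N0 \<subseteq> N} \<Longrightarrow> ideal_in S N" using assms by auto
  show thesis
    by (rule max_elem[OF *]) (use that in blast)+
qed

section \<open>Associated primes and prime avoidance\<close>

definition annih :: "'a \<Rightarrow> 'a set \<Rightarrow> 'a set" where
  "annih u N' = {s \<in> S. s * u \<in> N'}"

lemma ideal_annih: "ideal_in S N' \<Longrightarrow> u \<in> S \<Longrightarrow> ideal_in S (annih u N')"
  by (rule idealI) (auto simp: annih_def algebra_simps idealD)

text \<open>These are the associated primes of N/N' that are maximal among the annihilators of
  nonzero elements. Their union is the set of zerodivisors on N/N', and they are all that is needed
  of the associated primes.\<close>

definition maximal_annih :: "'a set \<Rightarrow> 'a set \<Rightarrow> 'a set \<Rightarrow> bool" where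
  "maximal_annih N N' P \<longleftrightarrow> (\<exists>u\<in>N - N'. P = annih u N') \<and> (\<forall>u\<in>N - N'. P \<subseteq> annih u N' \<longrightarrow> annih u N' = P)"

text \<open>If a b kills u and b does not, then the annihilator of b u contains a as well as the
  annihilator of u, and by maximality it equals the latter.\<close>

lemma maximal_annih_prime:
  assumes "ideal_in S N" "ideal_in S N'" "maximal_annih N N' P"
  shows "prime_in S P"
proof -
  obtain u where u: "u \<in> N" "u \<notin> N'" "P = annih u N'" using assms by (auto simp: maximal_annih_def)
  have P: "ideal_in S P" using u ideal_annih[OF assms(2)] idealD(6)[OF assms(1)] by blast
  moreover have "1 \<notin> P" using u by (auto simp: annih_def)
  moreover have "a \<in> P \<or> b \<in> P" if ab: "a \<in> S" "b \<in> S" "a * b \<in> P" for a b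
  proof (cases "b \<in> P")
    case False
    then have bu: "b * u \<in> N - N'" using u ab assms by (auto simp: annih_def idealD)
    have "P \<subseteq> annih (b * u) N'"
    proof
      fix s assume "s \<in> P"
      then have "s \<in> S" "b * (s * u) \<in> N'" using u assms ab by (auto simp: annih_def idealD)
      then show "s \<in> annih (b * u) N'" by (simp add: annih_def algebra_simps)
    qed
    then have "annih (b * u) N' = P" using assms(3) bu by (auto simp: maximal_annih_def)
    moreover have "a \<in> annih (b * u) N'" using ab u by (auto simp: annih_def algebra_simps)
    ultimately show ?thesis by blast
  qed simp
  ultimately show ?thesis by (auto simp: prime_in_def)
qed

lemma maximal_annih_exists:
  assumes "ideal_in S N" "ideal_in S N'" "u \<in> N - N'"
  obtains P where "maximal_annih N N' P" "annih u N' \<subseteq> P"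
proof -
  have *: "annih u N' \<in> (\<lambda>u. annih u N') ` (N - N')"
    "\<And>M. M \<in> (\<lambda>u. annih u N') ` (N - N') \<Longrightarrow> ideal_in S M"
    using assms ideal_annih idealD(6)[OF assms(1)] by auto
  obtain P where P: "P \<in> (\<lambda>u. annih u N') ` (N - N')" "annih u N' \<subseteq> P"
    "\<And>M. M \<in> (\<lambda>u. annih u N') ` (N - N') \<Longrightarrow> P \<subseteq> M \<Longrightarrow> M = P"
    using max_elem_above[OF *] by blast
  have "maximal_annih N N' P" using P(1,3) unfolding maximal_annih_def by blast
  then show thesis using P(2) that by blast
qed

text \<open>The element is a product of one element of I and one of each Q, all taken outside P;
  primality keeps the product outside P.\<close>

lemma prime_contains_factor:
  assumes "prime_in S P" "finite A" "\<And>Q. Q \<in> A \<Longrightarrow> ideal_in S Q" "\<And>Q. Q \<in> A \<Longrightarrow> \<not> Q \<subseteq> P"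
    "ideal_in S I" "\<not> I \<subseteq> P"
  obtains y where "y \<in> I" "y \<notin> P" "\<And>Q. Q \<in> A \<Longrightarrow> y \<in> Q"
proof -
  have "\<exists>y. y \<in> I \<and> y \<notin> P \<and> (\<forall>Q\<in>A. y \<in> Q)"
    using assms(2,3,4)
  proof (induction A)
    case empty
    then show ?case using assms by auto
  next
    case (insert Q A)
    have "\<exists>y. y \<in> I \<and> y \<notin> P \<and> (\<forall>Q\<in>A. y \<in> Q)"
      by (rule insert.IH) (simp_all add: insert.prems)
    then obtain y where y: "y \<in> I" "y \<notin> P" "\<forall>Q\<in>A. y \<in> Q" by blast
    obtain z where z: "z \<in> Q" "z \<notin> P" using insert.prems(2)[of Q] by blast
    have Q: "ideal_in S Q" using insert.prems(1)[of Q] by simp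
    have zy: "y \<in> S" "z \<in> S" using idealD(6)[OF assms(5) y(1)] idealD(6)[OF Q z(1)] by auto
    have "z * y \<notin> P" using zy y z assms by (auto simp: prime_in_def)
    moreover have "z * y \<in> I" using idealD(4)[OF assms(5) zy(2) y(1)] .
    moreover have "z * y \<in> Q" using idealD(5)[OF Q zy(1) z(1)] .
    moreover have "\<forall>Q\<in>A. z * y \<in> Q" using idealD(4)[OF insert.prems(1) zy(2)] y by simp
    ultimately show ?case by blast
  qed
  then show thesis using that by blast
qed

text \<open>P is chosen minimal in A, so that no other member of A is contained in it. If an element
  x avoiding the other members happens to lie in P, it is corrected by some y in I that lies in all
  the others but not in P.\<close>

lemma prime_avoidance:
  assumes "finite A" "\<And>P. P \<in> A \<Longrightarrow> prime_in S P" "ideal_in S I" "\<And>P. P \<in> A \<Longrightarrow> \<not> I \<subseteq> P"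
  shows "\<exists>x\<in>I. \<forall>P\<in>A. x \<notin> P"
  using assms(1,2,4)
proof (induction A rule: finite_psubset_induct)
  case (psubset A)
  show ?case
  proof (cases "A = {}")
    case True
    then show ?thesis using idealD(2)[OF assms(3)] by blast
  next
    case False
    then obtain P where P: "P \<in> A" "\<And>Q. Q \<in> A \<Longrightarrow> Q \<subseteq> P \<Longrightarrow> P = Q"
      using finite_has_minimal[OF psubset(1)] by metis
    have lt: "A - {P} \<subset> A" using P by blast
    from psubset.IH[OF lt] psubset.prems
    obtain x where x: "x \<in> I" "\<forall>Q\<in>A - {P}. x \<notin> Q" by auto
    show ?thesis
    proof (cases "x \<in> P")
      case False
      then show ?thesis using x by blast
    next
      case True
      obtain y where y: "y \<in> I" "y \<notin> P" "\<And>Q. Q \<in> A - {P} \<Longrightarrow> y \<in> Q"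
      proof (rule prime_contains_factor[of P "A - {P}" I])
        show "ideal_in S Q" if "Q \<in> A - {P}" for Q using that psubset.prems by (auto simp: prime_in_def)
        show "\<not> Q \<subseteq> P" if "Q \<in> A - {P}" for Q using that P by blast
      qed (use psubset P assms in auto)
      have "x + y \<in> I" using idealD(3)[OF assms(3) x(1) y(1)] .
      moreover have "x + y \<notin> Q" if Q: "Q \<in> A" for Q
      proof
        assume xy: "x + y \<in> Q"
        have iQ: "ideal_in S Q" using psubset.prems Q by (auto simp: prime_in_def)
        show False
        proof (cases "Q = P")
          case True
          then have "(x + y) - x \<in> P" using xy \<open>x \<in> P\<close> idealD(8)[OF iQ] by blast
          then show False using y by simp
        next
          case False
          then have "(x + y) - y \<in> Q" using xy y(3)[of Q] Q idealD(8)[OF iQ] by blast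
          then show False using x Q False by simp
        qed
      qed
      ultimately show ?thesis by blast
    qed
  qed
qed

text \<open>In place of a primary decomposition, W is taken maximal among the ideals that are killed
  modulo N' by everything that kills some finite set A of elements with maximal annihilators. By
  maximality W contains every v whose annihilator P is maximal. If P were not the annihilator of an
  element of A, then none of those annihilators would lie in P, so some y outside P would kill A,
  hence W and v, which puts y into P.\<close>

lemma finite_maximal_annih:
  assumes N: "ideal_in S N" and N': "ideal_in S N'"
  shows "finite {P. maximal_annih N N' P}"
proof -
  define dominates where "dominates A W \<longleftrightarrow> (\<forall>w\<in>W. \<forall>s\<in>S. (\<forall>u\<in>A. s * u \<in> N') \<longrightarrow> s * w \<in> N')" for A W
  define \<F> where "\<F> = {W. ideal_in S W \<and> (\<exists>A. finite A \<and> A \<subseteq> N - N' \<and>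
    (\<forall>u\<in>A. maximal_annih N N' (annih u N')) \<and> dominates A W)}"
  have "dominates {} N'" unfolding dominates_def using idealD(4)[OF N'] by simp
  then have "N' \<in> \<F>" unfolding \<F>_def using N' by blast
  then obtain W where W: "W \<in> \<F>" "\<And>V. V \<in> \<F> \<Longrightarrow> W \<subseteq> V \<Longrightarrow> V = W"
    by (rule max_elem[of N' \<F>]) (simp_all add: \<F>_def)
  from W(1) obtain A where iW: "ideal_in S W" and A: "finite A" "A \<subseteq> N - N'"
    "\<forall>u\<in>A. maximal_annih N N' (annih u N')" "dominates A W"
    unfolding \<F>_def by blast
  have "P \<in> (\<lambda>u. annih u N') ` A" if P: "maximal_annih N N' P" for P
  proof -
    obtain v where v: "v \<in> N" "v \<notin> N'" "P = annih v N'" using P by (auto simp: maximal_annih_def)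
    have vS: "v \<in> S" using idealD(6)[OF N v(1)] .
    have "add_multiples v S W \<in> \<F>"
      unfolding \<F>_def
    proof (intro CollectI conjI exI[of _ "insert v A"])
      show "ideal_in S (add_multiples v S W)" using ideal_add_multiples[OF vS ideal_S iW] .
      show "\<forall>u\<in>insert v A. maximal_annih N N' (annih u N')" using A P v by auto
      show "dominates (insert v A) (add_multiples v S W)"
        unfolding dominates_def
      proof (intro ballI impI)
        fix w s assume w: "w \<in> add_multiples v S W" and s: "s \<in> S" "\<forall>u\<in>insert v A. s * u \<in> N'"
        from w obtain y z where "w = y + v * z" "y \<in> W" "z \<in> S" by (rule add_multiplesE)
        moreover have "s * y \<in> N'" using A(4) s \<open>y \<in> W\<close> unfolding dominates_def by simp
        moreover have "z * (s * v) \<in> N'" using s idealD(4)[OF N' \<open>z \<in> S\<close>] by auto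
        ultimately show "s * w \<in> N'" using idealD(3)[OF N', of "s * y" "z * (s * v)"]
          by (simp add: algebra_simps)
      qed
    qed (use A v in auto)
    moreover have "W \<subseteq> add_multiples v S W" using add_multiples_upper[OF ideal_S] .
    ultimately have "add_multiples v S W = W" using W by blast
    moreover have "v * 1 \<in> add_multiples v S W" using mult_in_add_multiples[OF iW] by blast
    ultimately have vW: "v \<in> W" by simp
    show ?thesis
    proof (rule ccontr)
      assume neg: "P \<notin> (\<lambda>u. annih u N') ` A"
      have pr: "prime_in S P" using maximal_annih_prime[OF N N' P] .
      have idA: "ideal_in S Q" if "Q \<in> (\<lambda>u. annih u N') ` A" for Q
        using that A ideal_annih[OF N'] idealD(6)[OF N] by blast
      have nsub: "\<not> Q \<subseteq> P" if Q: "Q \<in> (\<lambda>u. annih u N') ` A" for Q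
      proof
        assume "Q \<subseteq> P"
        moreover have "maximal_annih N N' Q" using A Q by auto
        ultimately have "P = Q" using v by (auto simp: maximal_annih_def)
        then show False using neg Q by blast
      qed
      have "\<not> S \<subseteq> P" using pr by (auto simp: prime_in_def)
      then obtain y where y: "y \<in> S" "y \<notin> P" "\<And>Q. Q \<in> (\<lambda>u. annih u N') ` A \<Longrightarrow> y \<in> Q"
        using prime_contains_factor[OF pr _ idA nsub ideal_S] A(1) by blast
      then have "\<forall>u\<in>A. y * u \<in> N'" by (auto simp: annih_def)
      then have "y * v \<in> N'" using A(4) vW y unfolding dominates_def by blast
      then show False using y v by (auto simp: annih_def)
    qed
  qed
  then have "{P. maximal_annih N N' P} \<subseteq> (\<lambda>u. annih u N') ` A" by blast
  then show ?thesis using A(1) by (meson finite_imageI finite_subset)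
qed

end

locale noetherian_subring_with_ideal = noetherian_subring +
  fixes \<mm> :: "'a set"
  assumes ideal_mm: "ideal_in S \<mm>"
begin

lemma mm_S: "a \<in> \<mm> \<Longrightarrow> a \<in> S"
  using idealD(6)[OF ideal_mm] .

text \<open>Vanishing of Hom(S/\<mm>, N/N'). Over a Noetherian ring this is positive depth:
  \<open>socle_freeI\<close> gives one direction and \<open>common_nonzerodivisor\<close> the other.
  It is easier to transport between modules than a particular nonzerodivisor.\<close>

definition socle_free :: "'a set \<Rightarrow> 'a set \<Rightarrow> bool" where
  "socle_free N N' \<longleftrightarrow> (\<forall>u\<in>N. (\<forall>a\<in>\<mm>. a * u \<in> N') \<longrightarrow> u \<in> N')"

lemma socle_freeI: "f \<in> \<mm> \<Longrightarrow> nonzerodivisor f N N' \<Longrightarrow> socle_free N N'"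
  by (auto simp: socle_free_def nonzerodivisor_def)

text \<open>A zerodivisor on one of the modules lies in one of its maximal annihilators. All the
  modules together have finitely many of these, and \<mm> is contained in none, as otherwise \<mm>
  would kill a nonzero element. Prime avoidance is applied to all of them at once.\<close>

lemma common_nonzerodivisor:
  assumes "finite Ps" "\<And>N N'. (N, N') \<in> Ps \<Longrightarrow> ideal_in S N \<and> ideal_in S N' \<and> socle_free N N'"
  obtains f where "f \<in> \<mm>" "\<And>N N'. (N, N') \<in> Ps \<Longrightarrow> nonzerodivisor f N N'"
proof -
  define A where "A = (\<Union>p\<in>Ps. {P. maximal_annih (fst p) (snd p) P})"
  have "finite A" unfolding A_def using assms finite_maximal_annih by auto
  moreover have "prime_in S P" if "P \<in> A" for P
    using that assms maximal_annih_prime unfolding A_def by fastforce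
  moreover have "\<not> \<mm> \<subseteq> P" if "P \<in> A" for P
  proof
    assume mP: "\<mm> \<subseteq> P"
    obtain N N' where p: "(N, N') \<in> Ps" "maximal_annih N N' P" using \<open>P \<in> A\<close> unfolding A_def by auto
    then obtain u where u: "u \<in> N - N'" "P = annih u N'" by (auto simp: maximal_annih_def)
    then have "\<forall>a\<in>\<mm>. a * u \<in> N'" using mP by (auto simp: annih_def)
    then show False using u assms(2)[OF p(1)] by (auto simp: socle_free_def)
  qed
  ultimately obtain f where f: "f \<in> \<mm>" "\<forall>P\<in>A. f \<notin> P" using prime_avoidance ideal_mm by metis
  have "nonzerodivisor f N N'" if p: "(N, N') \<in> Ps" for N N'
    unfolding nonzerodivisor_def
  proof (intro ballI impI, rule ccontr)
    fix u assume u: "u \<in> N" "f * u \<in> N'" "u \<notin> N'"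
    then obtain P where P: "maximal_annih N N' P" "annih u N' \<subseteq> P"
      using maximal_annih_exists[of N N' u] assms(2)[OF p] by auto
    have "f \<in> annih u N'" using u mm_S[OF f(1)] by (auto simp: annih_def)
    then have "f \<in> P" using P by blast
    moreover have "P \<in> A" using P p unfolding A_def by force
    ultimately show False using f by blast
  qed
  then show thesis using that f by blast
qed

section \<open>Independence of depth from the chosen regular sequence\<close>

lemma depth_ge_Suc_imp: "depth_ge \<mm> (Suc n) N N' \<Longrightarrow> depth_ge \<mm> n N N'"
proof (induction n arbitrary: N')
  case (Suc n)
  from Suc.prems[unfolded depth_ge.simps(2)[of _ "Suc n"]]
  obtain f where "f \<in> \<mm>" "nonzerodivisor f N N'" "depth_ge \<mm> (Suc n) N (add_multiples f N N')"
    by (elim bexE conjE)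
  then show ?case using Suc.IH[of "add_multiples f N N'"] depth_ge.simps(2)[of \<mm> n N N'] by metis
qed simp

lemma depth_ge_mono: "depth_ge \<mm> n N N' \<Longrightarrow> k \<le> n \<Longrightarrow> depth_ge \<mm> k N N'"
proof (induction n)
  case (Suc n)
  show ?case
  proof (cases "k = Suc n")
    case False
    then show ?thesis using Suc depth_ge_Suc_imp[OF Suc.prems(1)] by simp
  qed (use Suc in simp)
qed simp

lemma depth_ge_socle_free: "depth_ge \<mm> (Suc n) N N' \<Longrightarrow> socle_free N N'"
  unfolding depth_ge.simps by (elim bexE conjE) (rule socle_freeI)

text \<open>\<open>{u \<in> M/fM. \<mm> u = 0}\<close> is isomorphic to \<open>Ext\<^sup>1(S/\<mm>, M)\<close>, whatever the nonzerodivisor \<open>f\<close>.\<close>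
lemma socle_free_exchange:
  assumes N: "ideal_in S N" and N': "ideal_in S N'"
    and f: "f \<in> \<mm>" "nonzerodivisor f N N'" and g: "g \<in> \<mm>" "nonzerodivisor g N N'"
    and sf: "socle_free N (add_multiples g N N')"
  shows "socle_free N (add_multiples f N N')"
  unfolding socle_free_def
proof (intro ballI impI)
  fix u assume u: "u \<in> N" "\<forall>a\<in>\<mm>. a * u \<in> add_multiples f N N'"
  then have "g * u \<in> add_multiples f N N'" using g by blast
  \<comment> \<open>The map sending u to v, defined by g u = f v modulo N', carries the socle of
    M/fM into that of M/gM, where M = N/N'. It is the identification with Ext made explicit.\<close>
  then obtain y v where v: "g * u = y + f * v" "y \<in> N'" "v \<in> N" by (rule add_multiplesE)
  have "\<forall>a\<in>\<mm>. a * v \<in> add_multiples g N N'"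
  proof
    fix a assume a: "a \<in> \<mm>"
    then obtain y' w where w: "a * u = y' + f * w" "y' \<in> N'" "w \<in> N" using u add_multiplesE by metis
    have "f * (a * v - g * w) = a * (g * u - y) - g * (a * u - y')" using v w by (simp add: algebra_simps)
    also have "\<dots> = g * y' - a * y" by (simp add: algebra_simps)
    also have "\<dots> \<in> N'" using N' v w a g mm_S by (auto intro!: idealD(3,4,8))
    finally have "f * (a * v - g * w) \<in> N'" .
    moreover have "a * v - g * w \<in> N" using N v w a g mm_S by (auto intro!: idealD(3,4,8))
    ultimately have "a * v - g * w \<in> N'" using f by (auto simp: nonzerodivisor_def)
    then have "(a * v - g * w) + g * w \<in> add_multiples g N N'" using w add_multiplesI by blast
    then show "a * v \<in> add_multiples g N N'" by simp
  qed
  then have "v \<in> add_multiples g N N'" using sf v by (auto simp: socle_free_def)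
  then obtain y2 w where w: "v = y2 + g * w" "y2 \<in> N'" "w \<in> N" by (rule add_multiplesE)
  have "g * (u - f * w) = y + f * y2" using v w by (simp add: algebra_simps)
  also have "\<dots> \<in> N'" using N' v w f mm_S by (auto intro!: idealD(3,4,8))
  finally have "g * (u - f * w) \<in> N'" .
  moreover have "u - f * w \<in> N" using u w N f mm_S by (auto intro!: idealD(4,8))
  ultimately have "u - f * w \<in> N'" using g nonzerodivisorD by blast
  then show "u \<in> add_multiples f N N'" using add_multiplesI[of "u - f * w" N' w N f] w by simp
qed

text \<open>In M = N/N', a relation f u = g v forces v = f w, since g is a nonzerodivisor on M/fM;
  cancelling f leaves u = g w. This is how two elements of a regular sequence are
  interchanged.\<close>

lemma nonzerodivisor_swap:
  assumes N: "ideal_in S N" and N': "ideal_in S N'" and S: "f \<in> S" "g \<in> S"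
    and h: "nonzerodivisor g N N'" "nonzerodivisor g N (add_multiples f N N')" "nonzerodivisor f N N'"
  shows "nonzerodivisor f N (add_multiples g N N')"
  unfolding nonzerodivisor_def
proof (intro ballI impI)
  fix u assume u: "u \<in> N" "f * u \<in> add_multiples g N N'"
  then obtain y v where v: "f * u = y + g * v" "y \<in> N'" "v \<in> N" by (auto elim: add_multiplesE)
  then have "g * v = - y + f * u" by (simp add: algebra_simps)
  then have "g * v \<in> add_multiples f N N'" using add_multiplesI[of "- y" N' u N f] u v idealD(7)[OF N'] by simp
  then have "v \<in> add_multiples f N N'" using h v by (auto simp: nonzerodivisor_def)
  then obtain y2 w where w: "v = y2 + f * w" "y2 \<in> N'" "w \<in> N" by (rule add_multiplesE)
  have "f * (u - g * w) = y + g * y2" using v w by (simp add: algebra_simps)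
  also have "\<dots> \<in> N'" using N' v w S by (auto intro!: idealD(3,4,8))
  finally have "f * (u - g * w) \<in> N'" .
  moreover have "u - g * w \<in> N" using u w N S by (auto intro!: idealD(4,8))
  ultimately have "u - g * w \<in> N'" using h nonzerodivisorD by blast
  then show "u \<in> add_multiples g N N'" using add_multiplesI[of "u - g * w" N' w N g] w by simp
qed

text \<open>With M = N/N', the given sequence starts with some g, and nothing relates g to f. An h
  that is a nonzerodivisor on M, M/gM and M/fM mediates: the induction hypothesis passes from M/gM
  to M/(g,h)M, exchanging g and h gives the depth of M/hM, and the same argument leads from M/hM
  through M/(h,f)M to M/fM. That h exists for M/fM is what \<open>socle_free_exchange\<close>
  provides.\<close>

theorem depth_ge_quotient:
  assumes "ideal_in S N" "ideal_in S N'" "depth_ge \<mm> (Suc n) N N'" "f \<in> \<mm>" "nonzerodivisor f N N'"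
  shows "depth_ge \<mm> n N (add_multiples f N N')"
  using assms
proof (induction n arbitrary: N' f)
  case (Suc n)
  note N = Suc.prems(1) and N' = Suc.prems(2) and f = Suc.prems(4,5)
  obtain g where g: "g \<in> \<mm>" "nonzerodivisor g N N'" "depth_ge \<mm> (Suc n) N (add_multiples g N N')"
    using Suc.prems(3) by (simp only: depth_ge.simps) blast
  have S: "f \<in> S" "g \<in> S" using f g mm_S by auto
  note iq = ideal_add_multiples[OF S(1) N N'] ideal_add_multiples[OF S(2) N N']
  have sg: "socle_free N (add_multiples g N N')" using depth_ge_socle_free[OF g(3)] .
  have sf: "socle_free N (add_multiples f N N')" using socle_free_exchange[OF N N' f g(1,2) sg] .
  obtain h where h: "h \<in> \<mm>" "nonzerodivisor h N N'" "nonzerodivisor h N (add_multiples g N N')"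
    "nonzerodivisor h N (add_multiples f N N')"
    by (rule common_nonzerodivisor[of "{(N, N'), (N, add_multiples g N N'), (N, add_multiples f N N')}"])
      (use N N' iq sf sg depth_ge_socle_free[OF Suc.prems(3)] in auto)
  have hS: "h \<in> S" using h mm_S by auto
  have ih: "ideal_in S (add_multiples h N N')" using ideal_add_multiples[OF hS N N'] .
  have "depth_ge \<mm> n N (add_multiples h N (add_multiples g N N'))"
    using Suc.IH[OF N iq(2) g(3) h(1,3)] .
  moreover have "nonzerodivisor g N (add_multiples h N N')"
    using nonzerodivisor_swap[OF N N' S(2) hS h(2,3) g(2)] .
  ultimately have "depth_ge \<mm> (Suc n) N (add_multiples h N N')"
    unfolding depth_ge.simps using g(1) by (subst (asm) add_multiples_commute) blast
  moreover have "nonzerodivisor f N (add_multiples h N N')"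
    using nonzerodivisor_swap[OF N N' S(1) hS h(2,4) f(2)] .
  ultimately have "depth_ge \<mm> n N (add_multiples f N (add_multiples h N N'))"
    using Suc.IH[OF N ih _ f(1)] by blast
  then have "depth_ge \<mm> n N (add_multiples h N (add_multiples f N N'))"
    by (subst add_multiples_commute)
  then show ?case unfolding depth_ge.simps using h(1,4) by blast
qed simp

text \<open>The second isomorphism theorem: \<open>J/K = J/(J \<inter> K') \<cong> (J + K')/K' = J'/K'\<close>.\<close>
lemma depth_ge_second_isomorphism:
  assumes "ideal_in S J'" "ideal_in S K'" "K' \<subseteq> J'" "J \<subseteq> J'" "K = J \<inter> K'"
    "\<And>x. x \<in> J' \<Longrightarrow> \<exists>y\<in>J. x - y \<in> K'" "ideal_in S J"
  shows "depth_ge \<mm> n J K \<longleftrightarrow> depth_ge \<mm> n J' K'"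
  using assms(2,3,5,6)
proof (induction n arbitrary: K K')
  case (Suc n)
  have "nonzerodivisor f J K \<longleftrightarrow> nonzerodivisor f J' K'" if "f \<in> \<mm>" for f
  proof
    assume nz: "nonzerodivisor f J K"
    show "nonzerodivisor f J' K'" unfolding nonzerodivisor_def
    proof (intro ballI impI)
      fix u assume u: "u \<in> J'" "f * u \<in> K'"
      obtain y where y: "y \<in> J" "u - y \<in> K'" using Suc.prems(4)[OF u(1)] by blast
      have "f * u - f * (u - y) \<in> K'" using u y Suc.prems that mm_S by (auto intro!: idealD(4,8))
      then have "f * y \<in> J \<inter> K'" using y assms(7) that mm_S by (auto simp: algebra_simps intro!: idealD(4))
      then have "y \<in> K'" using nz y Suc.prems by (auto simp: nonzerodivisor_def)
      then have "(u - y) + y \<in> K'" using y idealD(3)[OF Suc.prems(1)] by blast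
      then show "u \<in> K'" by simp
    qed
  next
    assume nz: "nonzerodivisor f J' K'"
    then show "nonzerodivisor f J K"
      using assms(4) Suc.prems by (auto simp: nonzerodivisor_def)
  qed
  moreover have "depth_ge \<mm> n J (add_multiples f J K) \<longleftrightarrow> depth_ge \<mm> n J' (add_multiples f J' K')" if f: "f \<in> \<mm>" for f
  proof (rule Suc.IH)
    show "ideal_in S (add_multiples f J' K')" using ideal_add_multiples mm_S f assms(1) Suc.prems by blast
    show "add_multiples f J' K' \<subseteq> J'" using add_multiples_subset f mm_S assms(1) Suc.prems by blast
    show "add_multiples f J K = J \<inter> add_multiples f J' K'"
    proof (intro equalityI subsetI)
      fix x assume "x \<in> add_multiples f J K"
      then obtain y z where yz: "x = y + f * z" "y \<in> K" "z \<in> J" by (rule add_multiplesE)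
      have "x \<in> J" using yz assms(7) f mm_S Suc.prems by (auto intro!: idealD(3,4))
      then show "x \<in> J \<inter> add_multiples f J' K'" using yz Suc.prems assms(4) by (auto intro!: add_multiplesI)
    next
      fix x assume x: "x \<in> J \<inter> add_multiples f J' K'"
      then obtain y z where yz: "x = y + f * z" "y \<in> K'" "z \<in> J'" by (auto elim: add_multiplesE)
      obtain w where w: "w \<in> J" "z - w \<in> K'" using Suc.prems(4)[OF yz(3)] by blast
      have "x - f * w = y + f * (z - w)" using yz by (simp add: algebra_simps)
      also have "\<dots> \<in> K'" using yz w Suc.prems f mm_S by (auto intro!: idealD(3,4))
      finally have "x - f * w \<in> K'" .
      moreover have "x - f * w \<in> J" using x w assms(7) f mm_S by (auto intro!: idealD(4,8))
      ultimately have "(x - f * w) + f * w \<in> add_multiples f J K" using Suc.prems w by (intro add_multiplesI) auto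
      then show "x \<in> add_multiples f J K" by simp
    qed
    show "\<exists>y\<in>J. x - y \<in> add_multiples f J' K'" if "x \<in> J'" for x
      using Suc.prems(4)[OF that] add_multiples_upper[OF assms(1)] by blast
  qed
  ultimately show ?case unfolding depth_ge.simps by (intro bex_cong[OF refl]) simp
qed simp

section \<open>The depth lemma for 0 \<rightarrow> J/I \<rightarrow> N/I \<rightarrow> N/J
  \<rightarrow> 0\<close>

context
  fixes N J I assumes N: "ideal_in S N" and J: "ideal_in S J" and I: "ideal_in S I"
    and IJ: "I \<subseteq> J" and JN: "J \<subseteq> N"
begin

text \<open>Since f is a nonzerodivisor on N/J, the sequence stays exact after division by f. But
  the new kernel appears as (J + fN)/(I + fN), because J need not contain I + fN. The second
  isomorphism theorem identifies it with J/(I + fJ), by the equality of J \<inter> (I + fN) and I +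
  fJ.\<close>

lemma depth_ge_kernel_quotient:
  assumes f: "f \<in> \<mm>" "nonzerodivisor f N J"
  shows "depth_ge \<mm> n J (add_multiples f J I) \<longleftrightarrow> depth_ge \<mm> n (add_multiples f N J) (add_multiples f N I)"
proof (rule depth_ge_second_isomorphism)
  show "ideal_in S (add_multiples f N J)" "ideal_in S (add_multiples f N I)"
    using ideal_add_multiples f mm_S N J I by blast+
  show "add_multiples f N I \<subseteq> add_multiples f N J" using IJ by (auto simp: add_multiples_def)
  show "J \<subseteq> add_multiples f N J" using add_multiples_upper[OF N] .
  show "add_multiples f J I = J \<inter> add_multiples f N I"
  proof (intro equalityI subsetI)
    fix x assume "x \<in> add_multiples f J I"
    then obtain y z where yz: "x = y + f * z" "y \<in> I" "z \<in> J" by (rule add_multiplesE)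
    then show "x \<in> J \<inter> add_multiples f N I" using J f mm_S IJ JN
      by (auto intro!: add_multiplesI idealD(3,4))
  next
    fix x assume x: "x \<in> J \<inter> add_multiples f N I"
    then obtain y z where yz: "x = y + f * z" "y \<in> I" "z \<in> N" by (auto elim: add_multiplesE)
    then have "f * z = x - y" by simp
    then have "f * z \<in> J" using x yz J IJ idealD(8)[OF J, of x y] by auto
    then have "z \<in> J" using f yz by (auto simp: nonzerodivisor_def)
    then show "x \<in> add_multiples f J I" using yz add_multiplesI by blast
  qed
  show "\<exists>y\<in>J. x - y \<in> add_multiples f N I" if x: "x \<in> add_multiples f N J" for x
  proof -
    obtain y z where yz: "x = y + f * z" "y \<in> J" "z \<in> N" using x by (rule add_multiplesE)
    then show ?thesis using mult_in_add_multiples[OF I] by (intro bexI[of _ y]) auto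
  qed
  show "ideal_in S J" by (rule J)
qed

end

text \<open>At the bottom of the induction the cokernel may have depth 0, so there is nothing to
  divide it by; a nonzerodivisor on N/I is simply restricted to J/I.\<close>

theorem depth_lemma_kernel:
  assumes "ideal_in S N" "ideal_in S J" "ideal_in S I" "I \<subseteq> J" "J \<subseteq> N"
    "depth_ge \<mm> (Suc n) N I" "depth_ge \<mm> n N J"
  shows "depth_ge \<mm> (Suc n) J I"
  using assms
proof (induction n arbitrary: J I)
  case 0
  then obtain f where "f \<in> \<mm>" "nonzerodivisor f N I" by auto
  then have "nonzerodivisor f J I" using 0 by (auto simp: nonzerodivisor_def)
  then show ?case using \<open>f \<in> \<mm>\<close> by auto
next
  case (Suc n)
  note N = Suc.prems(1) and J = Suc.prems(2) and I = Suc.prems(3) and IJ = Suc.prems(4,5)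
  obtain f where f: "f \<in> \<mm>" "nonzerodivisor f N I" "nonzerodivisor f N J"
    by (rule common_nonzerodivisor[of "{(N, I), (N, J)}"])
      (use N J I depth_ge_socle_free[OF Suc.prems(6)] depth_ge_socle_free[OF Suc.prems(7)] in auto)
  have fS: "f \<in> S" using f mm_S by auto
  have "depth_ge \<mm> (Suc n) (add_multiples f N J) (add_multiples f N I)"
  proof (rule Suc.IH)
    show "add_multiples f N I \<subseteq> add_multiples f N J" using IJ by (auto simp: add_multiples_def)
    show "add_multiples f N J \<subseteq> N" using add_multiples_subset[OF fS N] IJ by blast
    show "depth_ge \<mm> (Suc n) N (add_multiples f N I)" using depth_ge_quotient[OF N I Suc.prems(6)] f by blast
    show "depth_ge \<mm> n N (add_multiples f N J)" using depth_ge_quotient[OF N J Suc.prems(7)] f by blast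
  qed (use N J I fS ideal_add_multiples in auto)
  then have "depth_ge \<mm> (Suc n) J (add_multiples f J I)"
    using depth_ge_kernel_quotient[OF N J I IJ f(1,3)] by blast
  moreover have "nonzerodivisor f J I" using f IJ by (auto simp: nonzerodivisor_def)
  ultimately show ?case using f by auto
qed

text \<open>The obstacle is positive depth of N/J, which is not among the hypotheses. If \<mm> u
  \<subseteq> J, then g u lies in the socle of J/(I + gJ), which vanishes because J/I has depth at
  least 2. So g u = y + g z with y in I and z in J, and cancelling g on N/I puts u into J. This is
  the connecting map from Hom(S/\<mm>, N/J) to Ext of J/I in explicit form.\<close>

theorem depth_lemma_cokernel:
  assumes "ideal_in S N" "ideal_in S J" "ideal_in S I" "I \<subseteq> J" "J \<subseteq> N"
    "depth_ge \<mm> (Suc n) J I" "depth_ge \<mm> n N I"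
  shows "depth_ge \<mm> n N J"
  using assms
proof (induction n arbitrary: J I)
  case (Suc n)
  note N = Suc.prems(1) and J = Suc.prems(2) and I = Suc.prems(3) and IJ = Suc.prems(4,5)
  have sI: "socle_free J I" "socle_free N I"
    using depth_ge_socle_free[OF Suc.prems(6)] depth_ge_socle_free[OF Suc.prems(7)] .
  obtain g where g: "g \<in> \<mm>" "nonzerodivisor g N I" "nonzerodivisor g J I"
    by (rule common_nonzerodivisor[of "{(N, I), (J, I)}"]) (use N J I sI in auto)
  have "depth_ge \<mm> (Suc n) J (add_multiples g J I)"
    using depth_ge_quotient[OF J I Suc.prems(6) g(1,3)] .
  then have sg: "socle_free J (add_multiples g J I)" by (rule depth_ge_socle_free)
  have "socle_free N J" unfolding socle_free_def
  proof (intro ballI impI)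
    fix u assume u: "u \<in> N" "\<forall>a\<in>\<mm>. a * u \<in> J"
    have "\<forall>a\<in>\<mm>. a * (g * u) \<in> add_multiples g J I"
    proof
      fix a assume "a \<in> \<mm>"
      then have "g * (a * u) \<in> add_multiples g J I" using mult_in_add_multiples[OF I] u by blast
      then show "a * (g * u) \<in> add_multiples g J I" by (simp add: algebra_simps)
    qed
    then have "g * u \<in> add_multiples g J I" using sg u g by (auto simp: socle_free_def)
    then obtain y z where yz: "g * u = y + g * z" "y \<in> I" "z \<in> J" by (rule add_multiplesE)
    have "g * (u - z) \<in> I" using yz by (simp add: algebra_simps)
    moreover have "u - z \<in> N" using u yz IJ N by (auto intro!: idealD(8))
    ultimately have "u - z \<in> J" using g IJ by (auto simp: nonzerodivisor_def)
    then have "(u - z) + z \<in> J" using yz idealD(3)[OF J] by blast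
    then show "u \<in> J" by simp
  qed
  then obtain f where f: "f \<in> \<mm>" "nonzerodivisor f N I" "nonzerodivisor f J I" "nonzerodivisor f N J"
    by (rule_tac common_nonzerodivisor[of "{(N, I), (J, I), (N, J)}"]) (use N J I sI in auto)
  have fS: "f \<in> S" using f mm_S by auto
  have "depth_ge \<mm> n N (add_multiples f N J)"
  proof (rule Suc.IH)
    show "add_multiples f N I \<subseteq> add_multiples f N J" using IJ by (auto simp: add_multiples_def)
    show "add_multiples f N J \<subseteq> N" using add_multiples_subset[OF fS N] IJ by blast
    show "depth_ge \<mm> n N (add_multiples f N I)" using depth_ge_quotient[OF N I Suc.prems(7)] f by blast
    show "depth_ge \<mm> (Suc n) (add_multiples f N J) (add_multiples f N I)"
      using depth_ge_quotient[OF J I Suc.prems(6)] f depth_ge_kernel_quotient[OF N J I IJ f(1,4)] by blast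
  qed (use N J I fS ideal_add_multiples in auto)
  then show ?case using f by auto
qed simp

section \<open>From regular sequences to chains of primes\<close>

text \<open>The kernel of \<open>N/N' \<rightarrow> (1 + \<mm>)\<^sup>-\<^sup>1 N/N'\<close>.\<close>
definition saturation :: "'a set \<Rightarrow> 'a set" where
  "saturation K = {u \<in> S. \<exists>a\<in>\<mm>. (1 - a) * u \<in> K}"

lemma saturationI: "u \<in> S \<Longrightarrow> a \<in> \<mm> \<Longrightarrow> (1 - a) * u \<in> K \<Longrightarrow> u \<in> saturation K"
  by (auto simp: saturation_def)

lemma one_minus_mm: "a \<in> \<mm> \<Longrightarrow> b \<in> \<mm> \<Longrightarrow> \<exists>c\<in>\<mm>. (1 - a) * (1 - b) = 1 - c"
proof (intro bexI)
  assume ab: "a \<in> \<mm>" "b \<in> \<mm>"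
  show "(1 - a) * (1 - b) = 1 - (a + b - a * b)" by (simp add: algebra_simps)
  show "a + b - a * b \<in> \<mm>" using ab ideal_mm mm_S by (auto intro!: idealD(3,4,8))
qed

lemma saturation_upper: "ideal_in S K \<Longrightarrow> K \<subseteq> saturation K"
  using saturationI[of _ 0 K] idealD(2)[OF ideal_mm] idealD(6)[of K] by auto

lemma ideal_saturation:
  assumes K: "ideal_in S K" shows "ideal_in S (saturation K)"
proof (rule idealI)
  show "0 \<in> saturation K" using saturation_upper[OF K] idealD(2)[OF K] by blast
next
  fix x y assume "x \<in> saturation K" "y \<in> saturation K"
  then obtain a b where ab: "x \<in> S" "y \<in> S" "a \<in> \<mm>" "b \<in> \<mm>" "(1 - a) * x \<in> K" "(1 - b) * y \<in> K"
    by (auto simp: saturation_def)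
  obtain c where c: "c \<in> \<mm>" "(1 - a) * (1 - b) = 1 - c" using one_minus_mm ab by metis
  have "(1 - b) * ((1 - a) * x) + (1 - a) * ((1 - b) * y) \<in> K"
    using ab K mm_S by (auto intro!: idealD(3,4))
  then have "((1 - a) * (1 - b)) * (x + y) \<in> K" by (simp add: algebra_simps)
  then show "x + y \<in> saturation K" using c ab by (auto intro!: saturationI)
next
  fix s x assume "s \<in> S" "x \<in> saturation K"
  then obtain a where a: "s \<in> S" "x \<in> S" "a \<in> \<mm>" "(1 - a) * x \<in> K" by (auto simp: saturation_def)
  then have "s * ((1 - a) * x) \<in> K" using idealD(4)[OF K] by blast
  then have "(1 - a) * (s * x) \<in> K" by (simp add: algebra_simps)
  then show "s * x \<in> saturation K" using a by (auto intro!: saturationI)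
qed (auto simp: saturation_def)

lemma saturation_idem:
  assumes "ideal_in S K" "u \<in> S" "a \<in> \<mm>" "(1 - a) * u \<in> saturation K"
  shows "u \<in> saturation K"
proof -
  obtain b where b: "b \<in> \<mm>" "(1 - b) * ((1 - a) * u) \<in> K" using assms by (auto simp: saturation_def)
  obtain c where c: "c \<in> \<mm>" "(1 - b) * (1 - a) = 1 - c" using one_minus_mm assms b by metis
  then have "(1 - c) * u \<in> K" using b by (simp flip: mult.assoc)
  then show ?thesis using c assms saturationI by blast
qed

lemma nonzerodivisor_saturation:
  assumes "ideal_in S N" "nonzerodivisor f N N'" "u \<in> N" "f * u \<in> saturation N'"
  shows "u \<in> saturation N'"
proof -
  obtain a where a: "a \<in> \<mm>" "(1 - a) * (f * u) \<in> N'" using assms by (auto simp: saturation_def)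
  then have "f * ((1 - a) * u) \<in> N'" by (simp add: algebra_simps)
  moreover have "(1 - a) * u \<in> N" using assms a mm_S by (auto intro!: idealD(4))
  ultimately have "(1 - a) * u \<in> N'" using assms by (auto simp: nonzerodivisor_def)
  then show ?thesis using a saturationI[OF idealD(6)[OF assms(1,3)]] by blast
qed

text \<open>This is Nakayama's lemma for the submodule \<open>L\<close> annihilated by \<open>P\<close>: a saturated ideal that
  is maximal among those not containing \<open>L\<close> cannot exist if \<open>L \<subseteq> saturation (N' + fN)\<close>.\<close>
lemma annihilated_not_subset:
  assumes N: "ideal_in S N" and N': "ideal_in S N'" "N' \<subseteq> N" and f: "f \<in> \<mm>" "nonzerodivisor f N N'"
    and P: "P \<subseteq> S" and u: "u \<in> N" "u \<notin> saturation N'" "\<forall>s\<in>P. s * u \<in> saturation N'"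
  obtains w where "w \<in> N" "\<forall>s\<in>P. s * w \<in> saturation N'" "w \<notin> saturation (add_multiples f N N')"
proof (rule ccontr)
  assume "\<not> thesis"
  define C where "C = saturation N'"
  define C1 where "C1 = saturation (add_multiples f N N')"
  define L where "L = {w \<in> N. \<forall>s\<in>P. s * w \<in> C}"
  have LC1: "L \<subseteq> C1" using \<open>\<not> thesis\<close> that unfolding L_def C_def C1_def by blast
  define \<F> where "\<F> = {E. ideal_in S E \<and> C \<subseteq> E \<and> saturation E \<subseteq> E \<and> \<not> L \<subseteq> E}"
  have iC: "ideal_in S C" unfolding C_def using ideal_saturation[OF N'(1)] .
  have "saturation C \<subseteq> C"
    using saturation_idem[OF N'(1)] unfolding C_def by (force simp: saturation_def)
  moreover have "u \<in> L" "u \<notin> C" using u unfolding L_def C_def by auto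
  ultimately have "C \<in> \<F>" using iC unfolding \<F>_def by auto
  then obtain E where E: "E \<in> \<F>" "\<And>E'. E' \<in> \<F> \<Longrightarrow> E \<subseteq> E' \<Longrightarrow> E' = E"
    by (rule max_elem[of C \<F>]) (auto simp: \<F>_def)
  have iE: "ideal_in S E" "C \<subseteq> E" "saturation E \<subseteq> E" using E by (auto simp: \<F>_def)
  obtain w where w: "w \<in> L" "w \<notin> E" using E by (auto simp: \<F>_def)
  have wS: "w \<in> S" using w idealD(6)[OF N] unfolding L_def by blast
  have iEw: "ideal_in S (add_multiples w S E)" using ideal_add_multiples[OF wS ideal_S iE(1)] .
  define E' where "E' = saturation (add_multiples w S E)"
  have iE': "ideal_in S E'" unfolding E'_def using ideal_saturation[OF iEw] .
  have sub: "add_multiples w S E \<subseteq> E'" unfolding E'_def using saturation_upper[OF iEw] .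
  have EE': "E \<subseteq> E'" using sub add_multiples_upper[OF ideal_S] by blast
  have wE': "w \<in> E'" using sub mult_in_add_multiples[OF iE(1), of 1 S w] by auto
  have "saturation E' \<subseteq> E'"
    using saturation_idem[OF iEw] unfolding E'_def by (force simp: saturation_def)
  then have "L \<subseteq> E'" using E(2)[of E'] EE' wE' w iE iE' by (auto simp: \<F>_def)
  have "w \<in> C1" using LC1 w by blast
  then obtain a where a: "a \<in> \<mm>" "(1 - a) * w \<in> add_multiples f N N'" unfolding C1_def by (auto simp: saturation_def)
  then obtain y z where yz: "(1 - a) * w = y + f * z" "y \<in> N'" "z \<in> N" by (auto elim: add_multiplesE)
  \<comment> \<open>Multiplying the relation for w by s in P shows that f s z is in C, and f remains
    a nonzerodivisor modulo the saturation.\<close>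
  have "z \<in> L" unfolding L_def
  proof (intro CollectI conjI ballI)
    fix s assume s: "s \<in> P"
    then have sS: "s \<in> S" using P by blast
    have "f * (s * z) = s * ((1 - a) * w - y)" unfolding yz(1) by (simp add: algebra_simps)
    also have "\<dots> = (1 - a) * (s * w) - s * y" by (simp add: algebra_simps)
    also have "\<dots> \<in> C"
    proof (rule idealD(8)[OF iC])
      show "(1 - a) * (s * w) \<in> C"
        using idealD(4)[OF iC] w s a mm_S unfolding L_def by simp
      show "s * y \<in> C"
        using idealD(4)[OF iC sS] yz saturation_upper[OF N'(1)] unfolding C_def by blast
    qed
    finally have "f * (s * z) \<in> C" .
    moreover have "s * z \<in> N" using idealD(4)[OF N sS yz(3)] .
    ultimately show "s * z \<in> C" using nonzerodivisor_saturation[OF N f(2)] unfolding C_def by blast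
  qed (rule yz)
  then have "z \<in> E'" using \<open>L \<subseteq> E'\<close> by blast
  then obtain b where b: "b \<in> \<mm>" "(1 - b) * z \<in> add_multiples w S E" unfolding E'_def by (auto simp: saturation_def)
  then obtain e r where er: "(1 - b) * z = e + w * r" "e \<in> E" "r \<in> S" by (auto elim: add_multiplesE)
  obtain c where c: "c \<in> \<mm>" "(1 - b) * (1 - a) = 1 - c" using one_minus_mm a b by metis
  \<comment> \<open>This is the step in the style of Nakayama: up to E, a multiple of w by an
    element of 1 - \<mm> equals f r w. As f r is in \<mm>, a multiplier of the form 1 - (element of
    \<mm>) sends w into E, and E is saturated.\<close>
  have "(1 - b) * ((1 - a) * w) = (1 - b) * y + f * ((1 - b) * z)" unfolding yz by (simp add: algebra_simps)
  also have "\<dots> = (1 - b) * y + f * e + (f * r) * w" unfolding er by (simp add: algebra_simps)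
  finally have "(1 - c) * w = (1 - b) * y + f * e + (f * r) * w" using c by (simp flip: mult.assoc)
  then have "(1 - (c + f * r)) * w = (1 - b) * y + f * e" by (simp add: algebra_simps)
  moreover have "(1 - b) * y + f * e \<in> E"
  proof -
    have "y \<in> E" using yz saturation_upper[OF N'(1)] iE unfolding C_def by blast
    then show ?thesis using er f b mm_S iE by (auto intro!: idealD(3,4))
  qed
  moreover have "c + f * r \<in> \<mm>" using c f er ideal_mm by (auto intro!: idealD(3,5))
  ultimately have "w \<in> saturation E" using wS saturationI by metis
  then show False using iE w by blast
qed

text \<open>P0 kills a nonzero element of the localized module M. By the preceding lemma some w
  killed by P0 is still nonzero in M/fM, where f kills it too. A maximal annihilator Q above that of
  w contains P0 and f, and f is not in P0 because it is a nonzerodivisor. So each division adds one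
  prime on top of the chain.\<close>

lemma prime_chain_aux:
  assumes "ideal_in S N" "ideal_in S N'" "N' \<subseteq> N" "depth_ge \<mm> n N N'" "maximal_annih N (saturation N') P0"
  shows "\<exists>P. P 0 = P0 \<and> (\<forall>i\<le>n. prime_in S (P i)) \<and> (\<forall>i<n. P i \<subset> P (Suc i))"
  using assms
proof (induction n arbitrary: N' P0)
  case 0
  have "prime_in S P0" using maximal_annih_prime[OF 0(1) ideal_saturation[OF 0(2)] 0(5)] .
  then show ?case by (intro exI[of _ "\<lambda>_. P0"]) auto
next
  case (Suc n)
  note N = Suc.prems(1) and N' = Suc.prems(2,3)
  obtain f where f: "f \<in> \<mm>" "nonzerodivisor f N N'" "depth_ge \<mm> n N (add_multiples f N N')"
    using Suc.prems by auto
  have fS: "f \<in> S" using f mm_S by blast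
  have P0: "prime_in S P0" using maximal_annih_prime[OF N ideal_saturation[OF N'(1)] Suc.prems(5)] .
  have P0S: "P0 \<subseteq> S" using P0 idealD(1)[of P0] by (auto simp: prime_in_def)
  obtain u where u: "u \<in> N" "u \<notin> saturation N'" "P0 = annih u (saturation N')"
    using Suc.prems by (auto simp: maximal_annih_def)
  then have "\<forall>s\<in>P0. s * u \<in> saturation N'" by (auto simp: annih_def)
  then obtain w where w: "w \<in> N" "\<forall>s\<in>P0. s * w \<in> saturation N'" "w \<notin> saturation (add_multiples f N N')"
    using annihilated_not_subset[OF N N' f(1,2) P0S u(1,2)] by metis
  have iq: "ideal_in S (add_multiples f N N')" using ideal_add_multiples[OF fS N N'(1)] .
  obtain Q where Q: "maximal_annih N (saturation (add_multiples f N N')) Q"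
    "annih w (saturation (add_multiples f N N')) \<subseteq> Q"
    using maximal_annih_exists[OF N ideal_saturation[OF iq], of w] w by blast
  have satmono: "saturation N' \<subseteq> saturation (add_multiples f N N')"
    using add_multiples_upper[OF N] by (auto simp: saturation_def)
  have "P0 \<subseteq> Q" using Q w satmono P0S by (auto simp: annih_def)
  moreover have "f \<in> Q"
    using Q(2) fS mult_in_add_multiples[OF N'(1) w(1)] saturation_upper[OF iq] by (auto simp: annih_def)
  moreover have "f \<notin> P0" using nonzerodivisor_saturation[OF N f(2) u(1)] u by (auto simp: annih_def)
  ultimately have lt: "P0 \<subset> Q" by blast
  obtain P where P: "P 0 = Q" "\<forall>i\<le>n. prime_in S (P i)" "\<forall>i<n. P i \<subset> P (Suc i)"
    using Suc.IH[OF N iq add_multiples_subset[OF fS N N'(2)] f(3) Q(1)] by blast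
  show ?case
  proof (intro exI[of _ "case_nat P0 P"] conjI allI impI)
    show "prime_in S (case_nat P0 P i)" if "i \<le> Suc n" for i using that P P0 by (cases i) auto
    show "case_nat P0 P i \<subset> case_nat P0 P (Suc i)" if "i < Suc n" for i using that P lt by (cases i) auto
  qed simp
qed

text \<open>The last hypothesis says that u is nonzero in the localization at 1 + \<mm>. The chain
  starts above the annihilator of u, so it bounds the dimension of S modulo any ideal that kills
  u.\<close>

theorem prime_chain:
  assumes "ideal_in S N" "ideal_in S N'" "N' \<subseteq> N" "depth_ge \<mm> n N N'" "u \<in> N" "u \<notin> saturation N'"
  shows "\<exists>P. annih u N' \<subseteq> P 0 \<and> (\<forall>i\<le>n. prime_in S (P i)) \<and> (\<forall>i<n. P i \<subset> P (Suc i))"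
proof -
  obtain P0 where P0: "maximal_annih N (saturation N') P0" "annih u (saturation N') \<subseteq> P0"
    using maximal_annih_exists[OF assms(1) ideal_saturation[OF assms(2)], of u] assms by blast
  have sub: "annih u N' \<subseteq> annih u (saturation N')"
    unfolding annih_def using saturation_upper[OF assms(2)] by blast
  obtain P where P: "P 0 = P0" "\<forall>i\<le>n. prime_in S (P i)" "\<forall>i<n. P i \<subset> P (Suc i)"
    using prime_chain_aux[OF assms(1-4) P0(1)] by blast
  then show ?thesis using P0(2) sub by (intro exI[of _ P]) simp
qed

end

section \<open>Hilbert's basis theorem\<close>

definition chain_condition :: "'a::comm_ring_1 set \<Rightarrow> bool" where
  "chain_condition S \<longleftrightarrow>
    (\<forall>I :: nat \<Rightarrow> 'a set. (\<forall>i. ideal_in S (I i)) \<and> (\<forall>i. I i \<subseteq> I (Suc i)) \<longrightarrow> (\<exists>n. \<forall>k\<ge>n. I k = I n))"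

lemma chain_conditionD:
  fixes I :: "nat \<Rightarrow> 'a::comm_ring_1 set"
  assumes "chain_condition S" "\<And>i. ideal_in S (I i)" "\<And>i. I i \<subseteq> I (Suc i)"
  shows "\<exists>n. \<forall>k\<ge>n. I k = I n"
  using assms unfolding chain_condition_def by simp

lemma chain_condition_imp_max_condition:
  assumes "chain_condition S"
  shows "max_condition S"
  unfolding max_condition_def
proof (intro allI impI, rule ccontr)
  fix \<F> assume \<F>: "\<F> \<noteq> {} \<and> (\<forall>N\<in>\<F>. ideal_in S N)"
    and neg: "\<not> (\<exists>M\<in>\<F>. \<forall>N\<in>\<F>. M \<subseteq> N \<longrightarrow> N = M)"
  have "\<exists>I. \<forall>n. I n \<in> \<F> \<and> I n \<subset> I (Suc n)"
  proof (rule dependent_nat_choice)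
    show "\<exists>x. x \<in> \<F>" using \<F> by blast
    show "\<exists>y. y \<in> \<F> \<and> x \<subset> y" if "x \<in> \<F>" for x and n :: nat using that neg by blast
  qed
  then obtain I where I: "\<And>n. I n \<in> \<F>" "\<And>n. I n \<subset> I (Suc n)" by blast
  have "\<exists>n. \<forall>k\<ge>n. I k = I n"
  proof (rule chain_conditionD[OF assms])
    show "ideal_in S (I i)" for i using I(1) \<F> by blast
    show "I i \<subseteq> I (Suc i)" for i using I(2) by blast
  qed
  then obtain n where n: "\<And>k. k \<ge> n \<Longrightarrow> I k = I n" by blast
  have "I (Suc n) = I n" by (rule n) simp
  then show False using I(2)[of n] by simp
qed

text \<open>\<open>polys_below S x k\<close> are the polynomial expressions of degree \<open>< k\<close> in \<open>x\<close>; since \<open>x\<close> need not be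
  transcendental over \<open>S\<close>, degrees and leading coefficients belong to expressions and not to elements.\<close>
primrec polys_below :: "'a::comm_ring_1 set \<Rightarrow> 'a \<Rightarrow> nat \<Rightarrow> 'a set" where
  "polys_below S x 0 = {0}"
| "polys_below S x (Suc k) = {a * x ^ k + p | a p. a \<in> S \<and> p \<in> polys_below S x k}"

definition lead_coeffs :: "'a::comm_ring_1 set \<Rightarrow> 'a \<Rightarrow> nat \<Rightarrow> 'a set \<Rightarrow> 'a set" where
  "lead_coeffs S x k I = {a \<in> S. \<exists>p\<in>polys_below S x k. a * x ^ k + p \<in> I}"

context
  fixes S :: "'a::comm_ring_1 set" and x :: 'a
  assumes S: "subring_set S"
begin

lemmas S_closed = subring_setD[OF S]

lemma polys_below_add: "p \<in> polys_below S x k \<Longrightarrow> q \<in> polys_below S x k \<Longrightarrow> p + q \<in> polys_below S x k"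
proof (induction k arbitrary: p q)
  case (Suc k)
  then obtain a p' b q' where *: "p = a * x ^ k + p'" "q = b * x ^ k + q'" "a \<in> S" "b \<in> S"
    "p' \<in> polys_below S x k" "q' \<in> polys_below S x k" by auto
  then have "p + q = (a + b) * x ^ k + (p' + q')" by (simp add: algebra_simps)
  moreover have "a + b \<in> S" using S_closed(3)[OF *(3,4)] .
  ultimately show ?case using Suc.IH[OF *(5,6)] by auto
qed simp

lemma polys_below_scale: "p \<in> polys_below S x k \<Longrightarrow> s \<in> S \<Longrightarrow> s * p \<in> polys_below S x k"
proof (induction k arbitrary: p)
  case (Suc k)
  then obtain a p' where *: "p = a * x ^ k + p'" "a \<in> S" "p' \<in> polys_below S x k" by auto
  then have "s * p = (s * a) * x ^ k + s * p'" by (simp add: algebra_simps)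
  moreover have "s * a \<in> S" using S_closed(5)[OF Suc.prems(2) *(2)] .
  ultimately show ?case using Suc.IH[OF *(3) Suc.prems(2)] by auto
qed simp

lemma polys_below_zero: "0 \<in> polys_below S x k"
proof (induction k)
  case (Suc k)
  have "0 = 0 * x ^ k + 0" by simp
  then show ?case unfolding polys_below.simps using Suc S_closed(2) by (intro CollectI exI conjI)
qed simp

lemma polys_below_diff: "p \<in> polys_below S x k \<Longrightarrow> q \<in> polys_below S x k \<Longrightarrow> p - q \<in> polys_below S x k"
  using polys_below_add[of p k "- 1 * q"] polys_below_scale[of q k "- 1"] S_closed by simp

lemma polys_below_shift: "p \<in> polys_below S x k \<Longrightarrow> x * p \<in> polys_below S x (Suc k)"
proof (induction k arbitrary: p)
  case 0
  then show ?case using polys_below_zero[of 1] by simp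
next
  case (Suc k)
  then obtain a p' where *: "p = a * x ^ k + p'" "a \<in> S" "p' \<in> polys_below S x k" by auto
  then have "x * p = a * x ^ Suc k + x * p'" by (simp add: algebra_simps)
  then show ?case using Suc.IH[OF *(3)] *(2) polys_below.simps(2)[of S x "Suc k"] by blast
qed

lemma ideal_lead_coeffs:
  assumes "ideal_in T I" "S \<subseteq> T"
  shows "ideal_in S (lead_coeffs S x k I)"
proof -
  have "0 * x ^ k + 0 \<in> I" using assms by (simp add: ideal_in_def)
  then have "0 \<in> lead_coeffs S x k I"
    unfolding lead_coeffs_def using S_closed(2) polys_below_zero[of k] by (intro CollectI conjI bexI[of _ 0])
  moreover have "a + b \<in> lead_coeffs S x k I" if "a \<in> lead_coeffs S x k I" "b \<in> lead_coeffs S x k I" for a b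
  proof -
    obtain p q where *: "a \<in> S" "b \<in> S" "p \<in> polys_below S x k" "q \<in> polys_below S x k"
      "a * x ^ k + p \<in> I" "b * x ^ k + q \<in> I" using \<open>a \<in> _\<close> \<open>b \<in> _\<close> by (auto simp: lead_coeffs_def)
    then have "(a * x ^ k + p) + (b * x ^ k + q) \<in> I" using assms unfolding ideal_in_def by blast
    then have "(a + b) * x ^ k + (p + q) \<in> I" by (simp add: algebra_simps)
    then show ?thesis using S_closed(3)[OF *(1,2)] polys_below_add[OF *(3,4)] unfolding lead_coeffs_def by blast
  qed
  moreover have "s * a \<in> lead_coeffs S x k I" if "s \<in> S" "a \<in> lead_coeffs S x k I" for s a
  proof -
    obtain p where *: "a \<in> S" "p \<in> polys_below S x k" "a * x ^ k + p \<in> I"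
      using \<open>a \<in> _\<close> by (auto simp: lead_coeffs_def)
    then have "s * (a * x ^ k + p) \<in> I" using assms \<open>s \<in> S\<close> unfolding ideal_in_def by blast
    then have "(s * a) * x ^ k + (s * p) \<in> I" by (simp add: algebra_simps)
    then show ?thesis using S_closed(5)[OF \<open>s \<in> S\<close> *(1)] polys_below_scale[OF *(2) \<open>s \<in> S\<close>]
      unfolding lead_coeffs_def by blast
  qed
  ultimately show ?thesis by (auto simp: ideal_in_def lead_coeffs_def)
qed

lemma lead_coeffs_mono: "I \<subseteq> J \<Longrightarrow> lead_coeffs S x k I \<subseteq> lead_coeffs S x k J"
  unfolding lead_coeffs_def by blast

lemma lead_coeffs_Suc:
  assumes "ideal_in T I" "x \<in> T"
  shows "lead_coeffs S x k I \<subseteq> lead_coeffs S x (Suc k) I"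
proof
  fix a assume "a \<in> lead_coeffs S x k I"
  then obtain p where *: "a \<in> S" "p \<in> polys_below S x k" "a * x ^ k + p \<in> I"
    by (auto simp: lead_coeffs_def)
  then have "x * (a * x ^ k + p) \<in> I" using assms unfolding ideal_in_def by blast
  then have "a * x ^ Suc k + x * p \<in> I" by (simp add: algebra_simps)
  then show "a \<in> lead_coeffs S x (Suc k) I"
    using *(1) polys_below_shift[OF *(2)] unfolding lead_coeffs_def by blast
qed

text \<open>From p in J, an element of I with the same formal leading coefficient is subtracted; the
  difference lies in J and has smaller formal degree.\<close>

lemma lead_coeffs_determine:
  assumes I: "ideal_in T I" and J: "ideal_in T J" and T: "subring_set T" and IJ: "I \<subseteq> J"
    and eq: "\<And>k. lead_coeffs S x k J \<subseteq> lead_coeffs S x k I"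
  shows "p \<in> polys_below S x k \<Longrightarrow> p \<in> J \<Longrightarrow> p \<in> I"
proof (induction k arbitrary: p)
  case 0
  then show ?case using I by (simp add: ideal_in_def)
next
  case (Suc k)
  then obtain a q where aq: "p = a * x ^ k + q" "a \<in> S" "q \<in> polys_below S x k" by auto
  then have "a \<in> lead_coeffs S x k I" using Suc.prems eq unfolding lead_coeffs_def by blast
  then obtain q' where q': "q' \<in> polys_below S x k" "a * x ^ k + q' \<in> I" by (auto simp: lead_coeffs_def)
  have "- 1 * (a * x ^ k + q') \<in> J"
    using q' IJ J subring_setD(1,6)[OF T] unfolding ideal_in_def by blast
  then have "p + - 1 * (a * x ^ k + q') \<in> J" using Suc.prems J unfolding ideal_in_def by blast
  then have "q - q' \<in> J" using aq by simp
  then have "q - q' \<in> I" using Suc.IH polys_below_diff aq q' by blast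
  then have "(a * x ^ k + q') + (q - q') \<in> I" using q' I unfolding ideal_in_def by blast
  then show ?case using aq by simp
qed

text \<open>The ideals \<open>?L k i\<close> of leading coefficients grow with the degree k and with
  the index i. Stability of the diagonal from n on controls all degrees k \<ge> n simultaneously;
  each of the finitely many degrees below n becomes stable at an index of its own, and M exceeds all
  these indices.\<close>

theorem hilbert_basis_step:
  assumes cc: "chain_condition S" and T: "subring_set T" and ST: "S \<subseteq> T" and x: "x \<in> T"
    and gen: "T \<subseteq> (\<Union>k. polys_below S x k)"
  shows "chain_condition T"
  unfolding chain_condition_def
proof (intro allI impI)
  fix I :: "nat \<Rightarrow> 'a set"
  assume I: "(\<forall>i. ideal_in T (I i)) \<and> (\<forall>i. I i \<subseteq> I (Suc i))"
  have mono: "I i \<subseteq> I j" if "i \<le> j" for i j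
    using lift_Suc_mono_le[of I i j] I that by blast
  let ?L = "\<lambda>k i. lead_coeffs S x k (I i)"
  have iL: "ideal_in S (?L k i)" for k i using ideal_lead_coeffs I ST by blast
  have Lmono: "?L k i \<subseteq> ?L l j" if "k \<le> l" "i \<le> j" for k l i j
  proof -
    have "?L k i \<subseteq> ?L l i" using lift_Suc_mono_le[of "\<lambda>k. ?L k i" k l] lead_coeffs_Suc I x that by blast
    also have "\<dots> \<subseteq> ?L l j" using lead_coeffs_mono mono that by blast
    finally show ?thesis .
  qed
  have diag: "?L i i \<subseteq> ?L (Suc i) (Suc i)" for i by (rule Lmono) auto
  have "\<exists>n. \<forall>k\<ge>n. ?L k k = ?L n n"
    by (rule chain_conditionD[OF cc, of "\<lambda>i. ?L i i", OF iL diag])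
  then obtain n where n: "\<And>k. k \<ge> n \<Longrightarrow> ?L k k = ?L n n" by blast
  have "\<exists>m. \<forall>j\<ge>m. ?L k j = ?L k m" for k
  proof -
    have st: "?L k i \<subseteq> ?L k (Suc i)" for i by (rule Lmono) auto
    show ?thesis by (rule chain_conditionD[OF cc, of "\<lambda>i. ?L k i", OF iL st])
  qed
  then obtain m where m: "\<And>k j. j \<ge> m k \<Longrightarrow> ?L k j = ?L k (m k)" by metis
  define M where "M = Max (insert n (m ` {..<n}))"
  have Mn: "n \<le> M" and Mm: "\<And>k. k < n \<Longrightarrow> m k \<le> M" unfolding M_def by simp_all
  have L: "?L k j \<subseteq> ?L k M" if "j \<ge> M" for k j
  proof (cases "k < n")
    case True
    then show ?thesis using m[of k j] m[of k M] Mm that by fastforce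
  next
    case False
    have "?L k j \<subseteq> ?L (max k j) (max k j)" by (rule Lmono) auto
    also have "\<dots> = ?L n n" by (rule n) (use False in simp)
    also have "\<dots> \<subseteq> ?L k M" using Lmono False Mn by simp
    finally show ?thesis .
  qed
  have "I j = I M" if j: "j \<ge> M" for j
  proof
    show "I M \<subseteq> I j" using mono j by blast
    show "I j \<subseteq> I M"
    proof
      fix p assume p: "p \<in> I j"
      then have "p \<in> T" using I by (auto simp: ideal_in_def)
      then obtain k where "p \<in> polys_below S x k" using gen by blast
      then show "p \<in> I M" using lead_coeffs_determine[of T "I M" "I j"] I T mono[OF j] L[OF j] p by blast
    qed
  qed
  then show "\<exists>n. \<forall>k\<ge>n. I k = I n" by blast
qed

end

section \<open>Monomial ideals\<close>

text \<open>The polynomial ring on V, its irrelevant ideal and all Stanley--Reisner ideals have this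
  shape, so inclusions and quotients among them are decided on sets of exponents.\<close>

definition monomial_span :: "('v \<Rightarrow>\<^sub>0 nat) set \<Rightarrow> ('v, 'k::comm_ring_1) mpoly set" where
  "monomial_span U = {p. Poly_Mapping.keys p \<subseteq> U}"

definition exponents :: "'v set \<Rightarrow> ('v \<Rightarrow>\<^sub>0 nat) set" where
  "exponents V = {e. Poly_Mapping.keys e \<subseteq> V}"

abbreviation polys :: "'v set \<Rightarrow> ('v, 'k::comm_ring_1) mpoly set" where
  "polys V \<equiv> monomial_span (exponents V)"

lemma keys_plus_nat:
  fixes a b :: "'v \<Rightarrow>\<^sub>0 nat"
  shows "Poly_Mapping.keys (a + b) = Poly_Mapping.keys a \<union> Poly_Mapping.keys b"
  by (auto simp: in_keys_iff lookup_add)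

lemma exponents_sum_eq_zero:
  fixes a b :: "'v \<Rightarrow>\<^sub>0 nat"
  shows "a + b = 0 \<longleftrightarrow> a = 0 \<and> b = 0"
proof
  assume "a + b = 0"
  then have "Poly_Mapping.keys (a + b) = {}" by simp
  then show "a = 0 \<and> b = 0" by (simp add: keys_plus_nat)
qed simp

lemma exponents_plus [simp]: "a + b \<in> exponents V \<longleftrightarrow> a \<in> exponents V \<and> b \<in> exponents V"
  by (simp add: exponents_def keys_plus_nat)

lemma zero_in_exponents [simp]: "0 \<in> exponents V"
  by (simp add: exponents_def)

lemma single_in_exponents [simp]: "Poly_Mapping.single v n \<in> exponents V \<longleftrightarrow> v \<in> V \<or> n = 0"
  by (simp add: exponents_def)

lemma single_in_monomial_span [simp]: "e \<in> U \<Longrightarrow> Poly_Mapping.single e c \<in> monomial_span U"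
  by (simp add: monomial_span_def)

lemma monomial_span_add: "p \<in> monomial_span U \<Longrightarrow> q \<in> monomial_span U \<Longrightarrow> p + q \<in> monomial_span U"
  using keys_add[of p q] by (auto simp: monomial_span_def)

lemma monomial_span_diff: "p \<in> monomial_span U \<Longrightarrow> q \<in> monomial_span U \<Longrightarrow> p - q \<in> monomial_span U"
  by (auto simp: monomial_span_def in_keys_iff lookup_minus subset_iff) (metis diff_zero)

lemma zero_in_monomial_span [simp]: "0 \<in> monomial_span U"
  by (simp add: monomial_span_def)

lemma monomial_span_mono: "U \<subseteq> U' \<Longrightarrow> monomial_span U \<subseteq> monomial_span U'"
  by (auto simp: monomial_span_def)

lemma poly_eq_sum_monomials:
  fixes p :: "'a \<Rightarrow>\<^sub>0 'b::comm_monoid_add"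
  shows "p = (\<Sum>e\<in>Poly_Mapping.keys p. Poly_Mapping.single e (Poly_Mapping.lookup p e))"
proof (rule poly_mapping_eqI)
  fix k
  have "(\<Sum>e\<in>Poly_Mapping.keys p. Poly_Mapping.lookup (Poly_Mapping.single e (Poly_Mapping.lookup p e)) k) =
     (\<Sum>e\<in>Poly_Mapping.keys p. if e = k then Poly_Mapping.lookup p k else 0)"
    by (rule sum.cong) (auto simp: lookup_single when_def)
  also have "\<dots> = Poly_Mapping.lookup p k" by (simp add: in_keys_iff)
  finally show "Poly_Mapping.lookup p k =
     Poly_Mapping.lookup (\<Sum>e\<in>Poly_Mapping.keys p. Poly_Mapping.single e (Poly_Mapping.lookup p e)) k"
    by (simp add: lookup_sum)
qed

lemma sum_in_set:
  assumes "finite A" "0 \<in> B" "\<And>x y. x \<in> B \<Longrightarrow> y \<in> B \<Longrightarrow> x + y \<in> B" "\<And>a. a \<in> A \<Longrightarrow> f a \<in> B"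
  shows "sum f A \<in> B"
  using assms(1,4) by (induction A) (use assms in auto)

lemma monomial_span_subset:
  assumes "0 \<in> A" "\<And>x y. x \<in> A \<Longrightarrow> y \<in> A \<Longrightarrow> x + y \<in> A"
    "\<And>e c. e \<in> U \<Longrightarrow> Poly_Mapping.single e c \<in> A"
  shows "monomial_span U \<subseteq> A"
proof
  fix p :: "('a, 'b) mpoly" assume "p \<in> monomial_span U"
  then have "(\<Sum>e\<in>Poly_Mapping.keys p. Poly_Mapping.single e (Poly_Mapping.lookup p e)) \<in> A"
    by (intro sum_in_set assms) (auto simp: monomial_span_def)
  then show "p \<in> A" using poly_eq_sum_monomials[of p] by simp
qed

lemma monomial_span_mult:
  fixes p q :: "('v, 'k::comm_ring_1) mpoly"
  assumes "\<And>a e. a \<in> A \<Longrightarrow> e \<in> B \<Longrightarrow> a + e \<in> C" "p \<in> monomial_span A" "q \<in> monomial_span B"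
  shows "p * q \<in> monomial_span C"
  using keys_mult[of p q] assms by (fastforce simp: monomial_span_def)

lemma lookup_monomial_mult:
  fixes p :: "('v, 'k::comm_ring_1) mpoly"
  shows "Poly_Mapping.lookup (Poly_Mapping.single a c * p) (a + e) = c * Poly_Mapping.lookup p e"
proof -
  have "Poly_Mapping.lookup (Poly_Mapping.single a c * p) (a + e) =
    (\<Sum>b\<in>Poly_Mapping.keys p. Poly_Mapping.lookup (Poly_Mapping.single a c * Poly_Mapping.single b (Poly_Mapping.lookup p b)) (a + e))"
    by (subst poly_eq_sum_monomials[of p]) (simp only: sum_distrib_left lookup_sum)
  also have "\<dots> = (\<Sum>b\<in>Poly_Mapping.keys p. if b = e then c * Poly_Mapping.lookup p e else 0)"
    by (rule sum.cong) (auto simp: mult_single lookup_single when_def)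
  also have "\<dots> = c * Poly_Mapping.lookup p e" by (simp add: in_keys_iff)
  finally show ?thesis .
qed

lemma subring_polys: "subring_set (polys V :: ('v, 'k::comm_ring_1) mpoly set)"
proof -
  have "x * y \<in> polys V" if "x \<in> polys V" "y \<in> polys V" for x y :: "('v, 'k) mpoly"
    using that by (rule monomial_span_mult[rotated]) simp
  moreover have "(1 :: ('v, 'k) mpoly) \<in> polys V"
    using single_in_monomial_span[of 0 "exponents V" 1] by simp
  ultimately show ?thesis by (auto simp: subring_set_def monomial_span_diff)
qed

interpretation polys: subring_context "polys V" for V
  by unfold_locales (rule subring_polys)

definition monomial_ideal_exps :: "'v set \<Rightarrow> ('v \<Rightarrow>\<^sub>0 nat) set \<Rightarrow> bool" where
  "monomial_ideal_exps V U \<longleftrightarrow> U \<subseteq> exponents V \<and> (\<forall>e\<in>U. \<forall>a\<in>exponents V. a + e \<in> U)"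

lemma ideal_monomial_span: "monomial_ideal_exps V U \<Longrightarrow> ideal_in (polys V) (monomial_span U)"
  unfolding ideal_in_def monomial_ideal_exps_def
  by (auto intro: monomial_span_add monomial_span_mult dest: monomial_span_mono)

lemma variable_power: "variable v ^ k = (Poly_Mapping.single (Poly_Mapping.single v k) 1 :: ('v, 'k::comm_ring_1) mpoly)"
proof (induction k)
  case (Suc k)
  have "variable v ^ Suc k = (variable v :: ('v, 'k) mpoly) * variable v ^ k" by simp
  also have "\<dots> = Poly_Mapping.single (Poly_Mapping.single v 1 + Poly_Mapping.single v k) 1"
    unfolding Suc.IH by (simp add: variable_def mult_single)
  also have "Poly_Mapping.single v 1 + Poly_Mapping.single v k = Poly_Mapping.single v (Suc k)"
    by (simp flip: single_add)
  finally show ?case .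
qed simp

lemma polys_empty: "p \<in> polys {} \<longleftrightarrow> (\<exists>c. p = Poly_Mapping.single 0 c)"
proof
  assume "p \<in> polys {}"
  then have "\<And>e. e \<noteq> 0 \<Longrightarrow> Poly_Mapping.lookup p e = 0"
    by (force simp: monomial_span_def exponents_def in_keys_iff)
  then have "p = Poly_Mapping.single 0 (Poly_Mapping.lookup p 0)"
    by (intro poly_mapping_eqI) (simp add: lookup_single when_def)
  then show "\<exists>c. p = Poly_Mapping.single 0 c" ..
qed auto

lemma chain_condition_constants: "chain_condition (polys {} :: ('v, 'k::field) mpoly set)"
  unfolding chain_condition_def
proof (intro allI impI)
  fix I :: "nat \<Rightarrow> ('v, 'k) mpoly set"
  assume I: "(\<forall>i. ideal_in (polys {}) (I i)) \<and> (\<forall>i. I i \<subseteq> I (Suc i))"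
  show "\<exists>n. \<forall>k\<ge>n. I k = I n"
  proof (cases "\<exists>n. \<exists>p\<in>I n. p \<noteq> 0")
    case True
    then obtain n p where p: "p \<in> I n" "p \<noteq> 0" by blast
    then have "p \<in> polys {}" using I unfolding ideal_in_def by blast
    then obtain c where c: "p = Poly_Mapping.single 0 c" using polys_empty by blast
    then have "c \<noteq> 0" using p by auto
    have full: "I k = polys {}" if "k \<ge> n" for k
    proof
      show "I k \<subseteq> polys {}" using I unfolding ideal_in_def by blast
      have pk: "p \<in> I k" using lift_Suc_mono_le[of I n k] I that p by blast
      show "polys {} \<subseteq> I k"
      proof
        fix q :: "('v, 'k) mpoly" assume "q \<in> polys {}"
        then obtain d where d: "q = Poly_Mapping.single 0 d" using polys_empty by blast
        have "Poly_Mapping.single 0 (d / c) \<in> polys {}" by simp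
        then have "Poly_Mapping.single 0 (d / c) * p \<in> I k" using I pk unfolding ideal_in_def by blast
        then show "q \<in> I k" using \<open>c \<noteq> 0\<close> by (simp add: c d mult_single)
      qed
    qed
    have "I k = I n" if "k \<ge> n" for k using full[OF that] full[of n] by simp
    then show ?thesis by blast
  next
    case False
    then have "I k = {0}" for k using I unfolding ideal_in_def by blast
    then show ?thesis by simp
  qed
qed

lemma chain_condition_polys:
  assumes "finite V"
  shows "chain_condition (polys V :: ('v, 'k::field) mpoly set)"
  using assms
proof (induction V)
  case empty
  show ?case by (rule chain_condition_constants)
next
  case (insert v V)
  let ?S = "polys V :: ('v, 'k) mpoly set" and ?x = "variable v :: ('v, 'k) mpoly"
  have below_mono: "polys_below ?S ?x k \<subseteq> polys_below ?S ?x l" if "k \<le> l" for k l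
  proof (rule lift_Suc_mono_le[OF _ that])
    fix n
    show "polys_below ?S ?x n \<subseteq> polys_below ?S ?x (Suc n)"
    proof
      fix p assume "p \<in> polys_below ?S ?x n"
      then have "0 * ?x ^ n + p \<in> polys_below ?S ?x (Suc n)"
        unfolding polys_below.simps using zero_in_monomial_span by blast
      then show "p \<in> polys_below ?S ?x (Suc n)" by simp
    qed
  qed
  show ?case
  proof (rule hilbert_basis_step[OF subring_polys insert.IH subring_polys])
    show "?S \<subseteq> polys (insert v V)"
      by (rule monomial_span_mono) (auto simp: exponents_def)
    show "?x \<in> polys (insert v V)" by (simp add: variable_def)
    show "polys (insert v V) \<subseteq> (\<Union>k. polys_below ?S ?x k)"
    proof (rule monomial_span_subset)
      show "0 \<in> (\<Union>k. polys_below ?S ?x k)" using polys_below_zero[OF subring_polys] by blast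
      show "p + q \<in> (\<Union>k. polys_below ?S ?x k)"
        if pq: "p \<in> (\<Union>k. polys_below ?S ?x k)" "q \<in> (\<Union>k. polys_below ?S ?x k)" for p q
      proof -
        obtain k l where kl: "p \<in> polys_below ?S ?x k" "q \<in> polys_below ?S ?x l" using pq by blast
        have "p \<in> polys_below ?S ?x (max k l)" using kl(1) below_mono[of k "max k l"] by auto
        moreover have "q \<in> polys_below ?S ?x (max k l)" using kl(2) below_mono[of l "max k l"] by auto
        ultimately have "p + q \<in> polys_below ?S ?x (max k l)" by (rule polys_below_add[OF subring_polys])
        then show ?thesis by blast
      qed
      fix e c assume e: "e \<in> exponents (insert v V)"
      define k where "k = Poly_Mapping.lookup e v"
      define e' where "e' = e - Poly_Mapping.single v k"
      have ee': "e = e' + Poly_Mapping.single v k"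
        by (rule poly_mapping_eqI) (simp add: e'_def k_def lookup_add lookup_minus lookup_single when_def)
      have "e' \<in> exponents V"
        using e by (auto simp: exponents_def e'_def k_def in_keys_iff lookup_minus lookup_single when_def subset_iff)
      then have "Poly_Mapping.single e' c \<in> ?S" by simp
      then have "Poly_Mapping.single e' c * ?x ^ k + 0 \<in> polys_below ?S ?x (Suc k)"
        unfolding polys_below.simps using polys_below_zero[OF subring_polys, of V ?x k] by blast
      moreover have "Poly_Mapping.single e' c * ?x ^ k + 0 = Poly_Mapping.single e c"
        by (simp add: variable_power mult_single ee')
      ultimately show "Poly_Mapping.single e c \<in> (\<Union>k. polys_below ?S ?x k)" by (metis UN_iff UNIV_I)
    qed
  qed
qed

lemma noetherian_polys:
  "finite V \<Longrightarrow> noetherian_subring (polys V :: ('v, 'k::field) mpoly set)"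
  by (intro noetherian_subring.intro subring_context.intro noetherian_subring_axioms.intro subring_polys chain_condition_imp_max_condition chain_condition_polys)

lemma monomial_ideal_irrelevant: "monomial_ideal_exps V (exponents V - {0})"
  by (auto simp: monomial_ideal_exps_def exponents_sum_eq_zero)

lemma noetherian_polys_with_ideal:
  "finite V \<Longrightarrow> noetherian_subring_with_ideal (polys V :: ('v, 'k::field) mpoly set) (monomial_span (exponents V - {0}))"
  by (intro noetherian_subring_with_ideal.intro noetherian_polys noetherian_subring_with_ideal_axioms.intro
      ideal_monomial_span monomial_ideal_irrelevant)

lemma nonzerodivisor_variable:
  assumes "\<And>e. e \<in> U \<Longrightarrow> Poly_Mapping.single w 1 + e \<in> U' \<Longrightarrow> e \<in> U'"
  shows "nonzerodivisor (variable w :: ('v, 'k::comm_ring_1) mpoly) (monomial_span U) (monomial_span U')"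
  unfolding nonzerodivisor_def
proof (intro ballI impI)
  fix p :: "('v, 'k) mpoly"
  assume p: "p \<in> monomial_span U" and xp: "variable w * p \<in> monomial_span U'"
  have "e \<in> U'" if e: "e \<in> Poly_Mapping.keys p" for e
  proof -
    have "Poly_Mapping.lookup (variable w * p) (Poly_Mapping.single w 1 + e) = Poly_Mapping.lookup p e"
      by (simp add: variable_def lookup_monomial_mult)
    then have "Poly_Mapping.single w 1 + e \<in> Poly_Mapping.keys (variable w * p)"
      using e by (simp add: in_keys_iff)
    then show ?thesis using assms e p xp by (auto simp: monomial_span_def)
  qed
  then show "p \<in> monomial_span U'" by (auto simp: monomial_span_def)
qed

lemma add_multiples_variable:
  "add_multiples (variable w :: ('v, 'k::comm_ring_1) mpoly) (monomial_span U) (monomial_span U') =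
   monomial_span (U' \<union> (\<lambda>e. Poly_Mapping.single w 1 + e) ` U)"
    (is "?L = monomial_span ?W")
proof
  have "variable w * z \<in> monomial_span ?W" if "z \<in> monomial_span U" for z :: "('v, 'k) mpoly"
    by (rule monomial_span_mult[of "{Poly_Mapping.single w 1}" U, OF _ _ that]) (auto simp: variable_def)
  moreover have "y \<in> monomial_span ?W" if "y \<in> monomial_span U'" for y :: "('v, 'k) mpoly"
    using monomial_span_mono[of U' ?W] that by blast
  ultimately show "?L \<subseteq> monomial_span ?W"
    unfolding add_multiples_def using monomial_span_add by blast
  show "monomial_span ?W \<subseteq> ?L"
  proof (rule monomial_span_subset)
    have "0 + variable w * 0 \<in> ?L"
      unfolding add_multiples_def using zero_in_monomial_span by blast
    then show "0 \<in> ?L" by simp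
  next
    fix p q assume "p \<in> ?L" "q \<in> ?L"
    then obtain y z y' z' where *: "p = y + variable w * z" "q = y' + variable w * z'" "y \<in> monomial_span U'"
      "z \<in> monomial_span U" "y' \<in> monomial_span U'" "z' \<in> monomial_span U" unfolding add_multiples_def by blast
    have "p + q = (y + y') + variable w * (z + z')" unfolding * by (simp add: algebra_simps)
    then show "p + q \<in> ?L"
      unfolding add_multiples_def using monomial_span_add[OF *(3,5)] monomial_span_add[OF *(4,6)] by blast
  next
    fix e and c :: 'k assume e: "e \<in> ?W"
    show "Poly_Mapping.single e c \<in> ?L"
    proof (cases "e \<in> U'")
      case True
      then have "Poly_Mapping.single e c + variable w * 0 \<in> ?L"
        unfolding add_multiples_def using zero_in_monomial_span single_in_monomial_span by blast
      then show ?thesis by simp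
    next
      case False
      then obtain e' where e': "e' \<in> U" "e = Poly_Mapping.single w 1 + e'" using e by blast
      then have "0 + variable w * Poly_Mapping.single e' c \<in> ?L"
        unfolding add_multiples_def using zero_in_monomial_span single_in_monomial_span by blast
      then show ?thesis using e' by (simp add: variable_def mult_single)
    qed
  qed
qed

text \<open>The variables in \<open>G\<close> form a regular sequence on the module with monomial basis \<open>U - U'\<close>. The last
  hypothesis keeps \<open>x\<^sub>v\<close> a nonzerodivisor after division by \<open>x\<^sub>w\<close>.\<close>
lemma depth_ge_variables:
  assumes "finite G" "G \<subseteq> V" "U' \<subseteq> U"
    "\<And>v e. v \<in> G \<Longrightarrow> e \<in> U \<Longrightarrow> Poly_Mapping.single v 1 + e \<in> U' \<longleftrightarrow> e \<in> U'"
    "\<And>v e. v \<in> G \<Longrightarrow> e \<in> U \<Longrightarrow> Poly_Mapping.single v 1 + e \<in> U"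
    "\<And>v w e. v \<in> G \<Longrightarrow> w \<in> G \<Longrightarrow> v \<noteq> w \<Longrightarrow> Poly_Mapping.single v 1 + e \<in> U \<Longrightarrow> Poly_Mapping.single w 1 + e \<in> U \<Longrightarrow>
      e \<in> U \<or> Poly_Mapping.single v 1 + (Poly_Mapping.single w 1 + e) \<in> U'"
  shows "depth_ge (monomial_span (exponents V - {0}) :: ('v, 'k::comm_ring_1) mpoly set) (card G)
    (monomial_span U) (monomial_span U')"
  using assms
proof (induction G arbitrary: U')
  case (insert w G)
  let ?x = "\<lambda>v. Poly_Mapping.single v (1::nat)"
  let ?U = "U' \<union> (\<lambda>e. ?x w + e) ` U"
  have "Poly_Mapping.single w (1::nat) \<noteq> 0"
    by (metis keys_single keys_zero one_neq_zero insert_not_empty)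
  then have "variable w \<in> (monomial_span (exponents V - {0}) :: ('v, 'k) mpoly set)"
    using insert.prems(1) unfolding variable_def by (intro single_in_monomial_span) simp
  moreover have "nonzerodivisor (variable w :: ('v, 'k) mpoly) (monomial_span U) (monomial_span U')"
    by (rule nonzerodivisor_variable) (use insert.prems(3) in auto)
  moreover have "depth_ge (monomial_span (exponents V - {0}) :: ('v, 'k) mpoly set) (card G)
    (monomial_span U) (monomial_span ?U)"
  proof (rule insert.IH)
    show "G \<subseteq> V" "?U \<subseteq> U" using insert.prems by auto
    show "?x v + e \<in> U" if "v \<in> G" "e \<in> U" for v e using insert.prems that by blast
    show "e \<in> U \<or> ?x v + (?x u + e) \<in> ?U"
      if "v \<in> G" "u \<in> G" "v \<noteq> u" "?x v + e \<in> U" "?x u + e \<in> U" for v u e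
      using insert.prems(5)[of v u e] that by blast
    show "?x v + e \<in> ?U \<longleftrightarrow> e \<in> ?U" if ve: "v \<in> G" "e \<in> U" for v e
    proof
      assume "e \<in> ?U"
      then show "?x v + e \<in> ?U"
      proof
        assume "e \<in> U'"
        then show ?thesis using insert.prems(3)[of v e] ve by blast
      next
        assume "e \<in> (\<lambda>e. ?x w + e) ` U"
        then obtain e' where e': "e' \<in> U" "e = ?x w + e'" by blast
        have "?x v + e = ?x w + (?x v + e')" unfolding e' by (simp add: add.left_commute)
        moreover have "?x v + e' \<in> U" using insert.prems(4) ve e' by blast
        ultimately show ?thesis by blast
      qed
    next
      assume "?x v + e \<in> ?U"
      then show "e \<in> ?U"
      proof
        assume "?x v + e \<in> U'"
        then show ?thesis using insert.prems(3)[of v e] ve by blast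
      next
        assume "?x v + e \<in> (\<lambda>e. ?x w + e) ` U"
        then obtain e' where e': "e' \<in> U" "?x v + e = ?x w + e'" by blast
        have vw: "v \<noteq> w" using ve insert.hyps by blast
        \<comment> \<open>As v and w differ, comparing the exponents of w in x_v e = x_w e' shows
          that x_w divides e. The quotient d need not lie in U, but both x_v d and x_w d do, and the
          last hypothesis was made for this situation.\<close>
        define d where "d = e - ?x w"
        have look: "Poly_Mapping.lookup (?x v + e) u = Poly_Mapping.lookup (?x w + e') u" for u using e' by simp
        have "Poly_Mapping.lookup e w \<ge> 1" using look[of w] vw by (simp add: lookup_add lookup_single when_def)
        then have ed: "e = ?x w + d"
          by (intro poly_mapping_eqI) (auto simp: d_def lookup_add lookup_minus lookup_single when_def)
        then have "?x w + (?x v + d) = ?x w + e'" using e' by (simp add: add.left_commute)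
        then have "e' = ?x v + d" by simp
        then have "d \<in> U \<or> ?x v + (?x w + d) \<in> U'" using insert.prems(5)[of v w d] ve vw e' ed by blast
        then show ?thesis
        proof
          assume "d \<in> U"
          then show ?thesis using ed by blast
        next
          assume "?x v + (?x w + d) \<in> U'"
          then have "?x v + e \<in> U'" using ed by simp
          then show ?thesis using insert.prems(3)[of v e] ve by blast
        qed
      qed
    qed
  qed
  ultimately show ?case
    unfolding card_insert_disjoint[OF insert.hyps] depth_ge.simps
    by (intro bexI[of _ "variable w"] conjI) (simp_all only: add_multiples_variable)
qed simp

text \<open>The hypothesis on preimages makes h an isomorphism from N/N' onto its image h(N)/h(N'),
  and it persists when N' is replaced by N' + fN. It will be applied to the substitution that kills
  the variables outside a given set.\<close>

lemma depth_ge_image: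
  assumes "ideal_in S N" "ideal_in S N'" "N' \<subseteq> N" "\<mm> \<subseteq> S" "subring_set S"
    and add: "\<And>x y. x \<in> S \<Longrightarrow> y \<in> S \<Longrightarrow> h (x + y) = h x + h y"
    and mult: "\<And>x y. x \<in> S \<Longrightarrow> y \<in> S \<Longrightarrow> h (x * y) = h x * h y"
    and ker: "\<And>x. x \<in> N \<Longrightarrow> h x \<in> h ` N' \<Longrightarrow> x \<in> N'"
    and "depth_ge \<mm> n N N'"
  shows "depth_ge (h ` \<mm>) n (h ` N) (h ` N')"
  using assms(2,3,8,9)
proof (induction n arbitrary: N')
  case (Suc n)
  interpret subring_context S by unfold_locales (rule assms(5))
  obtain f where f: "f \<in> \<mm>" "nonzerodivisor f N N'" "depth_ge \<mm> n N (add_multiples f N N')"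
    using Suc.prems(4) by (auto simp only: depth_ge.simps)
  have fS: "f \<in> S" using f assms by blast
  note NS = idealD(6)[OF assms(1)] and NN = idealD(4)[OF assms(1) fS] and Nadd = idealD(3)[OF assms(1)]
  have im: "h ` add_multiples f N N' = add_multiples (h f) (h ` N) (h ` N')"
  proof -
    have *: "h (y + f * z) = h y + h f * h z" if yz: "y \<in> N'" "z \<in> N" for y z
    proof -
      have "y \<in> S" "z \<in> S" "f * z \<in> S" using yz Suc.prems(2) NS NN by blast+
      then show ?thesis using add[of y "f * z"] mult[of f z] fS by simp
    qed
    show ?thesis
    proof (intro equalityI subsetI)
      fix x assume "x \<in> h ` add_multiples f N N'"
      then obtain y z where "x = h (y + f * z)" "y \<in> N'" "z \<in> N" unfolding add_multiples_def by blast
      then show "x \<in> add_multiples (h f) (h ` N) (h ` N')" unfolding add_multiples_def using * by blast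
    next
      fix x assume "x \<in> add_multiples (h f) (h ` N) (h ` N')"
      then obtain y z where yz: "x = h y + h f * h z" "y \<in> N'" "z \<in> N" unfolding add_multiples_def by blast
      then have "x = h (y + f * z)" using * by simp
      moreover have "y + f * z \<in> add_multiples f N N'" unfolding add_multiples_def using yz by blast
      ultimately show "x \<in> h ` add_multiples f N N'" by blast
    qed
  qed
  have "nonzerodivisor (h f) (h ` N) (h ` N')" unfolding nonzerodivisor_def
  proof (intro ballI impI)
    fix hu assume hu: "hu \<in> h ` N" "h f * hu \<in> h ` N'"
    then obtain u where u: "h f * hu \<in> h ` N'" "hu = h u" "u \<in> N" by blast
    then have "h (f * u) \<in> h ` N'" using NS fS by (simp add: mult)
    then have "f * u \<in> N'" using Suc.prems(3) NN u by blast
    then show "hu \<in> h ` N'" using f u by (auto simp: nonzerodivisor_def)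
  qed
  moreover have "depth_ge (h ` \<mm>) n (h ` N) (h ` add_multiples f N N')"
  proof (rule Suc.IH)
    show "add_multiples f N N' \<subseteq> N" using add_multiples_subset[OF fS assms(1) Suc.prems(2)] .
    show "ideal_in S (add_multiples f N N')" using ideal_add_multiples[OF fS assms(1) Suc.prems(1)] .
    show "depth_ge \<mm> n N (add_multiples f N N')" by (rule f)
    show "x \<in> add_multiples f N N'" if x: "x \<in> N" "h x \<in> h ` add_multiples f N N'" for x
    proof -
      obtain y z where yz: "y \<in> N'" "z \<in> N" "h x = h (y + f * z)" using x(2) unfolding add_multiples_def by blast
      have w: "y + f * z \<in> N" using yz Suc.prems(2) NN Nadd by blast
      have d: "x - (y + f * z) \<in> N" using idealD(8)[OF assms(1) x(1) w] .
      have "h (x - (y + f * z) + (y + f * z)) = h (x - (y + f * z)) + h (y + f * z)"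
        by (rule add) (use NS d w in auto)
      then have "h (x - (y + f * z)) = 0" using yz by simp
      moreover have "h (0 + 0) = h 0 + h 0" by (rule add) auto
      then have "h 0 = 0" by simp
      ultimately have "h (x - (y + f * z)) \<in> h ` N'" using idealD(2)[OF Suc.prems(1)] by force
      then have "x - (y + f * z) \<in> N'" using Suc.prems(3) d by blast
      then have "(x - (y + f * z)) + y \<in> N'" using yz idealD(3)[OF Suc.prems(1)] by blast
      then have "(x - (y + f * z) + y) + f * z \<in> add_multiples f N N'" using add_multiplesI yz by blast
      then show ?thesis by simp
    qed
  qed
  ultimately show ?case using f(1) im by auto
qed simp

section \<open>Chains of primes modulo a monomial ideal\<close>

text \<open>Gaussian elimination: the equation b has a pivot a0, which is used to eliminate the
  unknown at a0 from the remaining equations. A solution of the smaller system is then extended by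
  the value - t at a0 that satisfies equation b.\<close>

lemma underdetermined_system:
  fixes c :: "'a \<Rightarrow> 'b \<Rightarrow> 'k::field"
  assumes "finite B" "finite A" "card B < card A"
  shows "\<exists>y. (\<exists>a\<in>A. y a \<noteq> 0) \<and> (\<forall>b\<in>B. (\<Sum>a\<in>A. y a * c a b) = 0)"
  using assms
proof (induction B arbitrary: A c)
  case empty
  then have "A \<noteq> {}" by auto
  then show ?case by (intro exI[of _ "\<lambda>_. 1"]) auto
next
  case (insert b B)
  show ?case
  proof (cases "\<forall>a\<in>A. c a b = 0")
    case True
    have "card B < card A" using insert by simp
    then show ?thesis using insert.IH[OF insert.prems(1), of c] True by (auto intro!: exI)
  next
    case False
    then obtain a0 where a0: "a0 \<in> A" "c a0 b \<noteq> 0" by blast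
    define A' where "A' = A - {a0}"
    have A: "A = insert a0 A'" "a0 \<notin> A'" "finite A'" using a0 insert by (auto simp: A'_def)
    have "card B < card A'" using insert A by simp
    then obtain y where y: "\<exists>a\<in>A'. y a \<noteq> 0"
      "\<And>d. d \<in> B \<Longrightarrow> (\<Sum>a\<in>A'. y a * (c a d - c a b / c a0 b * c a0 d)) = 0"
      using insert.IH[OF A(3), of "\<lambda>a d. c a d - c a b / c a0 b * c a0 d"] by blast
    define t where "t = (\<Sum>a\<in>A'. y a * c a b) / c a0 b"
    define z where "z a = (if a = a0 then - t else y a)" for a
    have sum_z: "(\<Sum>a\<in>A. z a * c a d) = (\<Sum>a\<in>A'. y a * c a d) - t * c a0 d" for d
    proof -
      have "(\<Sum>a\<in>A'. z a * c a d) = (\<Sum>a\<in>A'. y a * c a d)"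
        using A(2) by (intro sum.cong) (auto simp: z_def)
      then show ?thesis using A by (simp add: z_def)
    qed
    have "(\<Sum>a\<in>A. z a * c a d) = 0" if "d \<in> B" for d
    proof -
      have "(\<Sum>a\<in>A'. y a * (c a d - c a b / c a0 b * c a0 d)) = (\<Sum>a\<in>A'. y a * c a d) - t * c a0 d"
        by (simp add: t_def right_diff_distrib sum_subtractf sum_distrib_right sum_divide_distrib mult.assoc)
      then show ?thesis using y(2)[OF that] sum_z by simp
    qed
    moreover have "(\<Sum>a\<in>A. z a * c a b) = 0" using a0(2) by (simp add: sum_z t_def)
    moreover have "\<exists>a\<in>A. z a \<noteq> 0" using y(1) A by (auto simp: z_def)
    ultimately show ?thesis by (intro exI[of _ z]) auto
  qed
qed

text \<open>A polynomial of degree at most T in each variable, with coefficients c, evaluated at the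
  list. The recursion isolates the powers of the first argument, as the induction along a chain of
  primes requires; the closed form as a sum over \<open>exponent_lists\<close> is the one that
  counting and linear algebra use.\<close>

primrec multi_eval :: "nat \<Rightarrow> ('v, 'k::comm_ring_1) mpoly list \<Rightarrow> (nat list \<Rightarrow> 'k) \<Rightarrow> ('v, 'k) mpoly" where
  "multi_eval T [] c = Poly_Mapping.single 0 (c [])"
| "multi_eval T (x # xs) c = (\<Sum>a\<le>T. x ^ a * multi_eval T xs (\<lambda>as. c (a # as)))"

fun power_product :: "'a::comm_monoid_mult list \<Rightarrow> nat list \<Rightarrow> 'a" where
  "power_product (x # xs) (a # as) = x ^ a * power_product xs as"
| "power_product _ _ = 1"

definition exponent_lists :: "nat \<Rightarrow> nat \<Rightarrow> nat list set" where
  "exponent_lists T l = {as. set as \<subseteq> {..T} \<and> length as = l}"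

lemma finite_exponent_lists: "finite (exponent_lists T l)"
  unfolding exponent_lists_def by (rule finite_lists_length_eq) simp

lemma card_exponent_lists: "card (exponent_lists T l) = (T + 1) ^ l"
  unfolding exponent_lists_def by (subst card_lists_length_eq) simp_all

lemma multi_eval_eq_sum:
  "multi_eval T xs c = (\<Sum>as\<in>exponent_lists T (length xs). Poly_Mapping.single 0 (c as) * power_product xs as)"
proof (induction xs arbitrary: c)
  case Nil
  have "exponent_lists T 0 = {[]}" by (auto simp: exponent_lists_def)
  then show ?case by simp
next
  case (Cons x xs)
  have eq: "exponent_lists T (Suc (length xs)) = (\<lambda>(a, as). a # as) ` ({..T} \<times> exponent_lists T (length xs))"
    by (auto simp: exponent_lists_def length_Suc_conv image_iff)
  have inj: "inj_on (\<lambda>(a, as). a # as) ({..T} \<times> exponent_lists T (length xs))"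
    by (auto simp: inj_on_def)
  have "multi_eval T (x # xs) c =
    (\<Sum>a\<le>T. \<Sum>as\<in>exponent_lists T (length xs). Poly_Mapping.single 0 (c (a # as)) * power_product (x # xs) (a # as))"
    by (simp add: Cons.IH sum_distrib_left mult.left_commute)
  also have "\<dots> = (\<Sum>p\<in>{..T} \<times> exponent_lists T (length xs).
    Poly_Mapping.single 0 (c (fst p # snd p)) * power_product (x # xs) (fst p # snd p))"
    by (simp add: sum.cartesian_product split_def)
  also have "\<dots> = (\<Sum>as\<in>exponent_lists T (Suc (length xs)). Poly_Mapping.single 0 (c as) * power_product (x # xs) as)"
    unfolding eq by (subst sum.reindex[OF inj]) (simp add: split_def)
  finally show ?case by simp
qed

lemma prime_in_power: "prime_in S P \<Longrightarrow> subring_set S \<Longrightarrow> x \<in> S \<Longrightarrow> x \<notin> P \<Longrightarrow> x ^ n \<in> S \<and> x ^ n \<notin> P"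
proof (induction n)
  case (Suc n)
  then have "x ^ n \<in> S" "x ^ n \<notin> P" by auto
  then show ?case using Suc.prems subring_setD(5)[of S x "x ^ n"] by (auto simp: prime_in_def)
qed (auto simp: prime_in_def subring_set_def)

lemma multi_eval_in_subring: "set xs \<subseteq> polys V \<Longrightarrow> multi_eval T xs c \<in> polys V"
proof (induction xs arbitrary: c)
  case (Cons x xs)
  note S = subring_setD[OF subring_polys[of V]]
  have "x ^ a \<in> polys V" for a using Cons.prems by (induction a) (auto intro: S)
  then show ?case using Cons S(5) by (auto intro!: sum_in_set S)
qed simp

text \<open>Dividing out the largest possible power of \<open>x\<^sub>1\<close> and then setting \<open>x\<^sub>1 = 0\<close> (modulo the next prime)
  leaves a nonzero polynomial expression in the remaining \<open>x\<^sub>i\<close>.\<close>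
lemma multi_eval_notin_prime:
  fixes c :: "nat list \<Rightarrow> 'k::field"
  assumes "\<And>i. i \<le> length xs \<Longrightarrow> prime_in (polys V) (P i)" "\<And>i. i < length xs \<Longrightarrow> P i \<subseteq> P (Suc i)"
    "\<And>i. i < length xs \<Longrightarrow> xs ! i \<in> P (Suc i) - P i" "as \<in> exponent_lists T (length xs)" "c as \<noteq> 0"
  shows "multi_eval T xs c \<notin> P 0"
  using assms
proof (induction xs arbitrary: P c as)
  case Nil
  then have "prime_in (polys V) (P 0)" "as = []" by (auto simp: exponent_lists_def)
  show ?case
  proof
    assume "multi_eval T [] c \<in> P 0"
    moreover have "Poly_Mapping.single 0 (1 / c []) \<in> (polys V :: ('a, 'k) mpoly set)" by simp
    ultimately have "Poly_Mapping.single 0 (1 / c []) * Poly_Mapping.single 0 (c []) \<in> P 0"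
      using \<open>prime_in (polys V) (P 0)\<close> unfolding prime_in_def ideal_in_def multi_eval.simps by blast
    then show False using \<open>prime_in (polys V) (P 0)\<close> Nil.prems(5) \<open>as = []\<close>
      by (simp add: mult_single prime_in_def)
  qed
next
  case (Cons x xs)
  let ?S = "polys V :: ('a, 'k) mpoly set"
  have subS: "subring_set ?S" by (rule subring_polys)
  note S = subring_setD[OF subS]
  define s where "s a = multi_eval T xs (\<lambda>as. c (a # as))" for a
  have primes: "prime_in ?S (P 0)" "prime_in ?S (P 1)" using Cons.prems(1)[of 0] Cons.prems(1)[of 1] by simp_all
  then have ideals: "ideal_in ?S (P 0)" "ideal_in ?S (P 1)" by (auto simp: prime_in_def)
  have x: "x \<in> P 1" "x \<notin> P 0" using Cons.prems(3)[of 0] by auto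
  have xS: "x \<in> ?S" using x ideals unfolding ideal_in_def by blast
  have "set xs \<subseteq> ?S"
  proof
    fix y assume "y \<in> set xs"
    then obtain i where "i < length xs" "y = xs ! i" by (auto simp: in_set_conv_nth)
    then have "y \<in> P (Suc (Suc i))" "prime_in ?S (P (Suc (Suc i)))"
      using Cons.prems(3)[of "Suc i"] Cons.prems(1)[of "Suc (Suc i)"] by auto
    then show "y \<in> ?S" unfolding prime_in_def ideal_in_def by blast
  qed
  then have sS: "s a \<in> ?S" for a unfolding s_def by (rule multi_eval_in_subring)
  define good where "good a \<longleftrightarrow> (\<exists>bs\<in>exponent_lists T (length xs). c (a # bs) \<noteq> 0)" for a
  obtain a0 bs0 where a0: "as = a0 # bs0" "a0 \<le> T" "bs0 \<in> exponent_lists T (length xs)"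
    using Cons.prems(4) by (auto simp: exponent_lists_def length_Suc_conv)
  then have "good a0" using Cons.prems(5) unfolding good_def by blast
  define j where "j = (LEAST a. good a)"
  have j: "good j" "j \<le> T" "\<And>a. a < j \<Longrightarrow> \<not> good a"
    unfolding j_def using LeastI[of good, OF \<open>good a0\<close>] Least_le[of good, OF \<open>good a0\<close>] a0(2) not_less_Least by auto
  have s0: "s a = 0" if "a < j" for a
    using j(3)[OF that] unfolding s_def good_def multi_eval_eq_sum by (intro sum.neutral) auto
  obtain bs where bs: "bs \<in> exponent_lists T (length xs)" "c (j # bs) \<noteq> 0" using j(1) unfolding good_def by blast
  have sj: "s j \<notin> P 1"
  proof -
    have "multi_eval T xs (\<lambda>as. c (j # as)) \<notin> (\<lambda>i. P (Suc i)) 0"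
    proof (rule Cons.IH)
      show "prime_in ?S (P (Suc i))" if "i \<le> length xs" for i using Cons.prems(1)[of "Suc i"] that by simp
      show "P (Suc i) \<subseteq> P (Suc (Suc i))" if "i < length xs" for i using Cons.prems(2)[of "Suc i"] that by simp
      show "xs ! i \<in> P (Suc (Suc i)) - P (Suc i)" if "i < length xs" for i
        using Cons.prems(3)[of "Suc i"] that by simp
    qed (use bs in auto)
    then show ?thesis by (simp add: s_def)
  qed
  define r where "r = (\<Sum>a\<in>{Suc j..T}. x ^ (a - j) * s a)"
  have "{..T} = {..<j} \<union> {j..T}" using j(2) by auto
  then have "multi_eval T (x # xs) c = (\<Sum>a\<in>{..<j}. x ^ a * s a) + (\<Sum>a\<in>{j..T}. x ^ a * s a)"
    by (simp add: s_def) (subst sum.union_disjoint, auto)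
  also have "(\<Sum>a\<in>{..<j}. x ^ a * s a) = 0" using s0 by simp
  also have "(\<Sum>a\<in>{j..T}. x ^ a * s a) = x ^ j * (\<Sum>a\<in>{j..T}. x ^ (a - j) * s a)"
    unfolding sum_distrib_left by (rule sum.cong) (simp_all flip: mult.assoc power_add)
  also have "(\<Sum>a\<in>{j..T}. x ^ (a - j) * s a) = s j + r"
    unfolding r_def using j(2) by (subst sum.atLeast_Suc_atMost) simp_all
  finally have eq: "multi_eval T (x # xs) c = x ^ j * (s j + r)" by simp
  have r1: "r \<in> P 1" unfolding r_def
  proof (rule sum_in_set)
    show "0 \<in> P 1" "\<And>p q. p \<in> P 1 \<Longrightarrow> q \<in> P 1 \<Longrightarrow> p + q \<in> P 1" using ideals(2) unfolding ideal_in_def by blast+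
    fix a assume a: "a \<in> {Suc j..T}"
    have "x ^ k \<in> ?S" for k using xS by (induction k) (auto intro: S)
    then have "x ^ (a - j - 1) \<in> ?S" .
    then have "(x ^ (a - j - 1) * s a) * x \<in> P 1"
      using x(1) ideals(2) S(5)[OF _ sS] unfolding ideal_in_def by blast
    moreover have "a - j = Suc (a - j - 1)" using a by auto
    then have "x ^ (a - j) = x ^ (a - j - 1) * x" using power_Suc2 by metis
    ultimately show "x ^ (a - j) * s a \<in> P 1" by (simp only: mult_ac)
  qed simp
  have rS: "s j + r \<in> ?S" using r1 ideals(2) sS S(3) unfolding ideal_in_def by blast
  show ?case
  proof
    assume "multi_eval T (x # xs) c \<in> P 0"
    then have "x ^ j * (s j + r) \<in> P 0" using eq by simp
    moreover have "x ^ j \<in> ?S" "x ^ j \<notin> P 0" using prime_in_power[OF primes(1) subring_polys xS x(2)] by auto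
    ultimately have "s j + r \<in> P 0" using primes(1) rS unfolding prime_in_def by blast
    then have "s j + r \<in> P 1" using Cons.prems(2)[of 0] by auto
    moreover have "- 1 * r \<in> P 1" using r1 ideals(2) S(6)[OF S(1)] unfolding ideal_in_def by blast
    ultimately have "(s j + r) + - 1 * r \<in> P 1" using ideals(2) unfolding ideal_in_def by blast
    then show False using sj by simp
  qed
qed

section \<open>Counting monomials of bounded degree\<close>

definition total_degree :: "'v set \<Rightarrow> ('v \<Rightarrow>\<^sub>0 nat) \<Rightarrow> nat" where
  "total_degree V e = (\<Sum>v\<in>V. Poly_Mapping.lookup e v)"

definition polys_upto :: "'v set \<Rightarrow> nat \<Rightarrow> ('v, 'k::comm_ring_1) mpoly set" where
  "polys_upto V n = monomial_span {e \<in> exponents V. total_degree V e \<le> n}"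

lemma polys_upto_mult: "p \<in> polys_upto V m \<Longrightarrow> q \<in> polys_upto V n \<Longrightarrow> p * q \<in> polys_upto V (m + n)"
  unfolding polys_upto_def
  by (rule monomial_span_mult[rotated]) (auto simp: total_degree_def lookup_add sum.distrib)

lemma polys_upto_one: "1 \<in> polys_upto V n"
  using single_in_monomial_span[of 0 "{e \<in> exponents V. total_degree V e \<le> n}" 1]
  by (simp add: polys_upto_def total_degree_def)

lemma polys_upto_power: "p \<in> polys_upto V n \<Longrightarrow> p ^ k \<in> polys_upto V (k * n)"
  by (induction k) (auto simp: polys_upto_one intro: polys_upto_mult)

lemma polys_upto_mono: "m \<le> n \<Longrightarrow> polys_upto V m \<subseteq> polys_upto V n"
  unfolding polys_upto_def by (rule monomial_span_mono) auto

lemma power_product_degree: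
  "set xs \<subseteq> polys_upto V d \<Longrightarrow> set as \<subseteq> {..T} \<Longrightarrow> power_product xs as \<in> polys_upto V (length xs * (T * d))"
proof (induction xs as rule: power_product.induct)
  case (1 x xs a as)
  have "x ^ a \<in> polys_upto V (a * d)" using 1 by (intro polys_upto_power) simp
  moreover have "a * d \<le> T * d" using 1 by simp
  ultimately have "x ^ a \<in> polys_upto V (T * d)" using polys_upto_mono by blast
  then show ?case using polys_upto_mult[of _ V "T * d"] 1 by simp
qed (simp_all add: polys_upto_one)

lemma finite_set_polys_upto:
  assumes "finite X" "X \<subseteq> polys V"
  shows "\<exists>d. X \<subseteq> polys_upto V d"
  using assms
proof (induction X)
  case (insert p X)
  then obtain d where d: "X \<subseteq> polys_upto V d" by auto
  define m where "m = Max (insert 0 (total_degree V ` Poly_Mapping.keys p))"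
  have "p \<in> polys_upto V m"
    using insert.prems by (auto simp: polys_upto_def monomial_span_def m_def)
  then have "insert p X \<subseteq> polys_upto V (max m d)"
    using d polys_upto_mono[of m "max m d" V] polys_upto_mono[of d "max m d" V] by auto
  then show ?case by blast
qed simp

text \<open>A crude bound for the Hilbert function of k[\<Delta>]: an exponent vector supported on
  \<sigma> is determined by its at most s values there, each at most n. What matters is only that
  the growth in n is of order s.\<close>

lemma card_bounded_exponents:
  fixes n :: nat
  assumes "finite V" "\<Delta> \<subseteq> Pow V" "\<And>\<sigma>. \<sigma> \<in> \<Delta> \<Longrightarrow> card \<sigma> \<le> s"
  defines "B \<equiv> {e. Poly_Mapping.keys e \<in> \<Delta> \<and> total_degree V e \<le> n}"
  shows "finite B \<and> card B \<le> card \<Delta> * (n + 1) ^ s"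
proof -
  define C where "C \<sigma> = {e. Poly_Mapping.keys e = \<sigma> \<and> total_degree V e \<le> n}" for \<sigma>
  have C: "finite (C \<sigma>) \<and> card (C \<sigma>) \<le> (n + 1) ^ s" if \<sigma>: "\<sigma> \<in> \<Delta>" for \<sigma>
  proof -
    have fin: "finite \<sigma>" using \<sigma> assms(1,2) by (meson PowD finite_subset subsetD)
    let ?h = "\<lambda>e. restrict (Poly_Mapping.lookup e) \<sigma>"
    have inj: "inj_on ?h (C \<sigma>)"
    proof (rule inj_onI, rule poly_mapping_eqI)
      fix e e' v assume e: "e \<in> C \<sigma>" "e' \<in> C \<sigma>" "?h e = ?h e'"
      show "Poly_Mapping.lookup e v = Poly_Mapping.lookup e' v"
      proof (cases "v \<in> \<sigma>")
        case True
        then show ?thesis using fun_cong[OF e(3), of v] by simp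
      next
        case False
        then show ?thesis using e(1,2) by (auto simp: C_def in_keys_iff)
      qed
    qed
    have "Poly_Mapping.lookup e v \<le> n" if "e \<in> C \<sigma>" "v \<in> \<sigma>" for e v
    proof -
      have "Poly_Mapping.lookup e v \<le> total_degree V e"
        unfolding total_degree_def by (rule member_le_sum) (use that \<sigma> assms(1,2) in auto)
      then show ?thesis using that by (simp add: C_def)
    qed
    then have sub: "?h ` C \<sigma> \<subseteq> (\<Pi>\<^sub>E v\<in>\<sigma>. {..n})" by auto
    have finP: "finite (\<Pi>\<^sub>E v\<in>\<sigma>. {..n})" using fin by (intro finite_PiE) auto
    have "card (C \<sigma>) \<le> card (\<Pi>\<^sub>E v\<in>\<sigma>. {..n})" using card_inj_on_le[OF inj sub finP] .
    also have "\<dots> = (n + 1) ^ card \<sigma>" using fin by (simp add: card_PiE)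
    also have "\<dots> \<le> (n + 1) ^ s" using assms(3)[OF \<sigma>] by (intro power_increasing) auto
    finally show ?thesis using inj_on_finite[OF inj sub finP] by blast
  qed
  have fin\<Delta>: "finite \<Delta>" using assms(1,2) finite_subset by blast
  have B: "B = (\<Union>\<sigma>\<in>\<Delta>. C \<sigma>)" by (auto simp: B_def C_def)
  have "card B \<le> (\<Sum>\<sigma>\<in>\<Delta>. card (C \<sigma>))" unfolding B by (rule card_UN_le[OF fin\<Delta>])
  also have "\<dots> \<le> (\<Sum>\<sigma>\<in>\<Delta>. (n + 1) ^ s)" using C by (intro sum_mono) auto
  also have "\<dots> = card \<Delta> * (n + 1) ^ s" by simp
  finally show ?thesis using C fin\<Delta> unfolding B by auto
qed

text \<open>Pick x_i in P (i+1) outside P i. If l > s, the products of powers of the l elements x_i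
  outnumber the monomials available modulo the Stanley--Reisner ideal, so a nontrivial polynomial
  expression in the x_i falls into that ideal and hence into P 0. This contradicts
  \<open>multi_eval_notin_prime\<close>.\<close>

theorem prime_chain_length_le:
  fixes P :: "nat \<Rightarrow> ('v, 'k::field) mpoly set"
  assumes V: "finite V" "\<Delta> \<subseteq> Pow V" and s: "\<And>\<sigma>. \<sigma> \<in> \<Delta> \<Longrightarrow> card \<sigma> \<le> s"
    and P: "\<And>i. i \<le> l \<Longrightarrow> prime_in (polys V) (P i)" "\<And>i. i < l \<Longrightarrow> P i \<subset> P (Suc i)"
    and P0: "monomial_span {e \<in> exponents V. Poly_Mapping.keys e \<notin> \<Delta>} \<subseteq> P 0"
  shows "l \<le> s"
proof (rule ccontr)
  assume "\<not> l \<le> s"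
  have "\<forall>i\<in>{..<l}. \<exists>x. x \<in> P (Suc i) - P i" using P(2) by blast
  then obtain x where x: "\<And>i. i < l \<Longrightarrow> x i \<in> P (Suc i) - P i" by (metis lessThan_iff)
  define xs where "xs = map x [0..<l]"
  have len: "length xs = l" and nth: "\<And>i. i < l \<Longrightarrow> xs ! i = x i" by (simp_all add: xs_def)
  have "x i \<in> polys V" if "i < l" for i
    using x[OF that] P(1)[of "Suc i"] that unfolding prime_in_def ideal_in_def by auto
  then have "set xs \<subseteq> polys V" by (auto simp: xs_def)
  then obtain d where d: "set xs \<subseteq> polys_upto V d" using finite_set_polys_upto[of "set xs" V] by blast
  \<comment> \<open>Products with exponents at most T have degree at most n = l T d, and n + 1 \<le>
    (l d + 1)(T + 1). With this T the number of monomials is at most T (T + 1)^s, which is below (T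
    + 1)^(s+1) and hence below the number (T + 1)^l of products.\<close>
  define T where "T = card \<Delta> * (l * d + 1) ^ s"
  define n where "n = l * (T * d)"
  define B where "B = {e. Poly_Mapping.keys e \<in> \<Delta> \<and> total_degree V e \<le> n}"
  have B: "finite B" "card B \<le> card \<Delta> * (n + 1) ^ s"
    unfolding B_def using card_bounded_exponents[OF V s, of n] by blast+
  have "card \<Delta> * (n + 1) ^ s \<le> card \<Delta> * ((l * d + 1) * (T + 1)) ^ s"
    by (intro mult_le_mono power_mono) (auto simp: n_def algebra_simps)
  also have "\<dots> = T * (T + 1) ^ s" by (simp only: T_def power_mult_distrib mult.assoc)
  also have "\<dots> < (T + 1) * (T + 1) ^ s" by simp
  also have "\<dots> = (T + 1) ^ Suc s" by simp
  also have "\<dots> \<le> (T + 1) ^ l" using \<open>\<not> l \<le> s\<close> by (intro power_increasing) auto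
  finally have "card B < card (exponent_lists T l)" using B by (simp add: card_exponent_lists)
  then obtain y where y: "\<exists>as\<in>exponent_lists T l. y as \<noteq> 0"
    "\<And>e. e \<in> B \<Longrightarrow> (\<Sum>as\<in>exponent_lists T l. y as * Poly_Mapping.lookup (power_product xs as) e) = 0"
    using underdetermined_system[OF B(1) finite_exponent_lists, of T l "\<lambda>as e. Poly_Mapping.lookup (power_product xs as) e"]
    by blast
  define p where "p = multi_eval T xs y"
  have "Poly_Mapping.lookup p e = (\<Sum>as\<in>exponent_lists T l. y as * Poly_Mapping.lookup (power_product xs as) e)" for e
  proof -
    have "Poly_Mapping.lookup (Poly_Mapping.single 0 c * q) e = c * Poly_Mapping.lookup q e" for c :: 'k and q
      using lookup_monomial_mult[of 0 c q e] by simp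
    then show ?thesis by (simp add: p_def multi_eval_eq_sum len lookup_sum)
  qed
  then have pB: "e \<notin> Poly_Mapping.keys p" if "e \<in> B" for e using y(2)[OF that] by (simp add: in_keys_iff)
  have "p \<in> polys_upto V n" unfolding p_def multi_eval_eq_sum
  proof (rule sum_in_set[OF finite_exponent_lists])
    show "0 \<in> polys_upto V n" by (simp add: polys_upto_def)
    show "a + b \<in> polys_upto V n" if "a \<in> polys_upto V n" "b \<in> polys_upto V n" for a b :: "('v, 'k) mpoly"
      using that unfolding polys_upto_def by (rule monomial_span_add)
    fix as assume "as \<in> exponent_lists T (length xs)"
    then have pp: "power_product xs as \<in> polys_upto V n"
      using power_product_degree[OF d, of as T] by (simp add: n_def len exponent_lists_def)
    have "Poly_Mapping.single 0 (y as) \<in> polys_upto V 0" by (simp add: polys_upto_def total_degree_def)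
    from polys_upto_mult[OF this pp]
    show "Poly_Mapping.single 0 (y as) * power_product xs as \<in> polys_upto V n" by simp
  qed
  then have "p \<in> monomial_span {e \<in> exponents V. Poly_Mapping.keys e \<notin> \<Delta>}"
    using pB by (auto simp: polys_upto_def monomial_span_def B_def)
  then have "p \<in> P 0" using P0 by blast
  moreover obtain as where "as \<in> exponent_lists T l" "y as \<noteq> 0" using y(1) by blast
  then have "p \<notin> P 0" unfolding p_def
    by (intro multi_eval_notin_prime[where V = V and as = as]) (use P x nth len in auto)
  ultimately show False by blast
qed

section \<open>The polynomial ring as a ring structure\<close>

lemma poly_ring_simps [simp]:
  "carrier (poly_ring V) = polys V" "mult (poly_ring V) = (*)" "one (poly_ring V) = 1"
  "zero (poly_ring V) = 0" "add (poly_ring V) = (+)"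
  by (auto simp: poly_ring_def monomial_span_def exponents_def)

lemma cring_poly_ring: "cring (poly_ring V)"
proof (rule cringI)
  show "abelian_group (poly_ring V)"
    by (rule abelian_groupI) (auto simp: add.assoc add.commute intro: bexI[of _ "- x" for x])
  show "comm_monoid (poly_ring V)"
    by (rule comm_monoidI) (auto simp: mult.assoc mult.commute)
qed (auto simp: distrib_right)

lemma ring_poly_ring: "ring (poly_ring V)"
  using cring_poly_ring by (rule cring.axioms(1))

lemma poly_ring_a_inv: "x \<in> polys V \<Longrightarrow> a_inv (poly_ring V) x = - x"
  using cring.cring_simprules(9)[OF cring_poly_ring, of x V] cring.cring_simprules(3)[OF cring_poly_ring, of x V]
  by (simp add: eq_neg_iff_add_eq_0)

lemma ideal_poly_ring: "ideal I (poly_ring V) \<longleftrightarrow> ideal_in (polys V) I"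
proof
  assume "ideal I (poly_ring V)"
  then interpret ideal I "poly_ring V" .
  show "ideal_in (polys V) I"
    using a_subset additive_subgroup.zero_closed[OF is_additive_subgroup]
      additive_subgroup.a_closed[OF is_additive_subgroup] I_l_closed by (auto simp: ideal_in_def)
next
  assume I: "ideal_in (polys V) I"
  show "ideal I (poly_ring V)"
  proof (rule idealI[OF ring_poly_ring])
    show "subgroup I (add_monoid (poly_ring V))"
    proof (rule subgroup.intro)
      show "inv\<^bsub>add_monoid (poly_ring V)\<^esub> x \<in> I" if "x \<in> I" for x
        using poly_ring_a_inv[of x V] polys.idealD(6,7)[OF I that] by (simp add: a_inv_def)
    qed (use polys.idealD[OF I] in auto)
  qed (use polys.idealD(4,5)[OF I] in auto)
qed

lemma primeideal_poly_ring: "primeideal P (poly_ring V) \<longleftrightarrow> prime_in (polys V) P"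
proof
  assume "primeideal P (poly_ring V)"
  then interpret primeideal P "poly_ring V" .
  have "1 \<notin> P" using one_imp_carrier I_notcarr by auto
  then show "prime_in (polys V) P"
    using I_prime ideal_poly_ring[of P V] is_ideal by (auto simp: prime_in_def)
next
  assume P: "prime_in (polys V) P"
  show "primeideal P (poly_ring V)"
    by (rule primeidealI) (use P ideal_poly_ring cring_poly_ring in \<open>auto simp: prime_in_def\<close>)
qed

section \<open>Stanley--Reisner ideals and the irrelevant ideal as spans of monomials\<close>

definition indicator_exp :: "'v set \<Rightarrow> ('v \<Rightarrow>\<^sub>0 nat)" where
  "indicator_exp \<sigma> = (\<Sum>v\<in>\<sigma>. Poly_Mapping.single v 1)"

lemma lookup_indicator_exp:
  "finite \<sigma> \<Longrightarrow> Poly_Mapping.lookup (indicator_exp \<sigma>) w = (if w \<in> \<sigma> then 1 else 0)"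
  unfolding indicator_exp_def by (simp add: lookup_sum lookup_single when_def)

lemma keys_indicator_exp [simp]: "finite \<sigma> \<Longrightarrow> Poly_Mapping.keys (indicator_exp \<sigma>) = \<sigma>"
  by (auto simp: in_keys_iff lookup_indicator_exp split: if_splits)

lemma indicator_exp_divides:
  assumes "finite \<sigma>" "\<sigma> \<subseteq> Poly_Mapping.keys e"
  shows "e = (e - indicator_exp \<sigma>) + indicator_exp \<sigma>"
proof (rule poly_mapping_eqI)
  fix v
  have "v \<in> \<sigma> \<Longrightarrow> 1 \<le> Poly_Mapping.lookup e v" using assms(2) by (auto simp: in_keys_iff Suc_le_eq)
  then show "Poly_Mapping.lookup e v = Poly_Mapping.lookup (e - indicator_exp \<sigma> + indicator_exp \<sigma>) v"
    using assms(1) by (simp add: lookup_add lookup_minus lookup_indicator_exp)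
qed

lemma prod_variables:
  "(\<Prod>v\<in>\<sigma>. variable v) = (Poly_Mapping.single (indicator_exp \<sigma>) 1 :: ('v, 'k::comm_ring_1) mpoly)"
  unfolding indicator_exp_def by (induction \<sigma> rule: infinite_finite_induct) (auto simp: variable_def mult_single)

text \<open>Exponents of the monomials that vanish in k[\<Delta>]. Over a larger vertex set V these
  include all monomials in a variable outside \<Delta>.\<close>

definition face_exps :: "'v set \<Rightarrow> 'v set set \<Rightarrow> ('v \<Rightarrow>\<^sub>0 nat) set" where
  "face_exps V \<Delta> = {e \<in> exponents V. Poly_Mapping.keys e \<notin> \<Delta>}"

lemma monomial_ideal_face_exps:
  assumes "\<And>\<sigma> \<tau>. \<sigma> \<in> \<Delta> \<Longrightarrow> \<tau> \<subseteq> \<sigma> \<Longrightarrow> \<tau> \<in> \<Delta>"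
  shows "monomial_ideal_exps V (face_exps V \<Delta>)"
  using assms by (auto simp: monomial_ideal_exps_def face_exps_def keys_plus_nat)

lemma genideal_monomials:
  assumes U: "monomial_ideal_exps V U" and E: "E \<subseteq> U" "\<And>e. e \<in> U \<Longrightarrow> \<exists>a. \<exists>g\<in>E. e = a + g"
  shows "Idl\<^bsub>poly_ring V\<^esub> ((\<lambda>g. Poly_Mapping.single g 1) ` E) = (monomial_span U :: ('v, 'k::comm_ring_1) mpoly set)"
    (is "Idl\<^bsub>_\<^esub> ?G = _")
proof
  interpret ring "poly_ring V :: ('v, 'k) mpoly ring" by (rule ring_poly_ring)
  have iU: "ideal_in (polys V) (monomial_span U :: ('v, 'k) mpoly set)" using U by (rule ideal_monomial_span)
  have G: "?G \<subseteq> monomial_span U" using E(1) by auto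
  show "Idl\<^bsub>poly_ring V\<^esub> ?G \<subseteq> monomial_span U"
    using genideal_minimal[of "monomial_span U" ?G] iU G by (simp add: ideal_poly_ring)
  have carr: "?G \<subseteq> carrier (poly_ring V)" using G polys.idealD(1)[OF iU] by simp
  have iG: "ideal_in (polys V) (Idl\<^bsub>poly_ring V\<^esub> ?G)"
    using genideal_ideal[OF carr] by (simp add: ideal_poly_ring)
  show "monomial_span U \<subseteq> Idl\<^bsub>poly_ring V\<^esub> ?G"
  proof (rule monomial_span_subset)
    fix e and c :: 'k assume e: "e \<in> U"
    then obtain a g where ag: "g \<in> E" "e = a + g" using E(2) by blast
    have "Poly_Mapping.single g 1 \<in> Idl\<^bsub>poly_ring V\<^esub> ?G" using genideal_self[OF carr] ag(1) by blast
    moreover have "a + g \<in> exponents V" using e ag(2) U by (auto simp: monomial_ideal_exps_def)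
    then have "Poly_Mapping.single a c \<in> polys V" by simp
    ultimately have "Poly_Mapping.single a c * Poly_Mapping.single g 1 \<in> Idl\<^bsub>poly_ring V\<^esub> ?G"
      using polys.idealD(4)[OF iG] by blast
    then show "Poly_Mapping.single e c \<in> Idl\<^bsub>poly_ring V\<^esub> ?G" by (simp add: ag(2) mult_single)
  qed (use polys.idealD[OF iG] in auto)
qed

text \<open>A monomial whose support is not a face is a multiple of the squarefree monomial of its
  support, and that one is a generator. Closure of \<Delta> under subsets makes the span of these
  monomials an ideal.\<close>

lemma sr_ideal_eq:
  assumes "finite V" "\<And>\<sigma> \<tau>. \<sigma> \<in> \<Delta> \<Longrightarrow> \<tau> \<subseteq> \<sigma> \<Longrightarrow> \<tau> \<in> \<Delta>"
  shows "sr_ideal V \<Delta> = (monomial_span (face_exps V \<Delta>) :: ('v, 'k::comm_ring_1) mpoly set)"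
proof -
  let ?E = "indicator_exp ` {\<sigma>. \<sigma> \<subseteq> V \<and> \<sigma> \<notin> \<Delta>}"
  have fin: "finite \<sigma>" if "\<sigma> \<subseteq> V" for \<sigma> using that assms(1) finite_subset by blast
  have "{\<Prod>v\<in>\<sigma>. variable v | \<sigma>. \<sigma> \<subseteq> V \<and> \<sigma> \<notin> \<Delta>} = (\<lambda>g. Poly_Mapping.single g (1::'k)) ` ?E"
    unfolding prod_variables by blast
  moreover have "Idl\<^bsub>poly_ring V\<^esub> ((\<lambda>g. Poly_Mapping.single g (1::'k)) ` ?E) = monomial_span (face_exps V \<Delta>)"
  proof (rule genideal_monomials[OF monomial_ideal_face_exps[OF assms(2)]])
    show "?E \<subseteq> face_exps V \<Delta>" using fin by (auto simp: face_exps_def exponents_def)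
    fix e assume "e \<in> face_exps V \<Delta>"
    then have "indicator_exp (Poly_Mapping.keys e) \<in> ?E" by (auto simp: face_exps_def exponents_def)
    then show "\<exists>a. \<exists>g\<in>?E. e = a + g" using indicator_exp_divides[OF finite_keys order_refl] by metis
  qed
  ultimately show ?thesis unfolding sr_ideal_def by simp
qed

lemma irrelevant_ideal_eq:
  "irrelevant_ideal V = (monomial_span (exponents V - {0}) :: ('v, 'k::comm_ring_1) mpoly set)"
proof -
  let ?E = "(\<lambda>v. Poly_Mapping.single v (1::nat)) ` V"
  have "Poly_Mapping.single v (1::nat) \<noteq> 0" for v :: 'v
    by (metis keys_single keys_zero one_neq_zero insert_not_empty)
  then have sub: "?E \<subseteq> exponents V - {0}" by auto
  have "Idl\<^bsub>poly_ring V\<^esub> ((\<lambda>g. Poly_Mapping.single g (1::'k)) ` ?E) = monomial_span (exponents V - {0})"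
  proof (rule genideal_monomials[OF monomial_ideal_irrelevant sub])
    fix e assume e: "e \<in> exponents V - {0}"
    then obtain v where v: "v \<in> Poly_Mapping.keys e" by fastforce
    then have "e = (e - Poly_Mapping.single v 1) + Poly_Mapping.single v 1"
      using indicator_exp_divides[of "{v}" e] by (simp add: indicator_exp_def)
    moreover have "v \<in> V" using e v by (auto simp: exponents_def)
    ultimately show "\<exists>a. \<exists>g\<in>?E. e = a + g" by blast
  qed
  then show ?thesis unfolding irrelevant_ideal_def variable_def image_image .
qed

section \<open>Cosets and the correspondence between primes of a quotient and primes above the
  ideal\<close>

abbreviation poly_coset :: "'v set \<Rightarrow> ('v, 'k::comm_ring_1) mpoly set \<Rightarrow> ('v, 'k) mpoly \<Rightarrow> ('v, 'k) mpoly set" where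
  "poly_coset V I x \<equiv> I +>\<^bsub>poly_ring V\<^esub> x"

lemma poly_coset_eq: "poly_coset V I x = (\<lambda>i. i + x) ` I"
  by (auto simp: a_r_coset_def r_coset_def)

context
  fixes V :: "'v set" and I :: "('v, 'k::comm_ring_1) mpoly set"
  assumes I: "ideal_in (polys V) I"
begin

lemmas I_closed = polys.idealD[OF I]

lemma poly_coset_eq_iff: "poly_coset V I x = poly_coset V I y \<longleftrightarrow> x - y \<in> I"
proof
  assume "poly_coset V I x = poly_coset V I y"
  moreover have "0 + x \<in> poly_coset V I x" unfolding poly_coset_eq using I_closed(2) by blast
  ultimately obtain i where "i \<in> I" "x = i + y" unfolding poly_coset_eq by auto
  then show "x - y \<in> I" by simp
next
  have *: "poly_coset V I a \<subseteq> poly_coset V I b" if "a - b \<in> I" for a b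
    unfolding poly_coset_eq
  proof (intro image_subsetI image_eqI)
    fix i assume "i \<in> I"
    then show "i + (a - b) \<in> I" using that I_closed(3) by blast
  qed simp
  assume "x - y \<in> I"
  moreover from this have "- (x - y) \<in> I" by (rule I_closed(7))
  ultimately show "poly_coset V I x = poly_coset V I y" using *[of x y] *[of y x] by simp
qed

lemma poly_coset_zero: "poly_coset V I 0 = I"
  by (simp add: poly_coset_eq)

lemma poly_coset_eq_self: "poly_coset V I x = I \<longleftrightarrow> x \<in> I"
  using poly_coset_eq_iff[of x 0] poly_coset_zero by simp

lemma poly_coset_mult:
  "x \<in> polys V \<Longrightarrow> y \<in> polys V \<Longrightarrow>
    rcoset_mult (poly_ring V) I (poly_coset V I x) (poly_coset V I y) = poly_coset V I (x * y)"
  using ideal.rcoset_mult_add[of I "poly_ring V" x y] I by (simp add: ideal_poly_ring)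

lemma poly_coset_add:
  "set_add (poly_ring V) (poly_coset V I x) (poly_coset V I y) = poly_coset V I (x + y)"
proof -
  have sum: "set_add (poly_ring V) A B = (\<Union>a\<in>A. \<Union>b\<in>B. {a + b})" for A B :: "('v, 'k) mpoly set"
    by (auto simp: set_add_def set_mult_def)
  show ?thesis unfolding poly_coset_eq
  proof (intro equalityI subsetI)
    fix z assume "z \<in> (\<lambda>i. i + (x + y)) ` I"
    then obtain i where "i \<in> I" "z = (i + x) + (0 + y)" by (auto simp: add_ac)
    then show "z \<in> set_add (poly_ring V) ((\<lambda>i. i + x) ` I) ((\<lambda>i. i + y) ` I)"
      using I_closed(2) \<open>i \<in> I\<close> unfolding sum by blast
  next
    fix z assume "z \<in> set_add (poly_ring V) ((\<lambda>i. i + x) ` I) ((\<lambda>i. i + y) ` I)"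
    then obtain i j where ij: "i \<in> I" "j \<in> I" "z = (i + x) + (j + y)"
      unfolding sum by auto
    then have "z = (i + j) + (x + y)" "i + j \<in> I" using I_closed(3) by (auto simp: add_ac)
    then show "z \<in> (\<lambda>i. i + (x + y)) ` I" by blast
  qed
qed

lemma carrier_quot: "carrier (poly_ring V Quot I) = poly_coset V I ` polys V"
  by (auto simp: FactRing_def A_RCOSETS_def RCOSETS_def a_r_coset_def)

lemma krull_dim_quot_ge:
  assumes "\<And>i. i \<le> l \<Longrightarrow> prime_in (polys V) (P i)" "\<And>i. i < l \<Longrightarrow> P i \<subset> P (Suc i)" "I \<subseteq> P 0"
  shows "enat l \<le> krull_dim (poly_ring V Quot I)"
proof -
  have IP: "I \<subseteq> P i" if "i \<le> l" for i using that
  proof (induction i)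
    case (Suc i)
    then show ?case using assms(2)[of i] by auto
  qed (use assms in auto)
  define Q where "Q i = poly_coset V I ` P i" for i
  have mem: "poly_coset V I x \<in> Q i \<longleftrightarrow> x \<in> P i" if i: "i \<le> l" for x i
  proof
    have iP: "ideal_in (polys V) (P i)" using assms(1)[OF i] by (simp add: prime_in_def)
    assume "poly_coset V I x \<in> Q i"
    then obtain p where p: "p \<in> P i" "x - p \<in> I" unfolding Q_def using poly_coset_eq_iff by blast
    then have "(x - p) + p \<in> P i" using IP[OF i] polys.idealD(3)[OF iP] by blast
    then show "x \<in> P i" by simp
  qed (auto simp: Q_def)
  have cring: "cring (poly_ring V Quot I)"
    using ideal.quotient_is_cring[OF _ cring_poly_ring, of I V] I by (simp add: ideal_poly_ring)
  have prime: "primeideal (Q i) (poly_ring V Quot I)" if i: "i \<le> l" for i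
  proof (rule primeidealI[OF _ cring])
    have P: "prime_in (polys V) (P i)" using assms(1)[OF i] .
    then have iP: "ideal_in (polys V) (P i)" by (simp add: prime_in_def)
    have "ideal (P i) (poly_ring V)" "ideal I (poly_ring V)" using iP I by (simp_all add: ideal_poly_ring)
    then have "ideal ((+>\<^bsub>poly_ring V\<^esub>) I ` P i) (poly_ring V Quot I)"
      using ring.ring_ideal_imp_quot_ideal[OF ring_poly_ring] by blast
    then show "ideal (Q i) (poly_ring V Quot I)" unfolding Q_def .
    have "poly_coset V I 1 \<notin> Q i" using P by (simp add: mem[OF i] prime_in_def)
    moreover have "poly_coset V I 1 \<in> carrier (poly_ring V Quot I)" by (simp add: carrier_quot)
    ultimately show "carrier (poly_ring V Quot I) \<noteq> Q i" by blast
    fix A B assume A: "A \<in> carrier (poly_ring V Quot I)" and B: "B \<in> carrier (poly_ring V Quot I)"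
      and AB: "A \<otimes>\<^bsub>poly_ring V Quot I\<^esub> B \<in> Q i"
    then obtain a b where ab: "a \<in> polys V" "b \<in> polys V" "A = poly_coset V I a" "B = poly_coset V I b"
      by (auto simp: carrier_quot)
    have "A \<otimes>\<^bsub>poly_ring V Quot I\<^esub> B = poly_coset V I (a * b)"
      using ab by (simp add: FactRing_def poly_coset_mult)
    then have "a * b \<in> P i" using AB mem[OF i] by simp
    then have "a \<in> P i \<or> b \<in> P i" using P ab unfolding prime_in_def by blast
    then show "A \<in> Q i \<or> B \<in> Q i" using ab mem[OF i] by simp
  qed
  have "Q i \<subset> Q (Suc i)" if i: "i < l" for i
  proof -
    obtain p where p: "p \<in> P (Suc i)" "p \<notin> P i" using assms(2)[OF i] by blast
    then have "poly_coset V I p \<in> Q (Suc i)" "poly_coset V I p \<notin> Q i" using mem i by auto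
    moreover have "Q i \<subseteq> Q (Suc i)" unfolding Q_def using assms(2)[OF i] by blast
    ultimately show ?thesis by blast
  qed
  then show ?thesis unfolding krull_dim_def using prime by (intro Sup_upper) auto
qed

lemma krull_dim_quot_le:
  assumes "\<And>P l. (\<And>i. i \<le> l \<Longrightarrow> prime_in (polys V) (P i)) \<Longrightarrow> (\<And>i. i < l \<Longrightarrow> P i \<subset> P (Suc i)) \<Longrightarrow> I \<subseteq> P 0 \<Longrightarrow> l \<le> s"
  shows "krull_dim (poly_ring V Quot I) \<le> enat s"
  unfolding krull_dim_def
proof (rule Sup_least)
  fix x assume "x \<in> {enat l |l. \<exists>P. (\<forall>i\<le>l. primeideal (P i) (poly_ring V Quot I)) \<and> (\<forall>i<l. P i \<subset> P (Suc i))}"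
  then obtain l Q where Q: "x = enat l" "\<And>i. i \<le> l \<Longrightarrow> primeideal (Q i) (poly_ring V Quot I)" "\<And>i. i < l \<Longrightarrow> Q i \<subset> Q (Suc i)"
    by auto
  have hom: "ring_hom_ring (poly_ring V) (poly_ring V Quot I) ((+>\<^bsub>poly_ring V\<^esub>) I)"
    using ideal.rcos_ring_hom_ring[of I "poly_ring V"] I by (simp add: ideal_poly_ring)
  define P where "P i = {r \<in> polys V. poly_coset V I r \<in> Q i}" for i
  have sub: "Q i \<subseteq> poly_coset V I ` polys V" if "i \<le> l" for i
    using additive_subgroup.a_subset[OF ideal.axioms(1)[OF primeideal.axioms(1)[OF Q(2)[OF that]]]]
    by (simp add: carrier_quot)
  have "l \<le> s"
  proof (rule assms)
    show "prime_in (polys V) (P i)" if "i \<le> l" for i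
      using ring_hom_ring.primeideal_vimage[OF hom cring_poly_ring Q(2)[OF that]]
      by (simp add: P_def flip: primeideal_poly_ring)
    show "P i \<subset> P (Suc i)" if i: "i < l" for i
    proof -
      have "P i \<subseteq> P (Suc i)" using Q(3)[OF i] by (auto simp: P_def)
      moreover obtain A where A: "A \<in> Q (Suc i)" "A \<notin> Q i" using Q(3)[OF i] by blast
      then obtain a where "a \<in> polys V" "A = poly_coset V I a" using sub[of "Suc i"] i by auto
      then have "a \<in> P (Suc i)" "a \<notin> P i" using A by (auto simp: P_def)
      ultimately show ?thesis by blast
    qed
    have "I \<in> Q 0"
      using additive_subgroup.zero_closed[OF ideal.axioms(1)[OF primeideal.axioms(1)[OF Q(2)[of 0]]]]
      by (simp add: FactRing_def)
    then show "I \<subseteq> P 0" using I_closed(6) by (auto simp: P_def poly_coset_eq_self[THEN iffD2])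
  qed
  then show "x \<le> enat s" using Q by simp
qed

end

section \<open>Depth of quotient modules\<close>

abbreviation irrelevant :: "'v set \<Rightarrow> ('v, 'k::comm_ring_1) mpoly set" where
  "irrelevant V \<equiv> monomial_span (exponents V - {0})"

text \<open>A bridge between the recursion of \<open>depth_ge\<close> and the indexed form of
  \<open>regular_sequence\<close>. The fold computes I + (f_1, ..., f_i) J, and nonvanishing of the
  last quotient is still left out.\<close>

definition regular_list :: "'a::comm_ring_1 set \<Rightarrow> 'a set \<Rightarrow> 'a set \<Rightarrow> 'a list \<Rightarrow> bool" where
  "regular_list \<mm> J I fs \<longleftrightarrow> set fs \<subseteq> \<mm> \<and>
    (\<forall>i<length fs. nonzerodivisor (fs ! i) J (foldl (\<lambda>K f. add_multiples f J K) I (take i fs)))"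

lemma regular_list_Cons:
  "regular_list \<mm> J I (f # fs) \<longleftrightarrow> f \<in> \<mm> \<and> nonzerodivisor f J I \<and> regular_list \<mm> J (add_multiples f J I) fs"
  by (auto simp: regular_list_def All_less_Suc2)

lemma depth_ge_iff_list:
  "depth_ge \<mm> n J I \<longleftrightarrow> (\<exists>fs. length fs = n \<and> regular_list \<mm> J I fs)"
proof (induction n arbitrary: I)
  case (Suc n)
  have "(\<exists>fs. length fs = Suc n \<and> regular_list \<mm> J I fs) \<longleftrightarrow>
    (\<exists>f fs. length fs = n \<and> regular_list \<mm> J I (f # fs))"
    unfolding length_Suc_conv by blast
  then show ?case unfolding depth_ge.simps Suc.IH regular_list_Cons by blast
qed (auto simp: regular_list_def)

context
  fixes V :: "'v set" and I J :: "('v, 'k::comm_ring_1) mpoly set"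
  assumes I: "ideal_in (polys V) I" and J: "ideal_in (polys V) J" and IJ: "I \<subseteq> J"
begin

private abbreviation "M \<equiv> quotient_module (poly_ring V) J I"

lemma quotient_module_simps:
  "carrier M = poly_coset V I ` J" "zero M = I" "add M = set_add (poly_ring V)"
  "x \<in> polys V \<Longrightarrow> y \<in> J \<Longrightarrow> x \<odot>\<^bsub>M\<^esub> poly_coset V I y = poly_coset V I (x * y)"
  using polys.idealD(6)[OF J] by (auto simp: quotient_module_def poly_coset_mult[OF I])

lemma abelian_monoid_quotient: "abelian_monoid M"
proof -
  have z: "zero M = poly_coset V I 0" by (simp add: quotient_module_simps(2) poly_coset_zero[OF I])
  show ?thesis
    by (rule abelian_monoidI; unfold z quotient_module_simps(1,3); (elim imageE)?)
      (simp_all add: poly_coset_add[OF I] polys.idealD[OF J] add_ac)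
qed

lemma poly_coset_mem_image:
  assumes "ideal_in (polys V) K" "I \<subseteq> K"
  shows "poly_coset V I x \<in> poly_coset V I ` K \<longleftrightarrow> x \<in> K"
proof
  assume "poly_coset V I x \<in> poly_coset V I ` K"
  then obtain k where "k \<in> K" "x - k \<in> I" using poly_coset_eq_iff[OF I] by blast
  then have "(x - k) + k \<in> K" using assms polys.idealD(3) by blast
  then show "x \<in> K" by simp
qed auto

lemma ideal_foldl:
  assumes "set fs \<subseteq> polys V"
  shows "ideal_in (polys V) (foldl (\<lambda>K f. add_multiples f J K) I fs) \<and> I \<subseteq> foldl (\<lambda>K f. add_multiples f J K) I fs"
  using assms
proof (induction fs rule: rev_induct)
  case (snoc f fs)
  then have IH: "ideal_in (polys V) (foldl (\<lambda>K f. add_multiples f J K) I fs)"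
    "I \<subseteq> foldl (\<lambda>K f. add_multiples f J K) I fs" by auto
  show ?case
    using polys.ideal_add_multiples[OF _ J IH(1), of f] polys.add_multiples_upper[OF J] IH(2) snoc.prems by force
qed (use I in auto)

lemma ideal_mult_module_snoc:
  assumes fs: "set fs \<subseteq> polys V" "f \<in> polys V"
  shows "ideal_mult_module M (fs @ [f]) = {f \<odot>\<^bsub>M\<^esub> c \<oplus>\<^bsub>M\<^esub> a | a c. a \<in> ideal_mult_module M fs \<and> c \<in> carrier M}"
proof -
  interpret abelian_monoid M by (rule abelian_monoid_quotient)
  let ?n = "length fs"
  have smult: "g \<odot>\<^bsub>M\<^esub> c \<in> carrier M" if "g \<in> polys V" "c \<in> carrier M" for g c
    using that polys.idealD(4)[OF J] by (auto simp: quotient_module_simps)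
  have split: "finsum M (\<lambda>i. (fs @ [f]) ! i \<odot>\<^bsub>M\<^esub> m i) {..<length (fs @ [f])} =
    f \<odot>\<^bsub>M\<^esub> m ?n \<oplus>\<^bsub>M\<^esub> finsum M (\<lambda>i. fs ! i \<odot>\<^bsub>M\<^esub> m i) {..<?n}"
    if m: "m \<in> {..<?n} \<rightarrow> carrier M" "m ?n \<in> carrier M" for m
  proof -
    have cl: "fs ! i \<odot>\<^bsub>M\<^esub> m i \<in> carrier M" if "i < ?n" for i
      using smult m fs that nth_mem by blast
    have "finsum M (\<lambda>i. (fs @ [f]) ! i \<odot>\<^bsub>M\<^esub> m i) (insert ?n {..<?n}) =
      (fs @ [f]) ! ?n \<odot>\<^bsub>M\<^esub> m ?n \<oplus>\<^bsub>M\<^esub> finsum M (\<lambda>i. (fs @ [f]) ! i \<odot>\<^bsub>M\<^esub> m i) {..<?n}"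
      by (rule finsum_insert) (use cl smult m fs in \<open>auto simp: nth_append\<close>)
    also have "finsum M (\<lambda>i. (fs @ [f]) ! i \<odot>\<^bsub>M\<^esub> m i) {..<?n} = finsum M (\<lambda>i. fs ! i \<odot>\<^bsub>M\<^esub> m i) {..<?n}"
      by (rule finsum_cong') (use cl in \<open>auto simp: nth_append\<close>)
    finally show ?thesis by (simp add: lessThan_Suc)
  qed
  show ?thesis
  proof (intro equalityI subsetI)
    fix x assume "x \<in> ideal_mult_module M (fs @ [f])"
    then obtain m where m: "m \<in> {..<length (fs @ [f])} \<rightarrow> carrier M"
      "x = finsum M (\<lambda>i. (fs @ [f]) ! i \<odot>\<^bsub>M\<^esub> m i) {..<length (fs @ [f])}"
      unfolding ideal_mult_module_def by blast
    then have m': "m \<in> {..<?n} \<rightarrow> carrier M" "m ?n \<in> carrier M" by auto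
    then have "x = f \<odot>\<^bsub>M\<^esub> m ?n \<oplus>\<^bsub>M\<^esub> finsum M (\<lambda>i. fs ! i \<odot>\<^bsub>M\<^esub> m i) {..<?n}" using m(2) split by simp
    then show "x \<in> {f \<odot>\<^bsub>M\<^esub> c \<oplus>\<^bsub>M\<^esub> a | a c. a \<in> ideal_mult_module M fs \<and> c \<in> carrier M}"
      using m' unfolding ideal_mult_module_def by blast
  next
    fix x assume "x \<in> {f \<odot>\<^bsub>M\<^esub> c \<oplus>\<^bsub>M\<^esub> a | a c. a \<in> ideal_mult_module M fs \<and> c \<in> carrier M}"
    then obtain m c where m: "m \<in> {..<?n} \<rightarrow> carrier M" "c \<in> carrier M"
      "x = f \<odot>\<^bsub>M\<^esub> c \<oplus>\<^bsub>M\<^esub> finsum M (\<lambda>i. fs ! i \<odot>\<^bsub>M\<^esub> m i) {..<?n}"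
      unfolding ideal_mult_module_def by blast
    define m' where "m' = m(?n := c)"
    have "fs ! i \<odot>\<^bsub>M\<^esub> m i \<in> carrier M" if "i < ?n" for i
      using smult m fs that nth_mem by blast
    then have "finsum M (\<lambda>i. fs ! i \<odot>\<^bsub>M\<^esub> m' i) {..<?n} = finsum M (\<lambda>i. fs ! i \<odot>\<^bsub>M\<^esub> m i) {..<?n}"
      by (intro finsum_cong') (auto simp: m'_def)
    moreover have m'c: "m' \<in> {..<?n} \<rightarrow> carrier M" "m' ?n \<in> carrier M" using m by (auto simp: m'_def)
    ultimately have "x = finsum M (\<lambda>i. (fs @ [f]) ! i \<odot>\<^bsub>M\<^esub> m' i) {..<length (fs @ [f])}"
      using split[of m'] m(3) by (simp add: m'_def)
    moreover have "m' \<in> {..<length (fs @ [f])} \<rightarrow> carrier M" using m'c by (auto simp: less_Suc_eq)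
    ultimately show "x \<in> ideal_mult_module M (fs @ [f])" unfolding ideal_mult_module_def by blast
  qed
qed

text \<open>The induction appends at the end, because prefixes of the sequence and the left fold
  both grow there.\<close>

lemma ideal_mult_module_eq:
  assumes "set fs \<subseteq> polys V"
  shows "ideal_mult_module M fs = poly_coset V I ` foldl (\<lambda>K f. add_multiples f J K) I fs"
  using assms
proof (induction fs rule: rev_induct)
  case Nil
  interpret abelian_monoid M by (rule abelian_monoid_quotient)
  have "poly_coset V I ` I = {I}" using polys.idealD(2)[OF I] poly_coset_eq_self[OF I] by auto
  then show ?case by (auto simp: ideal_mult_module_def quotient_module_simps)
next
  case (snoc f fs)
  define K where "K = foldl (\<lambda>K f. add_multiples f J K) I fs"
  have f: "f \<in> polys V" and fs: "set fs \<subseteq> polys V" using snoc.prems by auto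
  have "{f \<odot>\<^bsub>M\<^esub> c \<oplus>\<^bsub>M\<^esub> a | a c. a \<in> poly_coset V I ` K \<and> c \<in> carrier M} =
    poly_coset V I ` add_multiples f J K"
  proof -
    have *: "f \<odot>\<^bsub>M\<^esub> poly_coset V I z \<oplus>\<^bsub>M\<^esub> poly_coset V I y = poly_coset V I (y + f * z)" if "z \<in> J" for y z
      using that f by (simp add: quotient_module_simps poly_coset_add[OF I] add.commute)
    show ?thesis
    proof (intro equalityI subsetI)
      fix x assume "x \<in> {f \<odot>\<^bsub>M\<^esub> c \<oplus>\<^bsub>M\<^esub> a | a c. a \<in> poly_coset V I ` K \<and> c \<in> carrier M}"
      then obtain y z where "y \<in> K" "z \<in> J" "x = f \<odot>\<^bsub>M\<^esub> poly_coset V I z \<oplus>\<^bsub>M\<^esub> poly_coset V I y"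
        by (auto simp: quotient_module_simps(1))
      then show "x \<in> poly_coset V I ` add_multiples f J K" using * polys.add_multiplesI by blast
    next
      fix x assume "x \<in> poly_coset V I ` add_multiples f J K"
      then obtain y z where "y \<in> K" "z \<in> J" "x = poly_coset V I (y + f * z)" by (auto elim: polys.add_multiplesE)
      then have "x = f \<odot>\<^bsub>M\<^esub> poly_coset V I z \<oplus>\<^bsub>M\<^esub> poly_coset V I y" using * by simp
      then show "x \<in> {f \<odot>\<^bsub>M\<^esub> c \<oplus>\<^bsub>M\<^esub> a | a c. a \<in> poly_coset V I ` K \<and> c \<in> carrier M}"
        using \<open>y \<in> K\<close> \<open>z \<in> J\<close> unfolding quotient_module_simps(1) by blast
    qed
  qed
  then show ?case
    unfolding ideal_mult_module_snoc[OF fs f] snoc.IH[OF fs] K_def by simp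
qed

lemma regular_sequence_iff:
  "regular_sequence (poly_ring V) M fs \<longleftrightarrow> set fs \<subseteq> polys V \<and>
     (\<forall>i<length fs. nonzerodivisor (fs ! i) J (foldl (\<lambda>K f. add_multiples f J K) I (take i fs))) \<and>
     \<not> J \<subseteq> foldl (\<lambda>K f. add_multiples f J K) I fs"
proof (cases "set fs \<subseteq> polys V")
  case True
  let ?K = "foldl (\<lambda>K f. add_multiples f J K) I"
  have ta: "set (take i fs) \<subseteq> polys V" for i using True set_take_subset[of i fs] by blast
  have "(\<forall>m\<in>carrier M. fs ! i \<odot>\<^bsub>M\<^esub> m \<in> ideal_mult_module M (take i fs) \<longrightarrow> m \<in> ideal_mult_module M (take i fs)) \<longleftrightarrow>
    nonzerodivisor (fs ! i) J (?K (take i fs))" if "i < length fs" for i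
  proof -
    have f: "fs ! i \<in> polys V" using True that nth_mem by blast
    show ?thesis
      unfolding ideal_mult_module_eq[OF ta] quotient_module_simps(1) nonzerodivisor_def ball_simps
      using quotient_module_simps(4)[OF f] poly_coset_mem_image[of "?K (take i fs)"] ideal_foldl[OF ta[of i]]
      by auto
  qed
  moreover have "ideal_mult_module M fs \<noteq> carrier M \<longleftrightarrow> \<not> J \<subseteq> ?K fs"
  proof -
    have "?K gs \<subseteq> J" if "set gs \<subseteq> polys V" for gs using that
    proof (induction gs rule: rev_induct)
      case (snoc g gs)
      then show ?case using polys.add_multiples_subset[of g V J "?K gs"] J by simp
    qed (use IJ in simp)
    then have KJ: "?K fs \<subseteq> J" using True .
    have "poly_coset V I ` ?K fs = poly_coset V I ` J \<longleftrightarrow> J \<subseteq> ?K fs"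
    proof
      assume eq: "poly_coset V I ` ?K fs = poly_coset V I ` J"
      show "J \<subseteq> ?K fs"
      proof
        fix x assume "x \<in> J"
        then have "poly_coset V I x \<in> poly_coset V I ` ?K fs" using eq by simp
        then show "x \<in> ?K fs" using poly_coset_mem_image ideal_foldl[OF True] by simp
      qed
    qed (use KJ in blast)
    then show ?thesis unfolding ideal_mult_module_eq[OF True] quotient_module_simps(1) by simp
  qed
  ultimately show ?thesis using True by (auto simp: regular_sequence_def)
qed (auto simp: regular_sequence_def)

lemma depth_ge_of_module_depth:
  assumes "enat n \<le> module_depth (poly_ring V) (irrelevant V) M"
  shows "depth_ge (irrelevant V) n J I"
\<comment> \<open>For n = 0 the claim is trivial, but a regular sequence need not exist: for the
  zero module the supremum is that of the empty set, which is 0. For n > 0 a supremum of at least n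
  is witnessed by a sequence of length at least n, of which a prefix is taken.\<close>
proof (cases n)
  case (Suc k)
  let ?L = "{enat (length fs) | fs. regular_sequence (poly_ring V) M fs \<and> set fs \<subseteq> irrelevant V}"
  have "\<exists>fs. regular_sequence (poly_ring V) M fs \<and> set fs \<subseteq> irrelevant V \<and> n \<le> length fs"
  proof (rule ccontr)
    assume "\<not> ?thesis"
    then have "length fs \<le> k" if "regular_sequence (poly_ring V) M fs" "set fs \<subseteq> irrelevant V" for fs
      using that Suc by (meson not_less_eq_eq)
    then have "Sup ?L \<le> enat k" by (intro Sup_least) auto
    then have "enat n \<le> enat k" using assms unfolding module_depth_def by (rule order_trans[rotated])
    then show False using Suc by simp
  qed
  then obtain fs where fs: "regular_sequence (poly_ring V) M fs" "set fs \<subseteq> irrelevant V" "n \<le> length fs" by blast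
  have "take i (take n fs) = take i fs" "take n fs ! i = fs ! i" if "i < n" for i using that by (auto simp: min_def)
  then show ?thesis
    unfolding depth_ge_iff_list regular_list_def using fs set_take_subset[of n fs]
    by (intro exI[of _ "take n fs"]) (auto simp: regular_sequence_iff)
qed simp

text \<open>K certifies that the last quotient is nonzero: it contains I and all products from \<mm>
  J, hence I + (f_1, ..., f_n) J for every sequence in \<mm>, but not all of J.\<close>

lemma module_depth_ge:
  assumes "depth_ge (irrelevant V) n J I" "\<not> J \<subseteq> K" "I \<subseteq> K"
    "\<And>x y. x \<in> K \<Longrightarrow> y \<in> K \<Longrightarrow> x + y \<in> K" "\<And>f z. f \<in> irrelevant V \<Longrightarrow> z \<in> J \<Longrightarrow> f * z \<in> K"
  shows "enat n \<le> module_depth (poly_ring V) (irrelevant V) M"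
proof -
  obtain fs where fs: "length fs = n" "set fs \<subseteq> irrelevant V"
    "\<forall>i<n. nonzerodivisor (fs ! i) J (foldl (\<lambda>K f. add_multiples f J K) I (take i fs))"
    using assms(1) unfolding depth_ge_iff_list regular_list_def by blast
  have "foldl (\<lambda>K f. add_multiples f J K) I gs \<subseteq> K" if "set gs \<subseteq> irrelevant V" for gs
    using that
  proof (induction gs rule: rev_induct)
    case (snoc g gs)
    have "y + g * z \<in> K" if "y \<in> foldl (\<lambda>K f. add_multiples f J K) I gs" "z \<in> J" for y z
      using that snoc assms(4)[of y "g * z"] assms(5)[of g z] by auto
    then show ?case by (auto simp: add_multiples_def)
  qed (use assms in simp)
  then have "\<not> J \<subseteq> foldl (\<lambda>K f. add_multiples f J K) I fs" using fs assms(2) by blast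
  moreover have "irrelevant V \<subseteq> (polys V :: ('v, 'k) mpoly set)" by (rule monomial_span_mono) auto
  ultimately have "regular_sequence (poly_ring V) M fs" unfolding regular_sequence_iff using fs by auto
  then show ?thesis unfolding module_depth_def using fs by (intro Sup_upper) auto
qed

lemma module_depth_le:
  assumes "\<And>n. depth_ge (irrelevant V) n J I \<Longrightarrow> enat n \<le> X"
  shows "module_depth (poly_ring V) (irrelevant V) M \<le> X"
  unfolding module_depth_def
proof (rule Sup_least)
  fix x assume "x \<in> {enat (length fs) | fs. regular_sequence (poly_ring V) M fs \<and> set fs \<subseteq> irrelevant V}"
  then obtain fs where fs: "x = enat (length fs)" "regular_sequence (poly_ring V) M fs" "set fs \<subseteq> irrelevant V" by blast
  then have "depth_ge (irrelevant V) (length fs) J I"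
    unfolding depth_ge_iff_list regular_list_def regular_sequence_iff by blast
  then show "x \<le> X" using assms fs by simp
qed

lemma annihilator_quotient_module:
  "annihilator (poly_ring V) M = {r \<in> polys V. \<forall>z\<in>J. r * z \<in> I}"
  unfolding annihilator_def quotient_module_simps(1,2) poly_ring_simps(1)
  by (intro Collect_cong conj_cong refl) (simp add: quotient_module_simps(4) poly_coset_eq_self[OF I])

lemma quotient_module_trivial_iff: "carrier M = {\<zero>\<^bsub>M\<^esub>} \<longleftrightarrow> J = I"
  unfolding quotient_module_simps(1,2) using IJ polys.idealD(2)[OF J] poly_coset_eq_self[OF I] by auto

end

section \<open>Depth and dimension of face ideals\<close>

abbreviation face_ideal :: "'v set \<Rightarrow> 'v set set \<Rightarrow> ('v, 'k::comm_ring_1) mpoly set" where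
  "face_ideal V \<Delta> \<equiv> monomial_span (face_exps V \<Delta>)"

definition down_closed :: "'v set set \<Rightarrow> bool" where
  "down_closed \<Delta> \<longleftrightarrow> (\<forall>\<sigma>\<in>\<Delta>. \<forall>\<tau>. \<tau> \<subseteq> \<sigma> \<longrightarrow> \<tau> \<in> \<Delta>)"

lemma down_closedD: "down_closed \<Delta> \<Longrightarrow> \<sigma> \<in> \<Delta> \<Longrightarrow> \<tau> \<subseteq> \<sigma> \<Longrightarrow> \<tau> \<in> \<Delta>"
  unfolding down_closed_def by blast

lemma down_closed_Pow: "down_closed (Pow F)"
  unfolding down_closed_def by blast

lemma monomial_ideal_face: "down_closed \<Delta> \<Longrightarrow> monomial_ideal_exps V (face_exps V \<Delta>)"
  by (rule monomial_ideal_face_exps) (rule down_closedD)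

lemma ideal_face_ideal: "down_closed \<Delta> \<Longrightarrow> ideal_in (polys V) (face_ideal V \<Delta>)"
  by (intro ideal_monomial_span monomial_ideal_face)

lemma face_ideal_antimono: "\<Delta> \<subseteq> \<Gamma> \<Longrightarrow> face_ideal V \<Gamma> \<subseteq> face_ideal V \<Delta>"
  by (rule monomial_span_mono) (auto simp: face_exps_def)

lemma face_ideal_subset: "face_ideal V \<Delta> \<subseteq> polys V"
  by (rule monomial_span_mono) (auto simp: face_exps_def)

lemma ideal_polys: "ideal_in (polys V) (polys V)"
  by (rule polys.ideal_S)

lemma keys_single_plus:
  "Poly_Mapping.keys (Poly_Mapping.single v (1::nat) + e) = insert v (Poly_Mapping.keys e)"
  by (simp add: keys_plus_nat)

text \<open>The quotient is the polynomial ring in the variables of F, on which these variables form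
  a regular sequence.\<close>

lemma depth_ge_face:
  assumes "finite V" "F \<subseteq> V"
  shows "depth_ge (irrelevant V :: ('v, 'k::field) mpoly set) (card F) (polys V) (face_ideal V (Pow F))"
proof (rule depth_ge_variables)
  show "finite F" using assms finite_subset by blast
  show "F \<subseteq> V" by fact
  show "face_exps V (Pow F) \<subseteq> exponents V" by (auto simp: face_exps_def)
  fix v e assume ve: "v \<in> F" "e \<in> exponents V"
  then show "Poly_Mapping.single v 1 + e \<in> face_exps V (Pow F) \<longleftrightarrow> e \<in> face_exps V (Pow F)"
    using assms(2) by (auto simp: face_exps_def keys_plus_nat)
  show "Poly_Mapping.single v 1 + e \<in> exponents V" using ve assms(2) by auto
qed auto

text \<open>Here F is a minimal nonface of \<Delta>. The monomials that are nonzero in the quotient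
  are those with support exactly F, so the module is free of rank one over the polynomial ring in
  the variables of F, generated by the squarefree monomial of F.\<close>

lemma depth_ge_removed_face:
  assumes "finite V" "F \<subseteq> V" "F \<notin> \<Delta>" "down_closed \<Delta>" "down_closed (insert F \<Delta>)"
  shows "depth_ge (irrelevant V :: ('v, 'k::field) mpoly set) (card F) (face_ideal V \<Delta>) (face_ideal V (insert F \<Delta>))"
proof (rule depth_ge_variables)
  show "finite F" using assms finite_subset by blast
  show "F \<subseteq> V" by fact
  show "face_exps V (insert F \<Delta>) \<subseteq> face_exps V \<Delta>" by (auto simp: face_exps_def)
  fix v assume v: "v \<in> F"
  then have vV: "v \<in> V" using assms(2) by blast
  show "Poly_Mapping.single v 1 + e \<in> face_exps V (insert F \<Delta>) \<longleftrightarrow> e \<in> face_exps V (insert F \<Delta>)"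
    if e: "e \<in> face_exps V \<Delta>" for e
  proof -
    have "insert v (Poly_Mapping.keys e) \<in> insert F \<Delta> \<longleftrightarrow> Poly_Mapping.keys e \<in> insert F \<Delta>"
    proof
      assume "insert v (Poly_Mapping.keys e) \<in> insert F \<Delta>"
      then show "Poly_Mapping.keys e \<in> insert F \<Delta>" by (rule down_closedD[OF assms(5)]) blast
    next
      assume "Poly_Mapping.keys e \<in> insert F \<Delta>"
      then have "Poly_Mapping.keys e = F" using e by (simp add: face_exps_def)
      then show "insert v (Poly_Mapping.keys e) \<in> insert F \<Delta>" using v by (simp add: insert_absorb)
    qed
    then show ?thesis unfolding face_exps_def mem_Collect_eq keys_single_plus using vV by simp
  qed
  show "Poly_Mapping.single v 1 + e \<in> face_exps V \<Delta>" if "e \<in> face_exps V \<Delta>" for e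
    using that vV down_closedD[OF assms(4), of "insert v (Poly_Mapping.keys e)" "Poly_Mapping.keys e"]
    unfolding face_exps_def mem_Collect_eq keys_single_plus by auto
  show "e \<in> face_exps V \<Delta> \<or> Poly_Mapping.single v 1 + (Poly_Mapping.single w 1 + e) \<in> face_exps V (insert F \<Delta>)"
    if w: "w \<in> F" "v \<noteq> w" "Poly_Mapping.single v 1 + e \<in> face_exps V \<Delta>" "Poly_Mapping.single w 1 + e \<in> face_exps V \<Delta>" for w e
  proof (rule ccontr)
    let ?K = "Poly_Mapping.keys e"
    assume neg: "\<not> ?thesis"
    have eV: "e \<in> exponents V" and vK: "insert v ?K \<notin> \<Delta>" and wK: "insert w ?K \<notin> \<Delta>"
      using w(3,4) unfolding face_exps_def mem_Collect_eq keys_single_plus by auto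
    have wV: "w \<in> V" using w assms(2) by blast
    have K: "?K \<in> \<Delta>" and vwK: "insert v (insert w ?K) \<in> insert F \<Delta>"
      using neg eV vV wV unfolding face_exps_def mem_Collect_eq keys_single_plus de_Morgan_disj by auto
    have "insert v ?K \<in> insert F \<Delta>" "insert w ?K \<in> insert F \<Delta>"
      using down_closedD[OF assms(5) vwK, of "insert v ?K"] down_closedD[OF assms(5) vwK, of "insert w ?K"] by blast+
    then have "insert v ?K = F" "insert w ?K = F" using vK wK by blast+
    then have "w \<in> ?K" using w(1,2) by blast
    then show False using wK K by (simp add: insert_absorb)
  qed
qed

text \<open>Stated for every complex that contains all faces with at most k vertices, since the
  induction runs through complexes between the skeleton and the full simplex. Adding a minimal
  nonface F, which has more than k vertices, gives an exact sequence with kernel of depth at least k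
  + 1 and, by induction, middle term of depth at least k; the cokernel is the ring in
  question.\<close>

lemma depth_ge_skeleton:
  assumes V: "finite V" and k: "k \<le> card V" and "down_closed \<Gamma>" "\<Gamma> \<subseteq> Pow V" "\<And>\<sigma>. \<sigma> \<subseteq> V \<Longrightarrow> card \<sigma> \<le> k \<Longrightarrow> \<sigma> \<in> \<Gamma>"
  shows "depth_ge (irrelevant V :: ('v, 'k::field) mpoly set) k (polys V) (face_ideal V \<Gamma>)"
  using assms(3-)
proof (induction "card (Pow V - \<Gamma>)" arbitrary: \<Gamma> rule: less_induct)
  case less
  interpret noetherian_subring_with_ideal "polys V :: ('v, 'k) mpoly set" "irrelevant V"
    by (rule noetherian_polys_with_ideal[OF V])
  show ?case
  proof (cases "\<Gamma> = Pow V")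
    case True
    then show ?thesis using depth_ge_mono[OF depth_ge_face[OF V order_refl] k] by simp
  next
    case False
    define A where "A = Pow V - \<Gamma>"
    have "finite A" "A \<noteq> {}" using False less.prems(2) V by (auto simp: A_def)
    then obtain F where F: "F \<in> A" "\<And>G. G \<in> A \<Longrightarrow> G \<subseteq> F \<Longrightarrow> F = G"
      using finite_has_minimal[of A] by metis
    have FV: "F \<subseteq> V" "F \<notin> \<Gamma>" using F by (auto simp: A_def)
    have dc: "down_closed (insert F \<Gamma>)"
      unfolding down_closed_def
    proof (intro ballI allI impI)
      fix \<sigma> \<tau> assume st: "\<sigma> \<in> insert F \<Gamma>" "\<tau> \<subseteq> \<sigma>"
      show "\<tau> \<in> insert F \<Gamma>"
      proof (cases "\<sigma> \<in> \<Gamma>")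
        case True
        then show ?thesis using down_closedD[OF less.prems(1) _ st(2)] by blast
      next
        case False
        then have "\<tau> \<subseteq> F" using st by blast
        then show ?thesis using F(2)[of \<tau>] FV by (auto simp: A_def)
      qed
    qed
    have "Pow V - insert F \<Gamma> \<subset> Pow V - \<Gamma>" using FV by blast
    then have "card (Pow V - insert F \<Gamma>) < card (Pow V - \<Gamma>)" using V by (intro psubset_card_mono) auto
    then have IH: "depth_ge (irrelevant V :: ('v, 'k) mpoly set) k (polys V) (face_ideal V (insert F \<Gamma>))"
      using less.hyps[of "insert F \<Gamma>"] dc less.prems FV by auto
    have "k < card F" using less.prems(3)[of F] FV by (meson not_le_imp_less)
    then have "depth_ge (irrelevant V :: ('v, 'k) mpoly set) (Suc k) (face_ideal V \<Gamma>) (face_ideal V (insert F \<Gamma>))"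
      using depth_ge_mono[OF depth_ge_removed_face[OF V FV less.prems(1) dc], of "Suc k"] by simp
    then show ?thesis
      using IH depth_lemma_cokernel[OF ideal_polys ideal_face_ideal[OF less.prems(1)] ideal_face_ideal[OF dc]]
        face_ideal_antimono[of \<Gamma> "insert F \<Gamma>"] face_ideal_subset by blast
  qed
qed

text \<open>A monomial outside a monomial ideal survives localization at 1 + \<mm>: for a without
  constant term, the coefficient of x^e in (1 - a) x^e is 1.\<close>

lemma depth_ge_prime_chain:
  fixes J :: "('v, 'k::field) mpoly set"
  assumes V: "finite V" and J: "ideal_in (polys V) J" and U: "monomial_ideal_exps V U" and sub: "monomial_span U \<subseteq> J"
    and depth: "depth_ge (irrelevant V) n J (monomial_span U)" and e: "Poly_Mapping.single e 1 \<in> J" "e \<notin> U"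
  shows "\<exists>P :: nat \<Rightarrow> ('v, 'k) mpoly set. {r \<in> polys V. r * Poly_Mapping.single e 1 \<in> monomial_span U} \<subseteq> P 0 \<and>
    (\<forall>i\<le>n. prime_in (polys V) (P i)) \<and> (\<forall>i<n. P i \<subset> P (Suc i))"
proof -
  interpret noetherian_subring_with_ideal "polys V :: ('v, 'k) mpoly set" "irrelevant V"
    by (rule noetherian_polys_with_ideal[OF V])
  have e': "Poly_Mapping.single e 1 \<notin> saturation (monomial_span U)"
  proof
    assume "Poly_Mapping.single e 1 \<in> saturation (monomial_span U)"
    then obtain a :: "('v, 'k) mpoly" where a: "a \<in> irrelevant V" "(1 - a) * Poly_Mapping.single e 1 \<in> monomial_span U"
      by (auto simp: saturation_def)
    have "0 \<notin> Poly_Mapping.keys a" using a(1) by (auto simp: monomial_span_def)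
    then have "Poly_Mapping.lookup a 0 = 0" by (simp add: in_keys_iff)
    then have "Poly_Mapping.lookup (Poly_Mapping.single e 1 * (1 - a)) (e + 0) = 1"
      unfolding lookup_monomial_mult by (simp add: lookup_minus)
    then have "e \<in> Poly_Mapping.keys ((1 - a) * Poly_Mapping.single e 1)"
      by (simp add: in_keys_iff mult.commute)
    then show False using a(2) e(2) by (auto simp: monomial_span_def)
  qed
  show ?thesis
    using prime_chain[OF J ideal_monomial_span[OF U] sub depth e(1) e'] unfolding annih_def .
qed

text \<open>A is the ideal with respect to which dimension is measured, such as a Stanley--Reisner
  ideal for the ring itself or the annihilator for the relative module. It only has to kill the
  chosen monomial in order to lie below the chain.\<close>

lemma depth_le_krull_dim:
  fixes J A :: "('v, 'k::field) mpoly set"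
  assumes "finite V" "ideal_in (polys V) J" "monomial_ideal_exps V U" "monomial_span U \<subseteq> J"
    "depth_ge (irrelevant V) n J (monomial_span U)" "Poly_Mapping.single e 1 \<in> J" "e \<notin> U"
    and A: "ideal_in (polys V) A" "\<And>r. r \<in> A \<Longrightarrow> r * Poly_Mapping.single e 1 \<in> monomial_span U"
  shows "enat n \<le> krull_dim (poly_ring V Quot A)"
proof -
  obtain P :: "nat \<Rightarrow> ('v, 'k) mpoly set" where P: "{r \<in> polys V. r * Poly_Mapping.single e 1 \<in> monomial_span U} \<subseteq> P 0"
    "\<forall>i\<le>n. prime_in (polys V) (P i)" "\<forall>i<n. P i \<subset> P (Suc i)"
    using depth_ge_prime_chain[OF assms(1-7)] by blast
  have "A \<subseteq> P 0" using A(2) polys.idealD(6)[OF A(1)] P(1) by blast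
  then show ?thesis using krull_dim_quot_ge[OF A(1), of n P] P(2,3) by blast
qed

text \<open>The chain of primes is not written down: it comes from the variables of F, a regular
  sequence on the polynomial ring of the face, whose unit is killed by A.\<close>

lemma krull_dim_ge_face:
  fixes A :: "('v, 'k::field) mpoly set"
  assumes V: "finite V" and F: "F \<subseteq> V" and A: "ideal_in (polys V) A" "A \<subseteq> face_ideal V (Pow F)"
  shows "enat (card F) \<le> krull_dim (poly_ring V Quot A)"
proof (rule depth_le_krull_dim[OF V ideal_polys monomial_ideal_face[OF down_closed_Pow] face_ideal_subset depth_ge_face[OF V F]])
  show "Poly_Mapping.single 0 1 \<in> polys V" by simp
  show "0 \<notin> face_exps V (Pow F)" by (simp add: face_exps_def)
  show "r * Poly_Mapping.single 0 1 \<in> face_ideal V (Pow F)" if "r \<in> A" for r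
    using that A(2) by auto
qed (rule A)

lemma krull_dim_le_card:
  fixes A :: "('v, 'k::field) mpoly set"
  assumes V: "finite V" "\<Gamma> \<subseteq> Pow V" "\<And>\<sigma>. \<sigma> \<in> \<Gamma> \<Longrightarrow> card \<sigma> \<le> s"
    and A: "ideal_in (polys V) A" "face_ideal V \<Gamma> \<subseteq> A"
  shows "krull_dim (poly_ring V Quot A) \<le> enat s"
proof (rule krull_dim_quot_le[OF A(1)])
  fix P :: "nat \<Rightarrow> ('v, 'k) mpoly set" and l
  assume P: "\<And>i. i \<le> l \<Longrightarrow> prime_in (polys V) (P i)" "\<And>i. i < l \<Longrightarrow> P i \<subset> P (Suc i)" "A \<subseteq> P 0"
  have P0: "monomial_span {e \<in> exponents V. Poly_Mapping.keys e \<notin> \<Gamma>} \<subseteq> P 0"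
    using A(2) P(3) unfolding face_exps_def by blast
  show "l \<le> s"
    by (rule prime_chain_length_le[of V \<Gamma> s l P]) (simp_all only: V P P0)
qed

text \<open>A monomial of least degree in \<open>U - U'\<close> is not in \<open>\<mm> U + U'\<close>, so the quotient by elements of \<open>\<mm>\<close> is nonzero.\<close>
lemma module_depth_ge_monomial:
  fixes V :: "'v set"
  assumes V: "finite V" and U: "monomial_ideal_exps V U" and U': "monomial_ideal_exps V U'" and sub: "U' \<subset> U"
    and depth: "depth_ge (irrelevant V :: ('v, 'k::field) mpoly set) n (monomial_span U) (monomial_span U')"
  shows "enat n \<le> module_depth (poly_ring V) (irrelevant V :: ('v, 'k) mpoly set)
    (quotient_module (poly_ring V) (monomial_span U) (monomial_span U'))"
proof -
  obtain e0 where e0: "e0 \<in> U - U'" "\<And>e. e \<in> U - U' \<Longrightarrow> total_degree V e0 \<le> total_degree V e"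
    using ex_has_least_nat[of "\<lambda>e. e \<in> U - U'" _ "total_degree V"] sub by blast
  show ?thesis
  proof (rule module_depth_ge[OF ideal_monomial_span[OF U'] ideal_monomial_span[OF U] _ depth, where K = "monomial_span (U - {e0})"])
    show "monomial_span U' \<subseteq> monomial_span U" using sub by (intro monomial_span_mono) auto
    have "Poly_Mapping.single e0 (1::'k) \<in> monomial_span U" using e0 by simp
    moreover have "Poly_Mapping.single e0 (1::'k) \<notin> monomial_span (U - {e0})" by (simp add: monomial_span_def)
    ultimately show "\<not> monomial_span U \<subseteq> (monomial_span (U - {e0}) :: ('v, 'k) mpoly set)" by blast
    show "monomial_span U' \<subseteq> monomial_span (U - {e0})" using sub e0 by (intro monomial_span_mono) auto
    show "x + y \<in> monomial_span (U - {e0})" if "x \<in> monomial_span (U - {e0})" "y \<in> monomial_span (U - {e0})"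
      for x y :: "('v, 'k) mpoly" using that by (rule monomial_span_add)
    show "f * z \<in> monomial_span (U - {e0})" if fz: "f \<in> irrelevant V" "z \<in> monomial_span U" for f z :: "('v, 'k) mpoly"
    proof (rule monomial_span_mult[OF _ fz])
      fix a e assume a: "a \<in> exponents V - {0}" and e: "e \<in> U"
      have "a + e \<in> U" using a e U by (auto simp: monomial_ideal_exps_def)
      moreover have "a + e \<noteq> e0"
      proof
        assume eq: "a + e = e0"
        obtain v where v: "v \<in> Poly_Mapping.keys a" using a by fastforce
        then have "v \<in> V" using a by (auto simp: exponents_def)
        moreover have "0 < Poly_Mapping.lookup a v" using v by (simp add: in_keys_iff)
        ultimately have "0 < total_degree V a" unfolding total_degree_def using V by (intro sum_pos2) auto
        then have "total_degree V e < total_degree V e0"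
          unfolding eq[symmetric] by (simp add: total_degree_def lookup_add sum.distrib)
        then have "e \<in> U'" using e0(2)[of e] e by auto
        then have "a + e \<in> U'" using a U' by (auto simp: monomial_ideal_exps_def)
        then show False using e0 eq by auto
      qed
      ultimately show "a + e \<in> U - {e0}" by simp
    qed
  qed
qed

section \<open>Setting the variables outside a given set to zero\<close>

definition restrict_vars :: "'v set \<Rightarrow> ('v, 'k::comm_ring_1) mpoly \<Rightarrow> ('v, 'k) mpoly" where
  "restrict_vars W = Poly_Mapping.mapp (\<lambda>e c. c when Poly_Mapping.keys e \<subseteq> W)"

lemma lookup_restrict_vars:
  "Poly_Mapping.lookup (restrict_vars W p) e = (if Poly_Mapping.keys e \<subseteq> W then Poly_Mapping.lookup p e else 0)"
  by (auto simp: restrict_vars_def lookup_mapp when_def in_keys_iff)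

lemma restrict_vars_add: "restrict_vars W (p + q) = restrict_vars W p + restrict_vars W q"
  by (rule poly_mapping_eqI) (simp add: lookup_restrict_vars lookup_add)

lemma keys_restrict_vars: "Poly_Mapping.keys (restrict_vars W p) = Poly_Mapping.keys p \<inter> exponents W"
proof (rule Set.set_eqI)
  fix e
  show "e \<in> Poly_Mapping.keys (restrict_vars W p) \<longleftrightarrow> e \<in> Poly_Mapping.keys p \<inter> exponents W"
    using in_keys_iff[of e "restrict_vars W p"] in_keys_iff[of e p]
    by (simp add: lookup_restrict_vars exponents_def)
qed

lemma restrict_vars_in: "p \<in> monomial_span U \<Longrightarrow> restrict_vars W p \<in> monomial_span (U \<inter> exponents W)"
  by (auto simp: monomial_span_def keys_restrict_vars)

lemma restrict_vars_id:
  assumes "p \<in> polys W"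
  shows "restrict_vars W p = p"
proof (rule poly_mapping_eqI)
  fix e
  show "Poly_Mapping.lookup (restrict_vars W p) e = Poly_Mapping.lookup p e"
    using assms in_keys_iff[of e p] by (auto simp: lookup_restrict_vars monomial_span_def exponents_def)
qed

lemma restrict_vars_eq_0:
  assumes "p \<in> monomial_span (- exponents W)"
  shows "restrict_vars W p = 0"
proof -
  have "Poly_Mapping.keys (restrict_vars W p) = {}"
    using assms by (auto simp: monomial_span_def keys_restrict_vars)
  then show ?thesis by simp
qed

lemma restrict_vars_diff: "p - restrict_vars W p \<in> monomial_span (- exponents W)"
proof -
  have "e \<notin> exponents W" if "e \<in> Poly_Mapping.keys (p - restrict_vars W p)" for e
    using that in_keys_iff[of e "p - restrict_vars W p"]
    by (auto simp: lookup_minus lookup_restrict_vars exponents_def)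
  then show ?thesis by (auto simp: monomial_span_def)
qed

text \<open>Both factors may be changed modulo the span of the monomials involving a variable
  outside W. This span absorbs multiplication and is mapped to 0, while polynomials in W are
  fixed.\<close>

lemma restrict_vars_mult: "restrict_vars W (p * q) = restrict_vars W p * restrict_vars W q"
proof -
  let ?h = "restrict_vars W"
  let ?Z = "monomial_span (- exponents W)"
  have in_UNIV: "r \<in> monomial_span UNIV" for r :: "('a, 'b) mpoly" by (simp add: monomial_span_def)
  have hh: "?h p * ?h q \<in> polys W"
    using restrict_vars_in[OF in_UNIV, of W p] restrict_vars_in[OF in_UNIV, of W q] by (simp add: polys.S_simps)
  have "?h p * (q - ?h q) \<in> ?Z"
    by (rule monomial_span_mult[OF _ in_UNIV restrict_vars_diff]) auto
  moreover have "(p - ?h p) * q \<in> ?Z"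
    by (rule monomial_span_mult[OF _ restrict_vars_diff in_UNIV]) auto
  ultimately have "?h p * (q - ?h q) + (p - ?h p) * q \<in> ?Z" by (rule monomial_span_add)
  then have "?h (?h p * (q - ?h q) + (p - ?h p) * q) = 0" by (rule restrict_vars_eq_0)
  moreover have "p * q = ?h p * ?h q + (?h p * (q - ?h q) + (p - ?h p) * q)" by (simp add: algebra_simps)
  ultimately have "?h (p * q) = ?h (?h p * ?h q)" using restrict_vars_add by (metis add.right_neutral)
  then show ?thesis using restrict_vars_id[OF hh] by simp
qed

lemma restrict_vars_image:
  "restrict_vars W ` (monomial_span U :: ('v, 'k::comm_ring_1) mpoly set) = monomial_span (U \<inter> exponents W)"
    (is "_ ` ?M = ?N")
proof
  show "restrict_vars W ` ?M \<subseteq> ?N" using restrict_vars_in by blast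
  show "?N \<subseteq> restrict_vars W ` ?M"
  proof
    fix p assume "p \<in> ?N"
    then have "p \<in> ?M" "restrict_vars W p = p" by (auto simp: monomial_span_def intro!: restrict_vars_id)
    then show "p \<in> restrict_vars W ` ?M" by (metis imageI)
  qed
qed

text \<open>The variables outside W are not vertices of \<Delta>, so they lie in the ideal of
  \<Delta>. Setting them to zero is therefore an isomorphism between the two presentations of
  k[\<Delta>], and it maps a regular sequence to a regular sequence.\<close>

lemma depth_ge_restrict_vars:
  assumes W: "W \<subseteq> V" "\<Union>\<Delta> \<subseteq> W" and \<Delta>: "down_closed \<Delta>"
    and depth: "depth_ge (irrelevant V :: ('v, 'k::field) mpoly set) n (polys V) (face_ideal V \<Delta>)"
  shows "depth_ge (irrelevant W :: ('v, 'k) mpoly set) n (polys W) (face_ideal W \<Delta>)"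
proof -
  let ?h = "restrict_vars W :: ('v, 'k) mpoly \<Rightarrow> _"
  have exps: "exponents V \<inter> exponents W = exponents W" "(exponents V - {0}) \<inter> exponents W = exponents W - {0}"
    "face_exps V \<Delta> \<inter> exponents W = face_exps W \<Delta>"
    using W(1) by (auto simp: exponents_def face_exps_def)
  have "depth_ge (?h ` irrelevant V) n (?h ` polys V) (?h ` face_ideal V \<Delta>)"
  proof (rule depth_ge_image[OF ideal_polys ideal_face_ideal[OF \<Delta>] face_ideal_subset _ subring_polys _ _ _ depth])
    show "irrelevant V \<subseteq> (polys V :: ('v, 'k) mpoly set)" by (rule monomial_span_mono) auto
    show "x \<in> face_ideal V \<Delta>" if x: "x \<in> polys V" "?h x \<in> ?h ` face_ideal V \<Delta>" for x
    proof -
      have hx: "?h x \<in> face_ideal W \<Delta>" using x(2) unfolding restrict_vars_image exps .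
      have "Poly_Mapping.keys e \<notin> \<Delta>" if e: "e \<in> Poly_Mapping.keys x" for e
      proof (cases "Poly_Mapping.keys e \<subseteq> W")
        case True
        then have "e \<in> Poly_Mapping.keys (?h x)" using e by (simp add: keys_restrict_vars exponents_def)
        then show ?thesis using hx by (auto simp: monomial_span_def face_exps_def)
      next
        case False
        then show ?thesis using W(2) by blast
      qed
      then show ?thesis using x(1) by (auto simp: monomial_span_def face_exps_def)
    qed
  qed (rule restrict_vars_add restrict_vars_mult)+
  then show ?thesis unfolding restrict_vars_image exps .
qed

section \<open>Cohen--Macaulay extenders\<close>

lemma simplicial_complexD:
  assumes "simplicial_complex \<Delta>"
  shows "finite (\<Union>\<Delta>)" "down_closed \<Delta>" "\<Delta> \<subseteq> Pow (\<Union>\<Delta>)" "finite \<Delta>"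
proof -
  show "finite (\<Union>\<Delta>)" "down_closed \<Delta>" using assms by (auto simp: simplicial_complex_def down_closed_def)
  then show "\<Delta> \<subseteq> Pow (\<Union>\<Delta>)" "finite \<Delta>" by (auto simp: finite_UnionD)
qed

lemma sr_ideal_face_ideal:
  "finite V \<Longrightarrow> down_closed \<Delta> \<Longrightarrow> sr_ideal V \<Delta> = face_ideal V \<Delta>"
  by (rule sr_ideal_eq) (auto intro: down_closedD)

lemma sr_dim_eq:
  assumes "simplicial_complex \<Delta>"
  shows "sr_dim TYPE('k::field) \<Delta> = krull_dim (poly_ring (\<Union>\<Delta>) Quot (face_ideal (\<Union>\<Delta>) \<Delta> :: ('v, 'k) mpoly set))"
  using simplicial_complexD[OF assms] by (simp add: sr_dim_def sr_ring_def sr_ideal_face_ideal)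

lemma sr_depth_eq:
  assumes "simplicial_complex \<Delta>"
  shows "sr_depth TYPE('k::field) \<Delta> = module_depth (poly_ring (\<Union>\<Delta>)) (irrelevant (\<Union>\<Delta>))
    (quotient_module (poly_ring (\<Union>\<Delta>)) (polys (\<Union>\<Delta>)) (face_ideal (\<Union>\<Delta>) \<Delta> :: ('v, 'k) mpoly set))"
  using simplicial_complexD[OF assms]
  by (simp add: sr_depth_def Let_def sr_ideal_face_ideal irrelevant_ideal_eq)

lemma complex_dim_eq:
  assumes "finite \<Delta>" "F \<in> \<Delta>" "\<And>\<sigma>. \<sigma> \<in> \<Delta> \<Longrightarrow> card \<sigma> \<le> card F"
  shows "complex_dim \<Delta> = int (card F) - 1"
  unfolding complex_dim_def
proof (rule Max_eqI)
  fix d assume "d \<in> face_dim ` \<Delta>"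
  then obtain \<sigma> where "\<sigma> \<in> \<Delta>" "d = face_dim \<sigma>" by blast
  then show "d \<le> int (card F) - 1" using assms(3)[of \<sigma>] by (simp add: face_dim_def)
qed (use assms in \<open>auto simp: face_dim_def\<close>)

lemma max_face:
  assumes "finite \<Delta>" "G \<in> \<Delta>"
  obtains F where "F \<in> \<Delta>" "\<And>\<sigma>. \<sigma> \<in> \<Delta> \<Longrightarrow> card \<sigma> \<le> card F"
proof -
  have "Max (card ` \<Delta>) \<in> card ` \<Delta>" using assms by (intro Max_in) auto
  then obtain F where "F \<in> \<Delta>" "Max (card ` \<Delta>) = card F" by auto
  moreover have "card \<sigma> \<le> Max (card ` \<Delta>)" if "\<sigma> \<in> \<Delta>" for \<sigma> using assms that by (intro Max_ge) auto
  ultimately show thesis using that by metis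
qed

lemma sr_depth_ge_imp:
  assumes "simplicial_complex \<Delta>" "enat n \<le> sr_depth TYPE('k::field) \<Delta>"
  shows "depth_ge (irrelevant (\<Union>\<Delta>)) n (polys (\<Union>\<Delta>)) (face_ideal (\<Union>\<Delta>) \<Delta> :: ('v, 'k) mpoly set)"
  using assms(2) unfolding sr_depth_eq[OF assms(1)]
  by (rule depth_ge_of_module_depth[OF ideal_face_ideal[OF simplicial_complexD(2)[OF assms(1)]] ideal_polys face_ideal_subset])

lemma sr_depth_ge:
  assumes "simplicial_complex \<Delta>" "\<Delta> \<noteq> {}"
    "depth_ge (irrelevant (\<Union>\<Delta>)) n (polys (\<Union>\<Delta>)) (face_ideal (\<Union>\<Delta>) \<Delta> :: ('v, 'k::field) mpoly set)"
  shows "enat n \<le> sr_depth TYPE('k) \<Delta>"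
  unfolding sr_depth_eq[OF assms(1)]
proof (rule module_depth_ge_monomial)
  note \<Delta> = simplicial_complexD[OF assms(1)]
  show "finite (\<Union>\<Delta>)" by (rule \<Delta>)
  show "monomial_ideal_exps (\<Union>\<Delta>) (exponents (\<Union>\<Delta>))" by (auto simp: monomial_ideal_exps_def)
  show "monomial_ideal_exps (\<Union>\<Delta>) (face_exps (\<Union>\<Delta>) \<Delta>)" using \<Delta>(2) by (rule monomial_ideal_face)
  obtain \<sigma> where "\<sigma> \<in> \<Delta>" using assms(2) by blast
  then have "{} \<in> \<Delta>" using down_closedD[OF \<Delta>(2)] by blast
  then have "0 \<in> exponents (\<Union>\<Delta>) - face_exps (\<Union>\<Delta>) \<Delta>" by (simp add: face_exps_def)
  moreover have "face_exps (\<Union>\<Delta>) \<Delta> \<subseteq> exponents (\<Union>\<Delta>)" by (auto simp: face_exps_def)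
  ultimately show "face_exps (\<Union>\<Delta>) \<Delta> \<subset> exponents (\<Union>\<Delta>)" by blast
qed (rule assms(3))

lemma sr_dim_ge:
  assumes "simplicial_complex \<Delta>" "F \<in> \<Delta>"
  shows "enat (card F) \<le> sr_dim TYPE('k::field) \<Delta>"
  unfolding sr_dim_eq[OF assms(1)]
proof (rule krull_dim_ge_face)
  note \<Delta> = simplicial_complexD[OF assms(1)]
  show "face_ideal (\<Union>\<Delta>) \<Delta> \<subseteq> (face_ideal (\<Union>\<Delta>) (Pow F) :: ('a, 'k) mpoly set)"
    by (rule face_ideal_antimono) (use assms(2) \<Delta>(2) down_closedD in auto)
qed (use simplicial_complexD[OF assms(1)] assms(2) ideal_face_ideal in auto)

lemma sr_dim_le:
  assumes "simplicial_complex \<Delta>" "\<And>\<sigma>. \<sigma> \<in> \<Delta> \<Longrightarrow> card \<sigma> \<le> s"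
  shows "sr_dim TYPE('k::field) \<Delta> \<le> enat s"
  unfolding sr_dim_eq[OF assms(1)]
  using krull_dim_le_card[OF simplicial_complexD(1,3)[OF assms(1)] assms(2) ideal_face_ideal[OF simplicial_complexD(2)[OF assms(1)]] order_refl] .

lemma sr_depth_le_sr_dim:
  assumes "simplicial_complex \<Delta>" "\<Delta> \<noteq> {}"
  shows "sr_depth TYPE('k::field) \<Delta> \<le> sr_dim TYPE('k) \<Delta>"
  unfolding sr_depth_eq[OF assms(1)] sr_dim_eq[OF assms(1)]
proof (rule module_depth_le)
  note \<Delta> = simplicial_complexD[OF assms(1)]
  show iF: "ideal_in (polys (\<Union>\<Delta>)) (face_ideal (\<Union>\<Delta>) \<Delta> :: ('a, 'k) mpoly set)" by (rule ideal_face_ideal[OF \<Delta>(2)])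
  show "ideal_in (polys (\<Union>\<Delta>)) (polys (\<Union>\<Delta>))" by (rule ideal_polys)
  show "face_ideal (\<Union>\<Delta>) \<Delta> \<subseteq> polys (\<Union>\<Delta>)" by (rule face_ideal_subset)
  fix n
  assume d: "depth_ge (irrelevant (\<Union>\<Delta>)) n (polys (\<Union>\<Delta>)) (face_ideal (\<Union>\<Delta>) \<Delta> :: ('a, 'k) mpoly set)"
  obtain \<sigma> where "\<sigma> \<in> \<Delta>" using assms(2) by blast
  then have "{} \<in> \<Delta>" using down_closedD[OF \<Delta>(2)] by blast
  then have "0 \<notin> face_exps (\<Union>\<Delta>) \<Delta>" by (simp add: face_exps_def)
  then show "enat n \<le> krull_dim (poly_ring (\<Union>\<Delta>) Quot (face_ideal (\<Union>\<Delta>) \<Delta> :: ('a, 'k) mpoly set))"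
    by (intro depth_le_krull_dim[OF \<Delta>(1) ideal_polys monomial_ideal_face[OF \<Delta>(2)] face_ideal_subset d _ _ iF,
        where e = 0]) simp_all
qed

lemma ideal_annihilator:
  assumes "ideal_in (polys V) I" "ideal_in (polys V) J"
  shows "ideal_in (polys V) {r \<in> polys V. \<forall>z\<in>J. r * z \<in> I}"
  using polys.idealD(2,3,4)[OF assms(1)] by (intro polys.idealI) (auto simp: distrib_right mult.assoc)

text \<open>For a facet F, the annihilator of the squarefree monomial of F in k[\<Gamma>] is the
  prime ideal generated by the variables outside F: multiplying by any such variable leaves
  \<Gamma>, and monomials supported in F keep the support equal to F.\<close>

lemma facet_annihilator:
  fixes r :: "('v, 'k::field) mpoly"
  assumes "finite F" "F \<in> \<Gamma>" "\<And>\<sigma>. \<sigma> \<in> \<Gamma> \<Longrightarrow> F \<subseteq> \<sigma> \<Longrightarrow> \<sigma> = F" "F \<subseteq> V" "r \<in> polys V"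
  shows "r * Poly_Mapping.single (indicator_exp F) 1 \<in> face_ideal V \<Gamma> \<longleftrightarrow> r \<in> face_ideal V (Pow F)"
proof
  assume r: "r * Poly_Mapping.single (indicator_exp F) 1 \<in> face_ideal V \<Gamma>"
  have "a \<in> face_exps V (Pow F)" if a: "a \<in> Poly_Mapping.keys r" for a
  proof -
    have "Poly_Mapping.lookup (Poly_Mapping.single (indicator_exp F) 1 * r) (indicator_exp F + a) = Poly_Mapping.lookup r a"
      by (simp add: lookup_monomial_mult)
    then have "indicator_exp F + a \<in> Poly_Mapping.keys (r * Poly_Mapping.single (indicator_exp F) 1)"
      using a by (simp add: in_keys_iff mult.commute)
    then have "F \<union> Poly_Mapping.keys a \<notin> \<Gamma>"
      using r assms(1) by (auto simp: monomial_span_def face_exps_def keys_plus_nat)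
    then have "\<not> Poly_Mapping.keys a \<subseteq> F" using assms(2) by (metis Un_absorb2)
    then show ?thesis using a assms(5) by (auto simp: monomial_span_def face_exps_def)
  qed
  then show "r \<in> face_ideal V (Pow F)" by (auto simp: monomial_span_def)
next
  assume r: "r \<in> face_ideal V (Pow F)"
  show "r * Poly_Mapping.single (indicator_exp F) 1 \<in> face_ideal V \<Gamma>"
  proof (rule monomial_span_mult[OF _ r, of "{indicator_exp F}"])
    fix a e assume "a \<in> face_exps V (Pow F)" "e \<in> {indicator_exp F}"
    then have a: "a \<in> exponents V" "\<not> Poly_Mapping.keys a \<subseteq> F" "e = indicator_exp F" by (auto simp: face_exps_def)
    then have "Poly_Mapping.keys a \<union> F \<notin> \<Gamma>" using assms(3)[of "Poly_Mapping.keys a \<union> F"] by blast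
    moreover have "indicator_exp F \<in> exponents V" using assms(1,4) by (simp add: exponents_def)
    ultimately show "a + e \<in> face_exps V \<Gamma>" using a assms(1) by (simp add: face_exps_def keys_plus_nat)
  qed simp
qed

lemma relative_cohen_macaulay_iff:
  fixes \<Gamma> :: "'v set set"
  assumes \<Gamma>: "simplicial_complex \<Gamma>" and \<Delta>: "down_closed \<Delta>" "\<Delta> \<subseteq> \<Gamma>"
  shows "relative_cohen_macaulay TYPE('k::field) \<Gamma> \<Delta> \<longleftrightarrow>
    face_ideal (\<Union>\<Gamma>) \<Delta> = (face_ideal (\<Union>\<Gamma>) \<Gamma> :: ('v, 'k) mpoly set) \<or>
    module_depth (poly_ring (\<Union>\<Gamma>)) (irrelevant (\<Union>\<Gamma>) :: ('v, 'k) mpoly set)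
      (quotient_module (poly_ring (\<Union>\<Gamma>)) (face_ideal (\<Union>\<Gamma>) \<Delta>) (face_ideal (\<Union>\<Gamma>) \<Gamma>)) =
    krull_dim (poly_ring (\<Union>\<Gamma>) Quot
      {r \<in> polys (\<Union>\<Gamma>). \<forall>z\<in>face_ideal (\<Union>\<Gamma>) \<Delta>. r * z \<in> (face_ideal (\<Union>\<Gamma>) \<Gamma> :: ('v, 'k) mpoly set)})"
proof -
  note G = simplicial_complexD[OF \<Gamma>]
  have i: "ideal_in (polys (\<Union>\<Gamma>)) (face_ideal (\<Union>\<Gamma>) \<Gamma> :: ('v, 'k) mpoly set)"
    "ideal_in (polys (\<Union>\<Gamma>)) (face_ideal (\<Union>\<Gamma>) \<Delta> :: ('v, 'k) mpoly set)"
    using ideal_face_ideal G(2) \<Delta>(1) by blast+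
  show ?thesis
    unfolding relative_cohen_macaulay_def Let_def cohen_macaulay_module_def module_dim_def
      sr_ideal_face_ideal[OF G(1) G(2)] sr_ideal_face_ideal[OF G(1) \<Delta>(1)] irrelevant_ideal_eq
      quotient_module_trivial_iff[OF i face_ideal_antimono[OF \<Delta>(2)]]
      annihilator_quotient_module[OF i face_ideal_antimono[OF \<Delta>(2)]] ..
qed

theorem theorem6p3:
  fixes \<Delta> :: "'v::infinite set set"
  assumes "simplicial_complex \<Delta>" and "\<Delta> \<noteq> {}" and "pure_complex \<Delta>"
  shows "(\<exists>\<Gamma>. cm_extender TYPE('k::field) \<Delta> \<Gamma>) \<longleftrightarrow>
         sr_dim TYPE('k) \<Delta> \<le> sr_depth TYPE('k) \<Delta> + 1"
proof
  note D = simplicial_complexD[OF assms(1)]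
  obtain F where F: "F \<in> \<Delta>" "\<And>\<sigma>. \<sigma> \<in> \<Delta> \<Longrightarrow> card \<sigma> \<le> card F"
    using max_face[OF D(4)] assms(2) by blast
  define s where "s = card F"
  have cdim: "complex_dim \<Delta> = int s - 1" unfolding s_def by (rule complex_dim_eq[OF D(4) F])
  {
    assume "\<exists>\<Gamma>. cm_extender TYPE('k) \<Delta> \<Gamma>"
    then obtain \<Gamma> where \<Gamma>: "simplicial_complex \<Gamma>" "\<Delta> \<subseteq> \<Gamma>" "complex_dim \<Gamma> = complex_dim \<Delta>"
      "cohen_macaulay_complex TYPE('k) \<Gamma>" "relative_cohen_macaulay TYPE('k) \<Gamma> \<Delta>"
      unfolding cm_extender_def by blast
    note G = simplicial_complexD[OF \<Gamma>(1)]
    define V where "V = \<Union>\<Gamma>"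
    let ?I = "face_ideal V \<Gamma> :: ('v, 'k) mpoly set" and ?J = "face_ideal V \<Delta> :: ('v, 'k) mpoly set"
    interpret noetherian_subring_with_ideal "polys V :: ('v, 'k) mpoly set" "irrelevant V"
      unfolding V_def by (rule noetherian_polys_with_ideal[OF G(1)])
    have iI: "ideal_in (polys V) ?I" and iJ: "ideal_in (polys V) ?J"
      using ideal_face_ideal G(2) D(2) by blast+
    have IJ: "?I \<subseteq> ?J" by (rule face_ideal_antimono[OF \<Gamma>(2)])
    have "F \<in> \<Gamma>" using F \<Gamma>(2) by blast
    then have "enat s \<le> sr_depth TYPE('k) \<Gamma>"
      using sr_dim_ge[OF \<Gamma>(1), of F, where 'k = 'k] \<Gamma>(4) by (simp add: cohen_macaulay_complex_def s_def)
    then have depthI: "depth_ge (irrelevant V) s (polys V) ?I"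
      unfolding V_def by (rule sr_depth_ge_imp[OF \<Gamma>(1)])
    \<comment> \<open>Here s = dim \<Delta> + 1. For s = 0 the truncated difference
      \<open>s - 1\<close> is 0 and the claim is empty.\<close>
    have depthJ: "depth_ge (irrelevant V) (s - 1) (polys V) ?J"
    proof (cases "?J = ?I")
      case True
      then show ?thesis using depth_ge_mono[OF depthI, of "s - 1"] by simp
    next
      case False
      then have eq: "module_depth (poly_ring V) (irrelevant V :: ('v, 'k) mpoly set) (quotient_module (poly_ring V) ?J ?I) =
          krull_dim (poly_ring V Quot {r \<in> polys V. \<forall>z\<in>?J. r * z \<in> ?I})" (is "?depth = krull_dim (_ Quot ?A)")
        using \<Gamma>(5) relative_cohen_macaulay_iff[OF \<Gamma>(1) D(2) \<Gamma>(2)] unfolding V_def by blast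
      have "\<Gamma> \<noteq> \<Delta>" using False by blast
      then obtain G0 where G0: "G0 \<in> \<Gamma>" "G0 \<notin> \<Delta>" using \<Gamma>(2) by blast
      \<comment> \<open>A largest face above a face outside \<Delta> is a facet of \<Gamma> that is
        not in \<Delta>. Its monomial therefore represents an element of \<open>?J\<close> whose
        annihilator modulo \<open>?I\<close> is \<open>face_ideal V (Pow H)\<close>.\<close>
      obtain H where H: "H \<in> {\<sigma> \<in> \<Gamma>. G0 \<subseteq> \<sigma>}" "\<And>\<sigma>. \<sigma> \<in> {\<sigma> \<in> \<Gamma>. G0 \<subseteq> \<sigma>} \<Longrightarrow> card \<sigma> \<le> card H"
        using max_face[of "{\<sigma> \<in> \<Gamma>. G0 \<subseteq> \<sigma>}" G0] G0 G(4) by auto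
      have H_in: "H \<in> \<Gamma>" "G0 \<subseteq> H" using H(1) by simp_all
      have HsubV: "H \<subseteq> V" using H_in(1) unfolding V_def by blast
      have Hfin: "finite H" using HsubV G(1) finite_subset unfolding V_def by metis
      have Hnot: "H \<notin> \<Delta>" using down_closedD[OF D(2) _ H_in(2)] G0(2) by metis
      note HV = HsubV Hfin H_in(1) Hnot
      have facet: "\<sigma> = H" if "\<sigma> \<in> \<Gamma>" "H \<subseteq> \<sigma>" for \<sigma>
      proof -
        have "\<sigma> \<subseteq> \<Union>\<Gamma>" using that(1) by blast
        then have "finite \<sigma>" using G(1) finite_subset by metis
        moreover have "card \<sigma> \<le> card H" using H that by blast
        ultimately show ?thesis using that(2) card_seteq by blast
      qed
      note ann = facet_annihilator[OF HV(2,3) facet HV(1), where 'k = 'k]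
      \<comment> \<open>This is the part of purity of \<Gamma> that is needed. Depth s of
        k[\<Gamma>] yields a chain of s + 1 primes above the annihilator of the monomial of H, while
        chains above that ideal have at most card H + 1 members.\<close>
      have sH: "s \<le> card H"
      proof -
        have e1: "indicator_exp H \<notin> face_exps V \<Gamma>" using HV by (simp add: face_exps_def)
        have e2: "Poly_Mapping.single (indicator_exp H) 1 \<in> (polys V :: ('v, 'k) mpoly set)"
          using HV by (intro single_in_monomial_span) (simp add: exponents_def)
        note chain = depth_ge_prime_chain[OF G(1)[folded V_def] ideal_polys monomial_ideal_face[OF G(2)]
          face_ideal_subset depthI e2 e1]
        then obtain P :: "nat \<Rightarrow> ('v, 'k) mpoly set"
          where P: "{r \<in> polys V. r * Poly_Mapping.single (indicator_exp H) 1 \<in> ?I} \<subseteq> P 0"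
          "\<forall>i\<le>s. prime_in (polys V) (P i)" "\<forall>i<s. P i \<subset> P (Suc i)"
          by (elim exE conjE)
        have P0: "face_ideal V (Pow H) \<subseteq> P 0"
        proof
          fix r :: "('v, 'k) mpoly" assume r: "r \<in> face_ideal V (Pow H)"
          then have "r \<in> polys V" using face_ideal_subset by (rule subsetD[rotated])
          then show "r \<in> P 0" using P(1) ann[of r] r by blast
        qed
        show ?thesis
        proof (rule prime_chain_length_le[of V "Pow H" "card H" s P])
          show "finite V" using G(1) unfolding V_def .
          show "Pow H \<subseteq> Pow V" using HV(1) by (rule Pow_mono)
          show "card \<sigma> \<le> card H" if "\<sigma> \<in> Pow H" for \<sigma> using that HV(2) by (auto intro: card_mono)
          show "monomial_span {e \<in> exponents V. Poly_Mapping.keys e \<notin> Pow H} \<subseteq> P 0"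
            using P0 unfolding face_exps_def .
        qed (simp_all add: P(2,3))
      qed
      \<comment> \<open>What annihilates all of \<open>?J\<close> modulo \<open>?I\<close>
        annihilates in particular the monomial of H, so the dimension of the relative module is at
        least that of the face H.\<close>
      have kH: "enat (card H) \<le> krull_dim (poly_ring V Quot ?A)"
      proof (rule krull_dim_ge_face)
        show "finite V" using G(1) V_def by simp
        show "ideal_in (polys V) ?A" by (rule ideal_annihilator[OF iI iJ])
        show "?A \<subseteq> face_ideal V (Pow H)"
        proof
          fix r assume r: "r \<in> ?A"
          have "indicator_exp H \<in> face_exps V \<Delta>" using HV by (simp add: face_exps_def exponents_def)
          then have "Poly_Mapping.single (indicator_exp H) 1 \<in> ?J" by simp
          then have "r * Poly_Mapping.single (indicator_exp H) 1 \<in> ?I" using r by simp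
          moreover have "r \<in> polys V" using r by simp
          ultimately show "r \<in> face_ideal V (Pow H)" using ann[of r] by simp
        qed
      qed (rule HV)
      have "enat s \<le> enat (card H)" using sH by simp
      then have "enat s \<le> ?depth" unfolding eq using kH by (rule order_trans)
      then have "depth_ge (irrelevant V) s ?J ?I" by (rule depth_ge_of_module_depth[OF iI iJ IJ])
      then show ?thesis
        using depth_lemma_cokernel[OF ideal_polys iJ iI IJ face_ideal_subset, of "s - 1"]
          depth_ge_mono[OF depthI, of "s - 1"] by (cases s) simp_all
    qed
    have "\<Union>\<Delta> \<subseteq> V" using \<Gamma>(2) unfolding V_def by blast
    \<comment> \<open>The bound was obtained over the vertices of \<Gamma>, whereas
      \<open>sr_depth\<close> refers to the vertices of \<Delta>.\<close>
    then have "depth_ge (irrelevant (\<Union>\<Delta>)) (s - 1) (polys (\<Union>\<Delta>)) (face_ideal (\<Union>\<Delta>) \<Delta> :: ('v, 'k) mpoly set)"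
      using depth_ge_restrict_vars[OF _ order_refl D(2) depthJ] by blast
    then have "enat (s - 1) \<le> sr_depth TYPE('k) \<Delta>" by (rule sr_depth_ge[OF assms(1,2)])
    then have "enat (s - 1) + 1 \<le> sr_depth TYPE('k) \<Delta> + 1" by (rule add_right_mono)
    moreover have "sr_dim TYPE('k) \<Delta> \<le> enat s" using sr_dim_le[OF assms(1)] F(2) unfolding s_def by blast
    moreover have "enat s \<le> enat (s - 1) + 1" by (simp add: one_enat_def)
    ultimately show "sr_dim TYPE('k) \<Delta> \<le> sr_depth TYPE('k) \<Delta> + 1" by (meson order_trans)
  next
    assume depth: "sr_dim TYPE('k) \<Delta> \<le> sr_depth TYPE('k) \<Delta> + 1"
    define V where "V = \<Union>\<Delta>"
    define \<Gamma> where "\<Gamma> = {\<sigma>. \<sigma> \<subseteq> V \<and> card \<sigma> \<le> s}"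
    have V: "finite V" "F \<subseteq> V" using D(1) F(1) unfolding V_def by auto
    have sub: "\<Delta> \<subseteq> \<Gamma>" using F(2) by (auto simp: \<Gamma>_def V_def s_def)
    have "\<Union>\<Gamma> \<subseteq> V" by (auto simp: \<Gamma>_def)
    moreover have "V \<subseteq> \<Union>\<Gamma>" using sub unfolding V_def by blast
    ultimately have U: "\<Union>\<Gamma> = V" by blast
    have sc: "simplicial_complex \<Gamma>" unfolding simplicial_complex_def
    proof (intro conjI ballI allI impI)
      show "finite (\<Union>\<Gamma>)" using U V by simp
      fix \<sigma> \<tau> assume st: "\<sigma> \<in> \<Gamma>" "\<tau> \<subseteq> \<sigma>"
      then have "card \<tau> \<le> card \<sigma>" using V(1) finite_subset[of \<sigma> V] by (intro card_mono) (auto simp: \<Gamma>_def)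
      then show "\<tau> \<in> \<Gamma>" using st by (auto simp: \<Gamma>_def)
    qed
    note G = simplicial_complexD[OF sc]
    let ?I = "face_ideal V \<Gamma> :: ('v, 'k) mpoly set" and ?J = "face_ideal V \<Delta> :: ('v, 'k) mpoly set"
    interpret noetherian_subring_with_ideal "polys V :: ('v, 'k) mpoly set" "irrelevant V"
      by (rule noetherian_polys_with_ideal[OF V(1)])
    have iI: "ideal_in (polys V) ?I" and iJ: "ideal_in (polys V) ?J"
      using ideal_face_ideal G(2) D(2) by blast+
    have IJ: "?I \<subseteq> ?J" by (rule face_ideal_antimono[OF sub])
    have cardG: "card \<sigma> \<le> s" if "\<sigma> \<in> \<Gamma>" for \<sigma> using that by (simp add: \<Gamma>_def)
    have ne: "\<Gamma> \<noteq> {}" using sub assms(2) by blast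
    have depthI: "depth_ge (irrelevant V) s (polys V) ?I"
    proof (rule depth_ge_skeleton[OF V(1) _ G(2)])
      show "s \<le> card V" unfolding s_def using V by (rule card_mono)
    qed (auto simp: \<Gamma>_def)
    have "enat s \<le> sr_depth TYPE('k) \<Delta> + 1"
      using sr_dim_ge[OF assms(1) F(1), where 'k = 'k] depth unfolding s_def by (rule order_trans)
    then have "enat (s - 1) \<le> sr_depth TYPE('k) \<Delta>"
      by (cases "sr_depth TYPE('k) \<Delta>") (auto simp: one_enat_def)
    then have "depth_ge (irrelevant V) (s - 1) (polys V) ?J"
      unfolding V_def by (rule sr_depth_ge_imp[OF assms(1)])
    \<comment> \<open>For s = 0 the claim is trivial; otherwise the depth lemma is applied with s =
      Suc (s - 1), the middle term having depth s and the cokernel depth s - 1.\<close>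
    then have depthJI: "depth_ge (irrelevant V) s ?J ?I"
      using depthI depth_lemma_kernel[OF ideal_polys iJ iI IJ face_ideal_subset, of "s - 1"] by (cases s) simp_all
    have "cohen_macaulay_complex TYPE('k) \<Gamma>"
    proof -
      have "enat s \<le> sr_depth TYPE('k) \<Gamma>" using sr_depth_ge[OF sc ne] depthI unfolding U by blast
      moreover have "sr_dim TYPE('k) \<Gamma> \<le> enat s" by (rule sr_dim_le[OF sc cardG])
      ultimately show ?thesis
        unfolding cohen_macaulay_complex_def using sr_depth_le_sr_dim[OF sc ne, where 'k = 'k] by (meson antisym order_trans)
    qed
    moreover have "relative_cohen_macaulay TYPE('k) \<Gamma> \<Delta>"
      unfolding relative_cohen_macaulay_iff[OF sc D(2) sub] U
    proof (rule disj_imp[THEN iffD2], rule impI, rule antisym)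
      let ?A = "{r \<in> polys V. \<forall>z\<in>?J. r * z \<in> ?I}"
      assume "?J \<noteq> ?I"
      then have lt: "face_exps V \<Gamma> \<subset> face_exps V \<Delta>" using sub by (auto simp: face_exps_def)
      have iA: "ideal_in (polys V) ?A" by (rule ideal_annihilator[OF iI iJ])
      have "enat s \<le> module_depth (poly_ring V) (irrelevant V :: ('v, 'k) mpoly set) (quotient_module (poly_ring V) ?J ?I)"
        by (rule module_depth_ge_monomial[OF V(1) monomial_ideal_face[OF D(2)] monomial_ideal_face[OF G(2)] lt depthJI])
      \<comment> \<open>The annihilator contains \<open>?I\<close>, and the faces of \<Gamma> have
        at most s vertices. Together with the depth bound this is the nontrivial half of the
        equality.\<close>
      moreover have "krull_dim (poly_ring V Quot ?A) \<le> enat s"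
      proof (rule krull_dim_le_card[OF V(1) _ cardG iA])
        show "\<Gamma> \<subseteq> Pow V" by (auto simp: \<Gamma>_def)
        show "?I \<subseteq> ?A"
          using face_ideal_subset[of V \<Gamma>] polys.idealD(5)[OF iI] polys.idealD(6)[OF iJ] by blast
      qed
      ultimately show "krull_dim (poly_ring V Quot ?A) \<le>
        module_depth (poly_ring V) (irrelevant V :: ('v, 'k) mpoly set) (quotient_module (poly_ring V) ?J ?I)"
        by (rule order_trans[rotated])
      \<comment> \<open>A monomial that is nonzero in the relative module. The annihilator kills it,
        so the primes produced from a regular sequence on this module lie above the
        annihilator.\<close>
      obtain e where e: "e \<in> face_exps V \<Delta>" "e \<notin> face_exps V \<Gamma>" using lt by blast
      then have e1: "Poly_Mapping.single e 1 \<in> ?J" by simp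
      show "module_depth (poly_ring V) (irrelevant V :: ('v, 'k) mpoly set) (quotient_module (poly_ring V) ?J ?I)
        \<le> krull_dim (poly_ring V Quot ?A)"
      proof (rule module_depth_le[OF iI iJ IJ])
        fix n assume "depth_ge (irrelevant V) n ?J ?I"
        then show "enat n \<le> krull_dim (poly_ring V Quot ?A)"
          by (rule depth_le_krull_dim[OF V(1) iJ monomial_ideal_face[OF G(2)] IJ _ e1 e(2) iA]) (use e1 in blast)
      qed
    qed
    moreover have "complex_dim \<Gamma> = complex_dim \<Delta>"
      using complex_dim_eq[OF G(4), of F] sub F(1) cardG cdim unfolding s_def by auto
    ultimately show "\<exists>\<Gamma>. cm_extender TYPE('k) \<Delta> \<Gamma>" using sc sub unfolding cm_extender_def by blast
  }
qed

end
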